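(* Let $\nu>0$. The transform $\mathcal{R}^\nu=(\mathcal{B}^{1,\nu})^{-1}\circ Proj\circ(\mathcal{B}^{2,\nu})^{-1}$, defined on the whole of $\mathcal{F}^{2,\nu}(\mathbb{C}^2)$ with values in $L^{2,\nu}(\mathbb{R},\mathbb{C})$, is a left inverse of $\mathcal{G}^\nu$: $\mathcal{R}^\nu\circ\mathcal{G}^\nu=\mathrm{id}_{L^{2,\nu}(\mathbb{R},\mathbb{C})}$. Moreover, for every $F\in\mathcal{F}^{2,\nu}(\mathbb{C}^2)$ we have $$\mathcal{R}^\nu F=\left(\frac{\pi}{\nu}\right)^{\frac12}(\mathcal{B}^{1,\nu})^{-1}(\mathcal{C}_{\psi_2}F),\qquad \mathcal{C}_{\psi_2}F=F\circ\psi_2,\quad \psi_2(\xi)=\left(\frac{\xi}{\sqrt2},-i\frac{\xi}{\sqrt2}\right),$$ which explicitly reads $$\mathcal{R}^\nu F(x)=\left(\frac{\nu}{\pi}\right)^{\frac14}\int_{\mathbb{C}}F\left(\frac{\xi}{\sqrt2},-i\frac{\xi}{\sqrt2}\right)e^{-\frac{\nu}{2}\overline{\xi}^2+\sqrt2\,\nu x\overline{\xi}}\,e^{-\nu|\xi|^2}\,d\lambda(\xi).$$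
   Context: Let $\nu>0$. $L^{2,\nu}(\mathbb{R}^d,\mathbb{C})$ is the Hilbert space of $\mathbb{C}$-valued functions on $\mathbb{R}^d$ that are square integrable with respect to $e^{-\nu|x|^2}dx$. $L^{2,\nu}(\mathbb{C}^d,\mathbb{C})$ is the analogous space on $\mathbb{C}^d$ for $e^{-\nu|z|^2}d\lambda$, with $d\lambda$ the Lebesgue measure. The Bargmann-Fock space is $\mathcal{F}^{2,\nu}(\mathbb{C}^d)=Hol(\mathbb{C}^d)\cap L^{2,\nu}(\mathbb{C}^d,\mathbb{C})$, where $Hol(\mathbb{C}^d)$ denotes the holomorphic functions on $\mathbb{C}^d$. The space $L^{2,\nu}(\mathbb{R}^2,\mathbb{C})$ is identified with $L^{2,\nu}(\mathbb{C},\mathbb{C})$ through $(x,y)\leftrightarrow x+iy$. The $d$-dimensional Segal-Bargmann transform, a unitary isomorphism from $L^{2,\nu}(\mathbb{R}^d,\mathbb{C})$ onto $\mathcal{F}^{2,\nu}(\mathbb{C}^d)$, is $$\mathcal{B}^{d,\nu}f(z)=\left(\frac{\nu}{\pi}\right)^{\frac{3d}{4}}\int_{\mathbb{R}^d}f(x)\,e^{-\nu\left(x-\frac{z}{\sqrt2}\right)^2}dx,\qquad u^2:=u_1^2+\cdots+u_d^2\ \text{ for } u\in\mathbb{C}^d.$$ The map $Proj$ is the orthogonal projection from $L^{2,\nu}(\mathbb{C},\mathbb{C})$ onto $\mathcal{F}^{2,\nu}(\mathbb{C})$, given by $Proj f(\xi)=\frac{\nu}{\pi}\int_{\mathbb{C}}f(\zeta)e^{\nu\xi\overline{\zeta}}e^{-\nu|\zeta|^2}d\lambda(\zeta)$.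 The transform $\mathcal{G}^\nu:L^{2,\nu}(\mathbb{R},\mathbb{C})\to\mathcal{F}^{2,\nu}(\mathbb{C}^2)$ is $$\mathcal{G}^\nu f(z,w)=\left(\frac{\nu}{\pi}\right)^{\frac12}(\mathcal{B}^{1,\nu}f)\left(\frac{z+iw}{\sqrt2}\right).$$
   Formalization: The explicit integral over ℂ need not converge absolutely (e.g. F=𝒢f, f an interval indicator); it is proved as the L^{2,ν}(ℝ)-limit of integrals over discs |ξ|≤r, for every F, and literally for a.e. x at which the integrand is absolutely integrable. *)

theory Defs
  imports "HOL-Complex_Analysis.Complex_Analysis"
begin

text \<open>
  Functions stand for their almost-everywhere classes: \<open>L2w \<nu>\<close> consists of the (Borel)
  representatives of the classes in \<open>L\<^sup>2\<^sup>,\<^sup>\<nu>\<close>, over any Euclidean space, and equality in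
  \<open>L\<^sup>2\<^sup>,\<^sup>\<nu>\<close> is equality almost everywhere.
\<close>

definition L2w :: "real \<Rightarrow> ('a::euclidean_space \<Rightarrow> complex) set" where
  "L2w \<nu> = {f. f \<in> borel_measurable lborel \<and>
               integrable lborel (\<lambda>x. (norm (f x))\<^sup>2 * exp (- \<nu> * (norm x)\<^sup>2))}"

definition inner_w ::
  "real \<Rightarrow> ('a::euclidean_space \<Rightarrow> complex) \<Rightarrow> ('a \<Rightarrow> complex) \<Rightarrow> complex" where
  "inner_w \<nu> f g =
     (LINT x|lborel. f x * cnj (g x) * complex_of_real (exp (- \<nu> * (norm x)\<^sup>2)))"

text \<open>
  Entire functions on \<open>\<complex>\<^sup>d\<close>: complex differentiable, i.e. with a complex linear Frechet
  derivative at every point (\<open>holomorphic_on\<close> only covers one variable).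
\<close>

definition entire_vec :: "(complex^'d \<Rightarrow> complex) \<Rightarrow> bool" where
  "entire_vec F \<longleftrightarrow>
     (\<forall>z. \<exists>L. (F has_derivative L) (at z) \<and> (\<forall>c v. L (c *s v) = c * L v))"

definition fock :: "real \<Rightarrow> (complex^'d \<Rightarrow> complex) set" where
  "fock \<nu> = {F. entire_vec F} \<inter> L2w \<nu>"

definition fock1 :: "real \<Rightarrow> (complex \<Rightarrow> complex) set" where
  "fock1 \<nu> = {\<phi>. \<phi> holomorphic_on UNIV} \<inter> L2w \<nu>"

definition segal_bargmann ::
  "real \<Rightarrow> (real^'d \<Rightarrow> complex) \<Rightarrow> (complex^'d \<Rightarrow> complex)" where
  "segal_bargmann \<nu> f z =
     complex_of_real ((\<nu> / pi) powr (3 * real CARD('d) / 4)) *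
     (LINT x|lborel. f x *
        exp (- complex_of_real \<nu> *
             (\<Sum>i\<in>UNIV. (complex_of_real (x $ i) - z $ i / complex_of_real (sqrt 2))\<^sup>2)))"

text \<open>The case \<open>d = 1\<close>, with \<open>\<real>\<^sup>1\<close> and \<open>\<complex>\<^sup>1\<close> identified with \<open>\<real>\<close> and \<open>\<complex>\<close>.\<close>

definition segal_bargmann1 :: "real \<Rightarrow> (real \<Rightarrow> complex) \<Rightarrow> (complex \<Rightarrow> complex)" where
  "segal_bargmann1 \<nu> f z = segal_bargmann \<nu> (\<lambda>x::real^1. f (x $ 1)) (vec z)"

text \<open>
  The inverses pick a representative of the preimage, which is determined only up to equality
  almost everywhere.
\<close>

definition segal_bargmann_inv ::
  "real \<Rightarrow> (complex^'d \<Rightarrow> complex) \<Rightarrow> (real^'d \<Rightarrow> complex)" where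
  "segal_bargmann_inv \<nu> = inv_into (L2w \<nu>) (segal_bargmann \<nu>)"

definition segal_bargmann1_inv :: "real \<Rightarrow> (complex \<Rightarrow> complex) \<Rightarrow> (real \<Rightarrow> complex)" where
  "segal_bargmann1_inv \<nu> = inv_into (L2w \<nu>) (segal_bargmann1 \<nu>)"

text \<open>
  The orthogonal projection of \<open>L\<^sup>2\<^sup>,\<^sup>\<nu>(\<complex>)\<close> onto the Fock space. Entire functions that agree
  almost everywhere are equal, so the description is unique as a function.
\<close>

definition fock_proj :: "real \<Rightarrow> (complex \<Rightarrow> complex) \<Rightarrow> (complex \<Rightarrow> complex)" where
  "fock_proj \<nu> f =
     (THE \<phi>. \<phi> \<in> fock1 \<nu> \<and> (\<forall>h\<in>fock1 \<nu>. inner_w \<nu> (\<lambda>\<zeta>. f \<zeta> - \<phi> \<zeta>) h = 0))"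

text \<open>The identification \<open>(x, y) \<leftrightarrow> x + \<i>y\<close> of functions on \<open>\<real>\<^sup>2\<close> with functions on \<open>\<complex>\<close>.\<close>

definition on_complex :: "(real^2 \<Rightarrow> complex) \<Rightarrow> (complex \<Rightarrow> complex)" where
  "on_complex g \<zeta> = g (vector [Re \<zeta>, Im \<zeta>])"

definition G_transform :: "real \<Rightarrow> (real \<Rightarrow> complex) \<Rightarrow> (complex^2 \<Rightarrow> complex)" where
  "G_transform \<nu> f p =
     complex_of_real ((\<nu> / pi) powr (1 / 2)) *
     segal_bargmann1 \<nu> f ((p $ 1 + \<i> * p $ 2) / complex_of_real (sqrt 2))"

definition R_transform :: "real \<Rightarrow> (complex^2 \<Rightarrow> complex) \<Rightarrow> (real \<Rightarrow> complex)" where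
  "R_transform \<nu> F =
     segal_bargmann1_inv \<nu> (fock_proj \<nu> (on_complex (segal_bargmann_inv \<nu> F)))"

definition psi2 :: "complex \<Rightarrow> complex^2" where
  "psi2 \<xi> = vector [\<xi> / complex_of_real (sqrt 2), - \<i> * (\<xi> / complex_of_real (sqrt 2))]"

definition C_psi2 :: "(complex^2 \<Rightarrow> complex) \<Rightarrow> (complex \<Rightarrow> complex)" where
  "C_psi2 F = F \<circ> psi2"

text \<open>
  The integrand of the explicit formula. As usual for the inverse Segal-Bargmann transform, it
  need not be absolutely integrable over \<open>\<complex>\<close>: its modulus against \<open>F\<close> in the Fock space decays
  in the \<open>Im \<xi>\<close> direction only as a square integrable function. The integral over \<open>\<complex>\<close> is then the
  limit in \<open>L\<^sup>2\<^sup>,\<^sup>\<nu>(\<real>)\<close> of the integrals over the discs \<open>cball 0 r\<close>.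
\<close>

definition R_integrand ::
  "real \<Rightarrow> (complex^2 \<Rightarrow> complex) \<Rightarrow> real \<Rightarrow> complex \<Rightarrow> complex" where
  "R_integrand \<nu> F x \<xi> =
     F (vector [\<xi> / complex_of_real (sqrt 2), - \<i> * (\<xi> / complex_of_real (sqrt 2))]) *
     exp (- complex_of_real (\<nu> / 2) * (cnj \<xi>)\<^sup>2 + complex_of_real (sqrt 2 * \<nu> * x) * cnj \<xi>) *
     complex_of_real (exp (- \<nu> * (norm \<xi>)\<^sup>2))"

lemma lborel_vec1: "distr lborel borel (vec :: real \<Rightarrow> real^1) = lborel"
proof (rule lborel_eqI[symmetric])
  fix l u :: "real^1"
  assume le: "\<And>b. b \<in> Basis \<Longrightarrow> l \<bullet> b \<le> u \<bullet> b"
  have B: "Basis = {axis 1 1 :: real^1}" by (auto simp: Basis_vec_def num1_eq1)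
  have le1: "l $ 1 \<le> u $ 1" using le[of "axis 1 1"] by (simp add: B inner_axis)
  have "vec -` box l u = box (l $ 1) (u $ 1)"
    by (auto simp: mem_box B inner_axis)
  moreover have "(vec :: real \<Rightarrow> real^1) \<in> borel_measurable lborel"
  proof -
    have "continuous_on UNIV (vec :: real \<Rightarrow> real^1)"
      unfolding vec_def by (intro continuous_intros)
    thus ?thesis using borel_measurable_continuous_onI by simp
  qed
  ultimately show "emeasure (distr lborel borel vec) (box l u) = (\<Prod>b\<in>Basis. (u - l) \<bullet> b)"
    using le1 by (simp add: emeasure_distr B inner_axis)
qed simp

lemma segal_bargmann1_eq:
  assumes "f \<in> borel_measurable borel"
  shows "segal_bargmann1 \<nu> f z = complex_of_real ((\<nu> / pi) powr (3 / 4)) *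
     (LINT x|lborel. f x *
        exp (- complex_of_real \<nu> * (complex_of_real x - z / complex_of_real (sqrt 2))\<^sup>2))"
proof -
  have v: "(vec :: real \<Rightarrow> real^1) \<in> borel_measurable lborel"
  proof -
    have "continuous_on UNIV (vec :: real \<Rightarrow> real^1)"
      unfolding vec_def by (intro continuous_intros)
    thus ?thesis using borel_measurable_continuous_onI by simp
  qed
  have m: "(\<lambda>x::real^1. x $ 1) \<in> borel_measurable borel"
    by (intro borel_measurable_continuous_onI continuous_intros)
  have [measurable]: "(\<lambda>x::real^1. f (x $ 1)) \<in> borel_measurable borel"
    using measurable_compose[OF m assms] .
  note m[measurable]
  show ?thesis
    unfolding segal_bargmann1_def segal_bargmann_def
    by (subst lborel_vec1[symmetric], subst integral_distr[OF v]) (simp_all add: UNIV_1)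
qed

end

theory Submission
  imports Defs "HOL-Probability.Levy"
begin

text \<open>
  Square completion identifies the integral defining \<open>Proj g (\<xi>)\<close>, up to the factor
  \<open>(\<pi>/\<nu>)\<^bsup>1/2\<^esup>\<close>, with the two-dimensional transform of \<open>g\<close> at \<open>\<psi>\<^sub>2 (\<xi>)\<close>. Since
  \<open>\<psi>\<^sub>2\<close> is a right inverse of \<open>(z, w) \<mapsto> (z + \<i>w)/\<surd>2\<close>, everything reduces to the
  surjectivity of the Segal-Bargmann transforms and their injectivity in dimension one. Surjectivity comes from the reproducing formula of
  the Fock space (the mean value property averaged over the Gaussian): the adjoint transform of the
  truncations of \<open>F\<close> to balls is Cauchy in \<open>L\<^sup>2\<close> and its limit is a preimage of \<open>F\<close>, which is also the
  explicit formula for the inverse. Injectivity is that of the Fourier transform.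
\<close>

section \<open>Square integrable functions\<close>

text \<open>\<open>R_transform\<close> uses arbitrarily chosen preimages, so nothing may depend on
  the choice. In dimension two this holds because the projection of \<open>on_complex g\<close>
  depends only on the values of \<open>segal_bargmann \<nu> g\<close> on the isotropic line p_1^2 +
  p_2^2 = 0 that \<open>psi2\<close> parametrises; in dimension one injectivity makes the result
  unique almost everywhere. The obstacle is that the integral of the explicit formula, the adjoint
  of the one-dimensional transform, need not converge absolutely. It is therefore first taken over
  balls, where the kernel is square integrable in both variables together and Fubini is available,
  and then extended by a norm estimate with an explicit tail rate for all real radii. The
  reproducing formula makes the Gram kernel of the transform idempotent, and idempotence yields the
  norm estimate without an orthonormal basis of Hermite functions. One abstract argument serves
  three times: for the transform in dimension d, for the one on the real line, and for the
  reproducing kernel itself, where it gives the orthogonal projection.\<close>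

definition L2 :: "'a measure \<Rightarrow> ('a \<Rightarrow> complex) set" where
  "L2 M = {f \<in> borel_measurable M. integrable M (\<lambda>x. (norm (f x))\<^sup>2)}"

definition nsq :: "'a measure \<Rightarrow> ('a \<Rightarrow> complex) \<Rightarrow> real" where
  "nsq M f = (LINT x|M. (norm (f x))\<^sup>2)"

lemma L2I: "f \<in> borel_measurable M \<Longrightarrow> integrable M (\<lambda>x. (norm (f x))\<^sup>2) \<Longrightarrow> f \<in> L2 M"
  by (simp add: L2_def)

lemma L2_measurable: "f \<in> L2 M \<Longrightarrow> f \<in> borel_measurable M"
  by (simp add: L2_def)

lemma L2_integrable: "f \<in> L2 M \<Longrightarrow> integrable M (\<lambda>x. (norm (f x))\<^sup>2)"
  by (simp add: L2_def)

lemma nsq_nonneg [simp]: "nsq M f \<ge> 0"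
  by (simp add: nsq_def)

lemma nsq_cnj [simp]: "nsq M (\<lambda>x. cnj (f x)) = nsq M f"
  by (simp add: nsq_def)

section \<open>Vector space structure and the Cauchy-Schwarz inequality\<close>

lemma L2_integrable_norm_mult:
  assumes f: "f \<in> L2 M" and g: "g \<in> L2 M"
  shows "integrable M (\<lambda>x. norm (f x) * norm (g x))"
proof (rule Bochner_Integration.integrable_bound)
  show "integrable M (\<lambda>x. (norm (f x))\<^sup>2 + (norm (g x))\<^sup>2)"
    using f g by (simp add: L2_def)
  show "(\<lambda>x. norm (f x) * norm (g x)) \<in> borel_measurable M"
    using f g by (auto simp: L2_def)
  have "a * b \<le> a\<^sup>2 + b\<^sup>2" if "a \<ge> 0" "b \<ge> 0" for a b :: real
    using sum_squares_bound[of a b] that mult_nonneg_nonneg[of a b] by linarith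
  thus "AE x in M. norm (norm (f x) * norm (g x)) \<le> norm ((norm (f x))\<^sup>2 + (norm (g x))\<^sup>2)"
    by (intro AE_I2) simp
qed

lemma L2_integrable_mult:
  assumes "f \<in> L2 M" and "g \<in> L2 M"
  shows "integrable M (\<lambda>x. f x * g x)"
  by (rule Bochner_Integration.integrable_bound[OF L2_integrable_norm_mult[OF assms]])
     (use assms in \<open>auto simp: L2_def norm_mult\<close>)

lemma borel_measurable_cnj [measurable]: "cnj \<in> borel_measurable borel"
  by (intro borel_measurable_continuous_onI continuous_intros)

lemma L2_cnj: "f \<in> L2 M \<Longrightarrow> (\<lambda>x. cnj (f x)) \<in> L2 M"
  by (auto simp: L2_def intro: measurable_compose[OF _ borel_measurable_cnj])

lemma L2_cmult: "f \<in> L2 M \<Longrightarrow> (\<lambda>x. c * f x) \<in> L2 M"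
  by (auto simp: L2_def norm_mult power_mult_distrib)

text \<open>Squares are kept throughout instead of norms, so this bound takes the place of
  Minkowski's inequality. It is the origin of the factor 2 in \<open>T_limit\<close>.\<close>

lemma norm_add_squared_le: "(norm (a + b))\<^sup>2 \<le> 2 * (norm a)\<^sup>2 + 2 * (norm (b::'a::real_normed_vector))\<^sup>2"
proof -
  have "(norm (a + b))\<^sup>2 \<le> (norm a + norm b)\<^sup>2"
    by (intro power_mono norm_triangle_ineq) simp
  also have "\<dots> \<le> 2 * (norm a)\<^sup>2 + 2 * (norm b)\<^sup>2"
    using sum_squares_bound[of "norm a" "norm b"] by (simp add: power2_sum)
  finally show ?thesis .
qed

lemma L2_add:
  assumes "f \<in> L2 M" "g \<in> L2 M"
  shows "(\<lambda>x. f x + g x) \<in> L2 M"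
proof (rule L2I)
  show "integrable M (\<lambda>x. (norm (f x + g x))\<^sup>2)"
  proof (rule Bochner_Integration.integrable_bound)
    show "integrable M (\<lambda>x. 2 * (norm (f x))\<^sup>2 + 2 * (norm (g x))\<^sup>2)"
      using assms by (simp add: L2_def)
  qed (use assms in \<open>auto simp: L2_def intro!: AE_I2 norm_add_squared_le\<close>)
qed (use assms in \<open>auto simp: L2_def\<close>)

lemma L2_diff:
  assumes "f \<in> L2 M" "g \<in> L2 M"
  shows "(\<lambda>x. f x - g x) \<in> L2 M"
  using L2_add[OF assms(1) L2_cmult[OF assms(2), of "-1"]] by simp

lemma nsq_add_le:
  assumes "f \<in> L2 M" "g \<in> L2 M"
  shows "nsq M (\<lambda>x. f x + g x) \<le> 2 * nsq M f + 2 * nsq M g"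
proof -
  have "nsq M (\<lambda>x. f x + g x) \<le> (LINT x|M. 2 * (norm (f x))\<^sup>2 + 2 * (norm (g x))\<^sup>2)"
    unfolding nsq_def using L2_integrable[OF L2_add[OF assms]] assms
    by (intro integral_mono norm_add_squared_le) (auto simp: L2_def)
  thus ?thesis using assms by (simp add: nsq_def L2_def)
qed

text \<open>The discriminant criterion, read off at the vertex c / b of the parabola. For b = 0
  there is no vertex, but a nonconstant affine function is unbounded below.\<close>

lemma quadratic_nonneg_imp:
  fixes a b c :: real
  assumes "\<And>t. 0 \<le> a - 2 * t * c + t\<^sup>2 * b" and "b \<ge> 0"
  shows "c\<^sup>2 \<le> a * b"
proof (cases "b = 0")
  case True
  have "c = 0"
  proof (rule ccontr)
    assume "c \<noteq> 0"
    \<comment> \<open>At this t the affine function a - 2tc has the value -1.\<close>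
    with assms(1)[of "(a + 1) / (2 * c)"] True show False by (simp add: field_simps)
  qed
  thus ?thesis using True by simp
next
  case False
  hence b: "b > 0" using assms(2) by simp
  have "0 \<le> a - 2 * (c / b) * c + (c / b)\<^sup>2 * b" by (rule assms(1))
  also have "\<dots> = a - c\<^sup>2 / b" using b by (simp add: field_simps power2_eq_square)
  finally show ?thesis using b by (simp add: field_simps)
qed

text \<open>With moduli the integral of (|f| - t|g|)^2 is a real polynomial in t, so no phase has to
  be chosen.\<close>

lemma L2_Cauchy_Schwarz_norm:
  assumes f: "f \<in> L2 M" and g: "g \<in> L2 M"
  shows "(LINT x|M. norm (f x) * norm (g x))\<^sup>2 \<le> nsq M f * nsq M g"
proof (rule quadratic_nonneg_imp)
  fix t :: real
  note [simp] = L2_integrable[OF f] L2_integrable[OF g] L2_integrable_norm_mult[OF f g]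
  have "0 \<le> (LINT x|M. (norm (f x) - t * norm (g x))\<^sup>2)" by simp
  also have "\<dots> = (LINT x|M. (norm (f x))\<^sup>2 - 2 * t * (norm (f x) * norm (g x)) + t\<^sup>2 * (norm (g x))\<^sup>2)"
    by (simp add: power2_diff power_mult_distrib algebra_simps)
  also have "\<dots> = nsq M f - 2 * t * (LINT x|M. norm (f x) * norm (g x)) + t\<^sup>2 * nsq M g"
    by (simp add: nsq_def)
  finally show "0 \<le> \<dots>" .
qed simp

lemma L2_Cauchy_Schwarz:
  assumes f: "f \<in> L2 M" and g: "g \<in> L2 M"
  shows "(norm (LINT x|M. f x * g x))\<^sup>2 \<le> nsq M f * nsq M g"
proof -
  have "norm (LINT x|M. f x * g x) \<le> (LINT x|M. norm (f x * g x))"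
    by (rule integral_norm_bound)
  hence "(norm (LINT x|M. f x * g x))\<^sup>2 \<le> (LINT x|M. norm (f x) * norm (g x))\<^sup>2"
    by (intro power_mono) (auto simp: norm_mult)
  also have "\<dots> \<le> nsq M f * nsq M g" by (rule L2_Cauchy_Schwarz_norm[OF assms])
  finally show ?thesis .
qed

section \<open>Finite measures, limits and completeness\<close>

lemma (in finite_measure) L2_bounded:
  assumes "f \<in> borel_measurable M" "\<And>x. norm (f x) \<le> C"
  shows "f \<in> L2 M"
proof (rule L2I)
  have "(norm (f x))\<^sup>2 \<le> C\<^sup>2" for x using assms(2)[of x] by (intro power_mono) auto
  thus "integrable M (\<lambda>x. (norm (f x))\<^sup>2)"
    using assms by (intro integrable_const_bound[where B = "C\<^sup>2"]) auto
qed (use assms in auto)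

lemma (in finite_measure) L2_imp_integrable:
  assumes "f \<in> L2 M"
  shows "integrable M f"
  using L2_integrable_mult[OF assms L2_bounded[of "\<lambda>_. 1" 1]] by simp

lemma nsq_eq_0_imp_AE:
  assumes "f \<in> L2 M" "nsq M f = 0"
  shows "AE x in M. f x = 0"
proof -
  have "AE x in M. (norm (f x))\<^sup>2 = 0"
    using assms integral_nonneg_eq_0_iff_AE[of M "\<lambda>x. (norm (f x))\<^sup>2"] by (auto simp: nsq_def L2_def)
  thus ?thesis by eventually_elim simp
qed

lemma L2_limit_AE_subseq:
  assumes "\<And>n. u n \<in> L2 M" "f \<in> L2 M" "(\<lambda>n. nsq M (\<lambda>x. u n x - f x)) \<longlonglongrightarrow> 0"
  shows "\<exists>r::nat\<Rightarrow>nat. strict_mono r \<and> (AE x in M. (\<lambda>n. u (r n) x) \<longlonglongrightarrow> f x)"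
proof -
  have "\<exists>r::nat\<Rightarrow>nat. strict_mono r \<and> (AE x in M. (\<lambda>n. (norm (u (r n) x - f x))\<^sup>2) \<longlonglongrightarrow> 0)"
  proof (rule tendsto_L1_AE_subseq)
    show "(\<lambda>n. LINT x|M. norm ((norm (u n x - f x))\<^sup>2)) \<longlonglongrightarrow> 0"
      using assms(3) by (simp add: nsq_def)
    show "integrable M (\<lambda>x. (norm (u n x - f x))\<^sup>2)" for n
      by (rule L2_integrable[OF L2_diff[OF assms(1,2)]])
  qed
  then obtain r :: "nat \<Rightarrow> nat" where r: "strict_mono r"
      "AE x in M. (\<lambda>n. (norm (u (r n) x - f x))\<^sup>2) \<longlonglongrightarrow> 0" by blast
  have "AE x in M. (\<lambda>n. u (r n) x) \<longlonglongrightarrow> f x"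
    using r(2)
  proof eventually_elim
    case (elim x)
    have "(\<lambda>n. sqrt ((norm (u (r n) x - f x))\<^sup>2)) \<longlonglongrightarrow> sqrt 0"
      by (intro tendsto_real_sqrt elim)
    thus ?case by (simp add: LIM_zero_iff tendsto_norm_zero_iff)
  qed
  with r(1) show ?thesis by blast
qed

text \<open>Strong convergence implies weak convergence. Identities known for truncations pass to
  the limit in this way.\<close>

lemma L2_mult_limit:
  assumes "\<And>n. u n \<in> L2 M" "f \<in> L2 M" "g \<in> L2 M" "(\<lambda>n. nsq M (\<lambda>x. u n x - f x)) \<longlonglongrightarrow> 0"
  shows "(\<lambda>n. LINT x|M. u n x * g x) \<longlonglongrightarrow> (LINT x|M. f x * g x)"
proof -
  have eq: "(LINT x|M. u n x * g x) - (LINT x|M. f x * g x) = (LINT x|M. (u n x - f x) * g x)" for n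
    using assms by (simp add: left_diff_distrib L2_integrable_mult)
  have "(\<lambda>n. (norm (LINT x|M. (u n x - f x) * g x))\<^sup>2) \<longlonglongrightarrow> 0"
  proof (rule tendsto_sandwich[OF _ _ tendsto_const])
    show "(\<lambda>n. nsq M (\<lambda>x. u n x - f x) * nsq M g) \<longlonglongrightarrow> 0"
      using tendsto_mult_right[OF assms(4), of "nsq M g"] by (simp add: mult.commute)
    show "\<forall>\<^sub>F n in sequentially. (norm (LINT x|M. (u n x - f x) * g x))\<^sup>2
            \<le> nsq M (\<lambda>x. u n x - f x) * nsq M g"
      using assms by (intro always_eventually allI L2_Cauchy_Schwarz L2_diff) auto
  qed auto
  hence "(\<lambda>n. sqrt ((norm (LINT x|M. (u n x - f x) * g x))\<^sup>2)) \<longlonglongrightarrow> sqrt 0"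
    by (rule tendsto_real_sqrt)
  hence "(\<lambda>n. (LINT x|M. u n x * g x) - (LINT x|M. f x * g x)) \<longlonglongrightarrow> 0"
    unfolding eq by (simp add: tendsto_norm_zero_iff)
  thus ?thesis by (simp add: LIM_zero_iff)
qed

text \<open>Riesz-Fischer with a rate: by Fatou's lemma the limit inherits the bound on the Cauchy
  differences, so that tail estimates survive the passage to the limit.\<close>

lemma (in finite_measure) L2_complete:
  fixes u :: "nat \<Rightarrow> 'a \<Rightarrow> complex"
  assumes u: "\<And>n. u n \<in> L2 M"
    and d: "d \<longlonglongrightarrow> 0" "\<And>m n. m \<le> n \<Longrightarrow> nsq M (\<lambda>x. u n x - u m x) \<le> d m"
  obtains f where "f \<in> L2 M" "\<And>n. nsq M (\<lambda>x. u n x - f x) \<le> d n"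
proof -
  define s :: real where "s = sqrt (nsq M (\<lambda>_. 1))"
  have "\<exists>N. \<forall>n\<ge>N. d n < (1/4) ^ k" for k
    using order_tendstoD(2)[OF d(1), of "(1/4)^k"] by (simp add: eventually_sequentially)
  \<comment> \<open>The threshold (1/4)^k bounds a squared norm; its root (1/2)^k is
    summable.\<close>
  then obtain N where N: "\<And>k n. n \<ge> N k \<Longrightarrow> d n < (1/4) ^ k" by metis
  \<comment> \<open>Summing the N i makes r monotone and keeps r k above both N k and k.\<close>
  define r where "r k = k + (\<Sum>i\<le>k. N i)" for k
  have rN: "r k \<ge> N k" for k unfolding r_def
    by (simp add: member_le_sum trans_le_add2)
  have rmono: "r k \<le> r (Suc k)" for k unfolding r_def by simp
  have rk: "r k \<ge> k" for k unfolding r_def by simp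
  define v where "v k x = u (r (Suc k)) x - u (r k) x" for k x
  have vL2: "v k \<in> L2 M" for k unfolding v_def by (intro L2_diff u)
  have one: "(\<lambda>_. 1) \<in> L2 M" by (rule L2_bounded[of _ 1]) auto
  \<comment> \<open>Cauchy-Schwarz against the constant 1, square integrable because the measure is
    finite, turns the L2 bounds into summable L1 bounds.\<close>
  have vint: "(LINT x|M. norm (v k x)) \<le> s * (1/2) ^ k" for k
  proof -
    have "(LINT x|M. norm (v k x) * norm (1::complex))\<^sup>2 \<le> nsq M (v k) * nsq M (\<lambda>_. 1)"
      by (rule L2_Cauchy_Schwarz_norm[OF vL2 one])
    also have "\<dots> \<le> (1/4) ^ k * nsq M (\<lambda>_. 1)"
      using d(2)[OF rmono[of k]] N[OF rN[of k]] unfolding v_def by (intro mult_right_mono) auto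
    also have "\<dots> = (s * (1/2) ^ k)\<^sup>2"
      by (simp add: s_def power_mult_distrib power_divide power2_eq_square flip: power_mult_distrib)
    finally have "(LINT x|M. norm (v k x))\<^sup>2 \<le> (s * (1/2) ^ k)\<^sup>2" by simp
    moreover have "s \<ge> 0" by (simp add: s_def)
    ultimately show ?thesis by (auto intro: power2_le_imp_le)
  qed
  have vm [measurable]: "v k \<in> borel_measurable M" for k using vL2 L2_measurable by blast
  have um [measurable]: "u k \<in> borel_measurable M" for k using u L2_measurable by blast
  have vnn: "(\<integral>\<^sup>+x. norm (v k x) \<partial>M) \<le> ennreal (s * (1/2)^k)" for k
  proof -
    have "(\<integral>\<^sup>+x. norm (v k x) \<partial>M) = ennreal (LINT x|M. norm (v k x))"
      by (rule nn_integral_eq_integral) (use L2_imp_integrable[OF vL2] in auto)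
    thus ?thesis using vint[of k] by (simp add: ennreal_leI)
  qed
  have sum: "summable (\<lambda>k. s * (1/2::real)^k)" by (intro summable_mult summable_geometric) simp
  have s0: "s \<ge> 0" by (simp add: s_def)
  have "(\<integral>\<^sup>+x. (\<Sum>k. ennreal (norm (v k x))) \<partial>M) = (\<Sum>k. \<integral>\<^sup>+x. norm (v k x) \<partial>M)"
    by (intro nn_integral_suminf) simp
  also have "\<dots> \<le> (\<Sum>k. ennreal (s * (1/2)^k))"
    by (intro suminf_le vnn) auto
  also have "\<dots> = ennreal (\<Sum>k. s * (1/2)^k)"
    using s0 sum by (intro suminf_ennreal2) auto
  finally have "(\<integral>\<^sup>+x. (\<Sum>k. ennreal (norm (v k x))) \<partial>M) \<noteq> \<infinity>"
    using ennreal_less_top le_less_trans less_irrefl by (metis infinity_ennreal_def)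
  hence "AE x in M. (\<Sum>k. ennreal (norm (v k x))) \<noteq> \<infinity>"
    by (intro nn_integral_noteq_infinite) auto
  hence conv: "AE x in M. convergent (\<lambda>k. u (r k) x)"
  proof eventually_elim
    case (elim x)
    hence "summable (\<lambda>k. norm (v k x))" by (intro summable_suminf_not_top) auto
    hence "summable (\<lambda>k. v k x)" by (rule summable_norm_cancel)
    hence "convergent (\<lambda>n. \<Sum>k<n. v k x)" by (simp add: summable_iff_convergent)
    hence "convergent (\<lambda>n. u (r n) x - u (r 0) x)"
      using sum_lessThan_telescope[of "\<lambda>k. u (r k) x"] by (simp add: v_def)
    hence "convergent (\<lambda>n. (u (r n) x - u (r 0) x) + u (r 0) x)"
      by (intro convergent_add convergent_const)
    thus ?case by simp
  qed
  \<comment> \<open>Where the subsequence diverges \<open>lim\<close> has an unspecified value, but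
    that happens only on a null set.\<close>
  define f where "f x = lim (\<lambda>k. u (r k) x)" for x
  have fm [measurable]: "f \<in> borel_measurable M" unfolding f_def by measurable
  have bound: "(\<integral>\<^sup>+x. ennreal ((norm (u n x - f x))\<^sup>2) \<partial>M) \<le> ennreal (d n)" for n
  proof -
    have "(\<integral>\<^sup>+x. ennreal ((norm (u n x - f x))\<^sup>2) \<partial>M)
        = (\<integral>\<^sup>+x. liminf (\<lambda>k. ennreal ((norm (u n x - u (r k) x))\<^sup>2)) \<partial>M)"
    proof (rule nn_integral_cong_AE, use conv in eventually_elim)
      case (elim x)
      have "(\<lambda>k. ennreal ((norm (u n x - u (r k) x))\<^sup>2)) \<longlonglongrightarrow> ennreal ((norm (u n x - f x))\<^sup>2)"
        using elim unfolding f_def convergent_LIMSEQ_iff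
        by (intro tendsto_ennrealI tendsto_intros)
      from lim_imp_Liminf[OF trivial_limit_sequentially this] show ?case by simp
    qed
    also have "\<dots> \<le> liminf (\<lambda>k. \<integral>\<^sup>+x. ennreal ((norm (u n x - u (r k) x))\<^sup>2) \<partial>M)"
      by (rule nn_integral_liminf) simp
    also have "\<dots> \<le> liminf (\<lambda>k. ennreal (d n))"
    proof (rule Liminf_mono)
      have "(\<integral>\<^sup>+x. ennreal ((norm (u n x - u (r k) x))\<^sup>2) \<partial>M) \<le> ennreal (d n)" if "k \<ge> n" for k
      proof -
        have "(\<integral>\<^sup>+x. ennreal ((norm (u n x - u (r k) x))\<^sup>2) \<partial>M)
            = ennreal (nsq M (\<lambda>x. u (r k) x - u n x))"
          unfolding nsq_def by (subst norm_minus_commute, rule nn_integral_eq_integral)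
             (auto intro: L2_integrable[OF L2_diff[OF u u]])
        also have "\<dots> \<le> ennreal (d n)" using d(2)[of n "r k"] that rk[of k] by (intro ennreal_leI) auto
        finally show ?thesis .
      qed
      thus "\<forall>\<^sub>F k in sequentially. (\<integral>\<^sup>+x. ennreal ((norm (u n x - u (r k) x))\<^sup>2) \<partial>M) \<le> ennreal (d n)"
        using eventually_sequentially by blast
    qed
    also have "\<dots> = ennreal (d n)" by (simp add: Liminf_const)
    finally show ?thesis .
  qed
  have uf: "(\<lambda>x. u n x - f x) \<in> L2 M" for n
    by (rule L2I) (use bound[of n] in \<open>auto simp: integrable_iff_bounded intro: le_less_trans\<close>)
  have "f \<in> L2 M" using L2_diff[OF u[of 0] uf[of 0]] by simp
  moreover have "nsq M (\<lambda>x. u n x - f x) \<le> d n" for n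
  proof -
    have "ennreal (nsq M (\<lambda>x. u n x - f x)) = (\<integral>\<^sup>+x. ennreal ((norm (u n x - f x))\<^sup>2) \<partial>M)"
      unfolding nsq_def by (rule nn_integral_eq_integral[symmetric]) (use L2_integrable[OF uf] in auto)
    also have "\<dots> \<le> ennreal (d n)" by (rule bound)
    finally have "ennreal (nsq M (\<lambda>x. u n x - f x)) \<le> ennreal (d n)" .
    moreover have "d n \<ge> 0" using d(2)[of n n] by (simp add: nsq_def)
    ultimately show ?thesis by (simp add: ennreal_le_iff)
  qed
  ultimately show ?thesis by (rule that)
qed

section \<open>Gaussian integrals and isometries\<close>

lemma nn_integral_gaussian_real:
  assumes "\<nu> > 0"
  shows "(\<integral>\<^sup>+x. ennreal (exp (- \<nu> * x\<^sup>2)) \<partial>lborel) = ennreal (sqrt (pi / \<nu>))"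
proof -
  have *: "exp (- \<nu> * x\<^sup>2) = sqrt (pi / \<nu>) * normal_density 0 (1 / sqrt (2 * \<nu>)) x" for x
    using assms by (simp add: normal_density_def real_sqrt_divide real_sqrt_mult power_divide field_simps)
  have "(\<integral>\<^sup>+x. ennreal (exp (- \<nu> * x\<^sup>2)) \<partial>lborel)
      = ennreal (LINT x|lborel. sqrt (pi / \<nu>) * normal_density 0 (1 / sqrt (2 * \<nu>)) x)"
    unfolding * using assms by (intro nn_integral_eq_integral) auto
  also have "\<dots> = ennreal (sqrt (pi / \<nu>))" using assms by simp
  finally show ?thesis .
qed

lemma norm_squared_eq_sum_Basis: "(norm (x::'a::euclidean_space))\<^sup>2 = (\<Sum>b\<in>Basis. (x \<bullet> b)\<^sup>2)"
  unfolding power2_norm_eq_inner by (subst euclidean_inner) (simp add: power2_eq_square)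

lemma nn_integral_gaussian:
  assumes "\<nu> > 0"
  shows "(\<integral>\<^sup>+x. ennreal (exp (- \<nu> * (norm (x::'a::euclidean_space))\<^sup>2)) \<partial>lborel)
           = ennreal (sqrt (pi / \<nu>) ^ DIM('a))"
proof -
  have "ennreal (exp (- \<nu> * (norm x)\<^sup>2)) = (\<Prod>b\<in>Basis. ennreal (exp (- \<nu> * (x \<bullet> b)\<^sup>2)))" for x :: 'a
    by (simp add: norm_squared_eq_sum_Basis sum_distrib_left exp_sum prod_ennreal sum_negf[symmetric])
  hence "(\<integral>\<^sup>+x. ennreal (exp (- \<nu> * (norm (x::'a))\<^sup>2)) \<partial>lborel)
      = (\<integral>\<^sup>+x. (\<Prod>b\<in>Basis. ennreal (exp (- \<nu> * ((x::'a) \<bullet> b)\<^sup>2))) \<partial>lborel)"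
    by simp
  also have "\<dots> = (\<Prod>b\<in>(Basis::'a set). \<integral>\<^sup>+x. ennreal (exp (- \<nu> * x\<^sup>2)) \<partial>lborel)"
    by (rule nn_integral_lborel_prod) auto
  also have "\<dots> = ennreal (sqrt (pi / \<nu>) ^ DIM('a))"
    using assms by (subst nn_integral_gaussian_real) (auto simp: prod_ennreal ennreal_power)
  finally show ?thesis .
qed

text \<open>
  The uniqueness argument for Haar measure: for an even function \<open>g\<close>, translation invariance
  of both measures and Fubini turn \<open>\<integral>f dN \<cdot> \<integral>g dx\<close> into \<open>\<integral>f dx \<cdot> \<integral>g dN\<close>; the Gaussian \<open>g\<close> has
  the same integral against both.
\<close>

lemma lborel_distr_isometry:
  fixes U :: "'b::euclidean_space \<Rightarrow> 'a::euclidean_space"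
  assumes lin: "linear U" and "surj U" and iso: "\<And>x. norm (U x) = norm x"
  shows "distr lborel borel U = lborel"
proof -
  \<comment> \<open>Equal dimensions give the two Gaussian integrals \<open>gL\<close> and
    \<open>gN\<close> the same value c.\<close>
  have dim: "DIM('b) = DIM('a)"
  proof -
    have "inj U"
      using lin iso by (metis linear_injective_0 norm_eq_zero)
    thus ?thesis
      using \<open>surj U\<close> dim_image_eq[OF lin, of UNIV] by (simp add: dim_UNIV)
  qed
  have Um [measurable]: "U \<in> borel_measurable borel"
    using lin by (intro borel_measurable_continuous_onI linear_continuous_on linear_conv_bounded_linear[THEN iffD1])
  define N where "N = distr lborel borel U"
  define g :: "'a \<Rightarrow> ennreal" where "g x = ennreal (exp (- 1 * (norm x)\<^sup>2))" for x
  have gm [measurable]: "g \<in> borel_measurable borel" unfolding g_def by measurable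
  have sN [measurable_cong]: "sets N = sets borel" by (simp add: N_def)
  define c where "c = ennreal (sqrt (pi / 1) ^ DIM('a))"
  have gL: "(\<integral>\<^sup>+x. g x \<partial>lborel) = c"
    unfolding g_def c_def by (rule nn_integral_gaussian) simp
  have gN: "(\<integral>\<^sup>+x. g x \<partial>N) = c"
    unfolding N_def g_def c_def dim[symmetric]
    by (subst nn_integral_distr) (use nn_integral_gaussian[of 1, where 'a='b] in \<open>simp_all add: iso\<close>)
  have c: "c \<noteq> 0" "c \<noteq> \<infinity>" by (simp_all add: c_def ennreal_eq_0_iff not_le)
  have Linv: "(\<integral>\<^sup>+x. h (x + y) \<partial>lborel) = (\<integral>\<^sup>+x. h x \<partial>lborel)"
    if [measurable]: "h \<in> borel_measurable borel" for h :: "'z::euclidean_space \<Rightarrow> ennreal" and y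
  proof -
    have "(\<integral>\<^sup>+x. h x \<partial>lborel) = (\<integral>\<^sup>+x. h x \<partial>distr lborel borel ((+) y))"
      by (simp only: lborel_distr_plus)
    also have "\<dots> = (\<integral>\<^sup>+x. h (y + x) \<partial>lborel)" by (rule nn_integral_distr) auto
    finally show ?thesis by (simp add: add.commute)
  qed
  have Ninv: "(\<integral>\<^sup>+x. h (x + y) \<partial>N) = (\<integral>\<^sup>+x. h x \<partial>N)"
    if [measurable]: "h \<in> borel_measurable borel" for h y
  proof -
    obtain y' where y': "U y' = y" using \<open>surj U\<close> by (metis surjD)
    have "(\<integral>\<^sup>+x. h (x + y) \<partial>N) = (\<integral>\<^sup>+x. h (U (x + y')) \<partial>lborel)"
      unfolding N_def by (subst nn_integral_distr) (auto simp: linear_add[OF lin] y')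
    also have "\<dots> = (\<integral>\<^sup>+x. h (U x) \<partial>lborel)" by (rule Linv[of "\<lambda>x. h (U x)"]) measurable
    also have "\<dots> = (\<integral>\<^sup>+x. h x \<partial>N)" unfolding N_def by (subst nn_integral_distr) auto
    finally show ?thesis .
  qed
  have sf: "sigma_finite_measure N"
  proof
    have "emeasure N (cball 0 (real n)) = emeasure lborel (cball 0 (real n) :: 'b set)" for n
    proof -
      have "U -` cball 0 (real n) = cball 0 (real n)" by (auto simp: iso)
      thus ?thesis unfolding N_def by (subst emeasure_distr) auto
    qed
    hence "emeasure N (cball 0 (real n)) \<noteq> \<infinity>" for n
      using emeasure_lborel_cball_finite[of 0 "real n"] by (simp add: less_top[symmetric])
    moreover have "(\<Union>n. cball 0 (real n)) = (UNIV :: 'a set)"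
      using real_arch_simple by (auto simp: dist_norm)
    ultimately show "\<exists>A. countable A \<and> A \<subseteq> sets N \<and> \<Union> A = space N \<and> (\<forall>a\<in>A. emeasure N a \<noteq> \<infinity>)"
      by (intro exI[of _ "range (\<lambda>n. cball 0 (real n))"]) (auto simp: N_def)
  qed
  interpret pair_sigma_finite N lborel
    by (intro pair_sigma_finite.intro sf sigma_finite_lborel)
  have key: "(\<integral>\<^sup>+x. f x \<partial>N) = (\<integral>\<^sup>+x. f x \<partial>lborel)" if [measurable]: "f \<in> borel_measurable borel" for f
  proof -
    have "(\<integral>\<^sup>+x. f x \<partial>N) * c = (\<integral>\<^sup>+y. (\<integral>\<^sup>+x. f x \<partial>N) * g y \<partial>lborel)"
      by (simp add: nn_integral_cmult gL)
    also have "\<dots> = (\<integral>\<^sup>+y. (\<integral>\<^sup>+x. f (x + y) * g y \<partial>N) \<partial>lborel)"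
      by (simp add: nn_integral_multc Ninv)
    also have "\<dots> = (\<integral>\<^sup>+x. (\<integral>\<^sup>+y. f (x + y) * g y \<partial>lborel) \<partial>N)"
      by (rule Fubini') measurable
    also have "\<dots> = (\<integral>\<^sup>+x. (\<integral>\<^sup>+y. f y * g (y - x) \<partial>lborel) \<partial>N)"
    proof (rule nn_integral_cong)
      fix x
      show "(\<integral>\<^sup>+y. f (x + y) * g y \<partial>lborel) = (\<integral>\<^sup>+y. f y * g (y - x) \<partial>lborel)"
        using Linv[of "\<lambda>y. f y * g (y - x)" x] by (simp add: add.commute)
    qed
    also have "\<dots> = (\<integral>\<^sup>+y. (\<integral>\<^sup>+x. f y * g (y - x) \<partial>N) \<partial>lborel)"
      by (rule Fubini'[symmetric]) measurable
    \<comment> \<open>Since g is even, g (y - x) is a function of x - y, and the invariance of N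
      removes y.\<close>
    also have "\<dots> = (\<integral>\<^sup>+y. (\<integral>\<^sup>+x. f y * g (x + - y) \<partial>N) \<partial>lborel)"
      by (simp add: g_def norm_minus_commute)
    also have "\<dots> = (\<integral>\<^sup>+y. f y * c \<partial>lborel)"
      by (simp add: nn_integral_cmult Ninv gN del: add_uminus_conv_diff)
    also have "\<dots> = (\<integral>\<^sup>+x. f x \<partial>lborel) * c" by (simp add: nn_integral_multc)
    finally show ?thesis using c by (metis ennreal_mult_cancel_left infinity_ennreal_def mult.commute)
  qed
  have "N = lborel"
  proof (rule measure_eqI)
    fix A assume "A \<in> sets N"
    hence [measurable]: "A \<in> sets borel" by (simp add: N_def)
    show "emeasure N A = emeasure lborel A"
      using key[of "indicator A"] by (simp add: sN)
  qed (simp add: N_def)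
  thus ?thesis by (simp add: N_def)
qed

text \<open>No contour is shifted: the square is completed for the real part of c only, and the
  oscillation left by the imaginary part is the characteristic function of the standard normal
  distribution.\<close>

lemma has_bochner_integral_exp_quadratic:
  fixes c :: complex
  assumes "\<nu> > 0"
  shows "has_bochner_integral lborel (\<lambda>x::real. exp (- complex_of_real \<nu> * (of_real x)\<^sup>2 + c * of_real x))
           (of_real (sqrt (pi / \<nu>)) * exp (c\<^sup>2 / of_real (4 * \<nu>)))"
proof -
  define \<sigma> where "\<sigma> = 1 / sqrt (2 * \<nu>)"
  define t where "t = \<sigma> * Im c"
  define a where "a = Re c / (2 * \<nu>)"
  \<comment> \<open>The mean is a and the standard deviation is \<sigma>. C undoes the normalisation
    of the density and carries the constants \<nu> a^2 and i a Im c that recentring at a leaves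
    behind.\<close>
  define C where "C = complex_of_real (sqrt (2 * pi)) * exp (of_real (\<nu> * a\<^sup>2) + \<i> * of_real (Im c * a))"
  have \<sigma>: "\<sigma> > 0" using assms by (simp add: \<sigma>_def)
  have \<sigma>2: "\<sigma>\<^sup>2 = 1 / (2 * \<nu>)" using assms by (simp add: \<sigma>_def power_divide)
  have "has_bochner_integral std_normal_distribution (\<lambda>x. iexp (t * x)) (exp (- (t^2) / 2))"
    unfolding has_bochner_integral_iff
  proof
    interpret real_distribution std_normal_distribution by (rule real_dist_normal_dist)
    show "integrable std_normal_distribution (\<lambda>x. iexp (t * x))"
      by (intro integrable_const_bound[where B = 1]) (auto simp: norm_exp_i_times)
    have "char std_normal_distribution t = complex_of_real (exp (- (t^2) / 2))"
      by (simp add: char_std_normal_distribution)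
    thus "(LINT x|std_normal_distribution. iexp (t * x)) = complex_of_real (exp (- (t^2) / 2))"
      by (simp add: char_def)
  qed
  hence "has_bochner_integral lborel (\<lambda>x. std_normal_density x *\<^sub>R iexp (t * x)) (exp (- (t^2) / 2))"
    unfolding has_bochner_integral_iff by (simp add: integrable_density integral_density)
  hence "has_bochner_integral lborel (\<lambda>x. std_normal_density (- (a / \<sigma>) + (1 / \<sigma>) * x) *\<^sub>R iexp (t * (- (a / \<sigma>) + (1 / \<sigma>) * x)))
      (complex_of_real (exp (- (t^2) / 2)) /\<^sub>R \<bar>1 / \<sigma>\<bar>)"
    using \<sigma> by (subst (asm) lborel_has_bochner_integral_real_affine_iff[where c = "1 / \<sigma>" and t = "- (a / \<sigma>)"]) simp_all
  hence "has_bochner_integral lborel (\<lambda>x. C * (std_normal_density (- (a / \<sigma>) + (1 / \<sigma>) * x) *\<^sub>R iexp (t * (- (a / \<sigma>) + (1 / \<sigma>) * x))))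
      (C * (complex_of_real (exp (- (t^2) / 2)) /\<^sub>R \<bar>1 / \<sigma>\<bar>))"
    by (rule has_bochner_integral_mult_right)
  moreover have "C * (std_normal_density (- (a / \<sigma>) + (1 / \<sigma>) * x) *\<^sub>R iexp (t * (- (a / \<sigma>) + (1 / \<sigma>) * x)))
      = exp (- complex_of_real \<nu> * (of_real x)\<^sup>2 + c * of_real x)" for x :: real
  proof -
    have 1: "- ((- (a / \<sigma>) + (1 / \<sigma>) * x)\<^sup>2) / 2 = - \<nu> * (x - a)\<^sup>2"
    proof -
      have "(- (a / \<sigma>) + (1 / \<sigma>) * x)\<^sup>2 = (x - a)\<^sup>2 / \<sigma>\<^sup>2"
        using \<sigma> by (simp add: field_simps power2_eq_square)
      thus ?thesis using assms by (simp add: \<sigma>2)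
    qed
    have 2: "t * (- (a / \<sigma>) + (1 / \<sigma>) * x) = Im c * (x - a)"
      using \<sigma> by (simp add: t_def field_simps)
    have "C * (std_normal_density (- (a / \<sigma>) + (1 / \<sigma>) * x) *\<^sub>R iexp (t * (- (a / \<sigma>) + (1 / \<sigma>) * x)))
      = exp (of_real (\<nu> * a\<^sup>2) + \<i> * of_real (Im c * a)) * of_real (exp (- \<nu> * (x - a)\<^sup>2)) * exp (\<i> * of_real (Im c * (x - a)))"
      unfolding std_normal_density_def 1 2 C_def by (simp add: scaleR_conv_of_real)
    also have "\<dots> = exp ((of_real (\<nu> * a\<^sup>2) + \<i> * of_real (Im c * a)) + of_real (- \<nu> * (x - a)\<^sup>2) + \<i> * of_real (Im c * (x - a)))"
      by (simp only: exp_add exp_of_real)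
    also have "(of_real (\<nu> * a\<^sup>2) + \<i> * of_real (Im c * a)) + of_real (- \<nu> * (x - a)\<^sup>2) + \<i> * of_real (Im c * (x - a))
       = - complex_of_real \<nu> * (of_real x)\<^sup>2 + c * of_real x"
      using assms by (simp add: complex_eq_iff a_def power2_eq_square field_simps)
    finally show ?thesis .
  qed
  moreover have "C * (complex_of_real (exp (- (t^2) / 2)) /\<^sub>R \<bar>1 / \<sigma>\<bar>)
       = of_real (sqrt (pi / \<nu>)) * exp (c\<^sup>2 / of_real (4 * \<nu>))"
  proof -
    have 1: "- (t^2) / 2 = - (Im c)\<^sup>2 / (4 * \<nu>)"
      using assms by (simp add: t_def power_mult_distrib \<sigma>2)
    have 2: "sqrt (2 * pi) * \<sigma> = sqrt (pi / \<nu>)"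
      using assms by (simp add: \<sigma>_def real_sqrt_mult real_sqrt_divide)
    have "C * (complex_of_real (exp (- (t^2) / 2)) /\<^sub>R \<bar>1 / \<sigma>\<bar>)
       = of_real (sqrt (2 * pi) * \<sigma>) * (exp (of_real (\<nu> * a\<^sup>2) + \<i> * of_real (Im c * a)) * of_real (exp (- (Im c)\<^sup>2 / (4 * \<nu>))))"
      unfolding 1 C_def using \<sigma> by (simp add: scaleR_conv_of_real field_simps)
    also have "exp (of_real (\<nu> * a\<^sup>2) + \<i> * of_real (Im c * a)) * of_real (exp (- (Im c)\<^sup>2 / (4 * \<nu>)))
       = exp (of_real (\<nu> * a\<^sup>2) + \<i> * of_real (Im c * a) + complex_of_real (- (Im c)\<^sup>2 / (4 * \<nu>)))"
      by (simp only: exp_add exp_of_real)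
    also have "of_real (\<nu> * a\<^sup>2) + \<i> * of_real (Im c * a) + complex_of_real (- (Im c)\<^sup>2 / (4 * \<nu>)) = c\<^sup>2 / of_real (4 * \<nu>)"
      using assms by (simp add: complex_eq_iff a_def power2_eq_square field_simps)
    finally show ?thesis by (simp add: 2)
  qed
  ultimately show ?thesis by simp
qed

lemma has_bochner_integral_lborel_prod:
  fixes f :: "'a::euclidean_space \<Rightarrow> real \<Rightarrow> complex" and I :: "'a \<Rightarrow> complex"
  assumes f: "\<And>b. b \<in> Basis \<Longrightarrow> has_bochner_integral lborel (f b) (I b)"
  shows "has_bochner_integral lborel (\<lambda>x::'a. \<Prod>b\<in>Basis. f b (x \<bullet> b)) (\<Prod>b\<in>Basis. I b)"
proof -
  interpret product_sigma_finite "\<lambda>_::'a. lborel :: real measure" ..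
  have int: "integrable lborel (f b)" "integral\<^sup>L lborel (f b) = I b" if "b \<in> Basis" for b
    using f[OF that] by (auto simp: has_bochner_integral_iff)
  have [measurable]: "f b \<in> borel_measurable borel" if "b \<in> Basis" for b
    using int(1)[OF that] by (auto dest: borel_measurable_integrable)
  have "has_bochner_integral (\<Pi>\<^sub>M b\<in>Basis. lborel) (\<lambda>x. \<Prod>b\<in>(Basis::'a set). f b (x b)) (\<Prod>b\<in>Basis. I b)"
    using product_integral_prod[of Basis f] product_integrable_prod[of Basis f] int
    by (auto simp: has_bochner_integral_iff intro!: prod.cong)
  moreover have "(\<Prod>b\<in>Basis. f b ((\<Sum>c\<in>Basis. x c *\<^sub>R c) \<bullet> b)) = (\<Prod>b\<in>(Basis::'a set). f b (x b))" for x
    by (intro prod.cong) auto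
  ultimately show ?thesis
    by (subst lborel_eq, subst has_bochner_integral_distr) simp_all
qed

lemma has_bochner_integral_gaussian:
  fixes c :: "'a::euclidean_space \<Rightarrow> complex"
  assumes "\<nu> > 0"
  shows "has_bochner_integral lborel
           (\<lambda>x::'a. exp (- complex_of_real \<nu> * (of_real (norm x))\<^sup>2 + (\<Sum>b\<in>Basis. c b * of_real (x \<bullet> b))))
           (of_real (sqrt (pi / \<nu>)) ^ DIM('a) * exp ((\<Sum>b\<in>Basis. (c b)\<^sup>2) / of_real (4 * \<nu>)))"
proof -
  have "exp (- complex_of_real \<nu> * (of_real (norm x))\<^sup>2 + (\<Sum>b\<in>Basis. c b * of_real (x \<bullet> b)))
      = (\<Prod>b\<in>Basis. exp (- complex_of_real \<nu> * (of_real (x \<bullet> b))\<^sup>2 + c b * of_real (x \<bullet> b)))" for x :: 'a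
    unfolding of_real_power[symmetric] norm_squared_eq_sum_Basis
    by (subst exp_sum[symmetric]) (simp_all add: sum.distrib sum_distrib_left sum_subtractf sum_negf)
  moreover have "of_real (sqrt (pi / \<nu>)) ^ DIM('a) * exp ((\<Sum>b\<in>Basis. (c b)\<^sup>2) / of_real (4 * \<nu>))
     = (\<Prod>b\<in>(Basis::'a set). of_real (sqrt (pi / \<nu>)) * exp ((c b)\<^sup>2 / of_real (4 * \<nu>)))"
    by (simp add: prod.distrib exp_sum sum_divide_distrib)
  ultimately show ?thesis
    using has_bochner_integral_lborel_prod[OF has_bochner_integral_exp_quadratic[OF assms], of c]
    by simp
qed

section \<open>Coherent kernels\<close>

definition L2_compact :: "'z::euclidean_space measure \<Rightarrow> ('z \<Rightarrow> complex) set" where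
  "L2_compact \<mu> = {h \<in> L2 \<mu>. \<exists>r. \<forall>z. norm z > r \<longrightarrow> h z = 0}"

lemma of_real_nsq: "complex_of_real (nsq M f) = (LINT x|M. f x * cnj (f x))"
  unfolding nsq_def integral_complex_of_real[symmetric] by (simp add: complex_norm_square[symmetric])

lemma L2_pair_tensor:
  assumes "sigma_finite_measure M" "sigma_finite_measure N" "f \<in> L2 M" "g \<in> L2 N"
  shows "(\<lambda>(x, y). f x * g y) \<in> L2 (M \<Otimes>\<^sub>M N)"
proof -
  interpret pair_sigma_finite M N using assms(1,2) by (rule pair_sigma_finite.intro)
  have [measurable]: "f \<in> borel_measurable M" "g \<in> borel_measurable N"
    using assms(3,4) by (auto simp: L2_def)
  have "integrable (M \<Otimes>\<^sub>M N) (\<lambda>p. (norm (f (fst p) * g (snd p)))\<^sup>2)"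
  proof (rule Fubini_integrable)
    show "integrable M (\<lambda>x. LINT y|N. norm ((norm (f (fst (x, y)) * g (snd (x, y))))\<^sup>2))"
      using assms(3,4) by (simp add: norm_mult power_mult_distrib L2_def)
    show "AE x in M. integrable N (\<lambda>y. (norm (f (fst (x, y)) * g (snd (x, y))))\<^sup>2)"
      using assms(3,4) by (simp add: norm_mult power_mult_distrib L2_def)
  qed measurable
  thus ?thesis by (intro L2I) (auto simp: case_prod_unfold)
qed

lemma continuous_bounded_cball:
  fixes f :: "'a::euclidean_space \<Rightarrow> 'b::real_normed_vector"
  assumes "continuous_on UNIV f"
  obtains C where "C \<ge> 0" "\<And>x. norm x \<le> r \<Longrightarrow> norm (f x) \<le> C"
proof -
  have "compact (f ` cball 0 r)"
    by (intro compact_continuous_image continuous_on_subset[OF assms]) auto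
  then obtain C where "\<And>x. x \<in> cball 0 r \<Longrightarrow> norm (f x) \<le> C"
    by (meson compact_imp_bounded bounded_iff imageI)
  thus ?thesis by (intro that[of "max C 0"]) (auto simp: le_max_iff_disj)
qed

text \<open>The kernel may fail to be square integrable on the product, but h only sees it over a
  ball. There \<open>nsq N (A z)\<close> is bounded by continuity, so the cut-off kernel is square
  integrable; Cauchy-Schwarz in z gives the first claim and Fubini the second.\<close>

lemma kernel_swap:
  fixes A :: "'z::euclidean_space \<Rightarrow> 'y::euclidean_space \<Rightarrow> complex"
  assumes "finite_measure \<mu>" "finite_measure N"
    and sets [measurable_cong]: "sets \<mu> = sets borel" "sets N = sets borel"
    and contA: "continuous_on UNIV (\<lambda>(z, y). A z y)"
    and A2: "\<And>z. A z \<in> L2 N"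
    and D: "continuous_on UNIV (\<lambda>z. nsq N (A z))"
    and h: "h \<in> L2_compact \<mu>"
  shows kernel_swap_L2: "(\<lambda>y. LINT z|\<mu>. h z * A z y) \<in> L2 N"
    and kernel_swap_eq: "g \<in> L2 N \<Longrightarrow>
      (LINT y|N. (LINT z|\<mu>. h z * A z y) * g y) = (LINT z|\<mu>. h z * (LINT y|N. A z y * g y))"
proof -
  interpret \<mu>: finite_measure \<mu> by fact
  interpret N: finite_measure N by fact
  interpret pair_sigma_finite \<mu> N ..
  have h2: "h \<in> L2 \<mu>" using h by (simp add: L2_compact_def)
  obtain r where r: "\<And>z. norm z > r \<Longrightarrow> h z = 0" using h by (auto simp: L2_compact_def)
  define A' where "A' z y = indicator (cball 0 r) z * A z y" for z y
  have "(\<lambda>(z, y). A z y) \<in> borel_measurable borel"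
    by (rule borel_measurable_continuous_onI[OF contA])
  hence Am [measurable]: "(\<lambda>(z, y). A z y) \<in> borel_measurable (\<mu> \<Otimes>\<^sub>M N)"
    by (simp add: borel_prod[symmetric] cong: measurable_cong_sets sets_pair_measure_cong[OF sets])
  have [measurable]: "cball (0::'z) r \<in> sets \<mu>" by (simp add: sets)
  have A'm [measurable]: "(\<lambda>(z, y). A' z y) \<in> borel_measurable (\<mu> \<Otimes>\<^sub>M N)"
    unfolding A'_def by measurable
  have hm [measurable]: "h \<in> borel_measurable \<mu>" using h2 by (rule L2_measurable)
  have hA: "h z * A z y = h z * A' z y" for z y
    using r[of z] by (cases "norm z \<le> r") (auto simp: A'_def indicator_def)
  have A'2: "A' z \<in> L2 N" for z unfolding A'_def by (rule L2_cmult[OF A2])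
  obtain C where C: "C \<ge> 0" "\<And>z. norm z \<le> r \<Longrightarrow> norm (nsq N (A z)) \<le> C"
    using continuous_bounded_cball[OF D] by blast
  have intA': "integrable (\<mu> \<Otimes>\<^sub>M N) (\<lambda>p. (norm (A' (fst p) (snd p)))\<^sup>2)"
  proof (rule Fubini_integrable)
    have "(LINT y|N. norm ((norm (A' (fst (z, y)) (snd (z, y))))\<^sup>2)) = indicator (cball 0 r) z * nsq N (A z)" for z
      by (simp add: A'_def nsq_def norm_mult power_mult_distrib indicator_def)
    moreover have "integrable \<mu> (\<lambda>z. indicator (cball 0 r) z * nsq N (A z))"
    proof (rule \<mu>.integrable_const_bound[where B = C])
      show "AE z in \<mu>. norm (indicator (cball 0 r) z * nsq N (A z)) \<le> C"
        using C by (auto simp: indicator_def)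
      have "(\<lambda>z. nsq N (A z)) \<in> borel_measurable \<mu>"
        using borel_measurable_continuous_onI[OF D] by (simp cong: measurable_cong_sets[OF sets(1) refl])
      thus "(\<lambda>z. indicator (cball 0 r) z * nsq N (A z)) \<in> borel_measurable \<mu>" by measurable
    qed
    ultimately show "integrable \<mu> (\<lambda>z. LINT y|N. norm ((norm (A' (fst (z, y)) (snd (z, y))))\<^sup>2))"
      by simp
    show "AE z in \<mu>. integrable N (\<lambda>y. (norm (A' (fst (z, y)) (snd (z, y))))\<^sup>2)"
      using A'2 by (simp add: L2_def)
  qed (use A'm in \<open>simp add: case_prod_unfold\<close>)
  have A'L2: "(\<lambda>(z, y). A' z y) \<in> L2 (\<mu> \<Otimes>\<^sub>M N)"
    using A'm intA' by (intro L2I) (simp_all add: case_prod_unfold)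
  show "(\<lambda>y. LINT z|\<mu>. h z * A z y) \<in> L2 N"
    unfolding hA
  proof (rule L2I)
    show m [measurable]: "(\<lambda>y. LINT z|\<mu>. h z * A' z y) \<in> borel_measurable N" by measurable
    have "integrable (\<mu> \<Otimes>\<^sub>M N) (\<lambda>(z, y). (norm (A' z y))\<^sup>2)"
      using intA' by (simp add: case_prod_unfold)
    note * = AE_integrable_snd[OF this] integrable_snd[OF this]
    show "integrable N (\<lambda>y. (norm (LINT z|\<mu>. h z * A' z y))\<^sup>2)"
    proof (rule Bochner_Integration.integrable_bound)
      show "integrable N (\<lambda>y. nsq \<mu> h * (LINT z|\<mu>. (norm (A' z y))\<^sup>2))" using *(2) by simp
      \<comment> \<open>Cauchy-Schwarz for almost every fixed y, with the majorant integrable in y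
        by Fubini.\<close>
      show "AE y in N. norm ((norm (LINT z|\<mu>. h z * A' z y))\<^sup>2) \<le> norm (nsq \<mu> h * (LINT z|\<mu>. (norm (A' z y))\<^sup>2))"
        using *(1) AE_space
      proof eventually_elim
        case (elim y)
        have "(\<lambda>z. A' z y) \<in> borel_measurable \<mu>"
          using elim(2) measurable_compose[OF measurable_Pair1' A'm] by simp
        hence "(\<lambda>z. A' z y) \<in> L2 \<mu>" using elim(1) by (rule L2I)
        from L2_Cauchy_Schwarz[OF h2 this] show ?case by (simp add: nsq_def)
      qed
    qed measurable
  qed
  assume g: "g \<in> L2 N"
  have "integrable (\<mu> \<Otimes>\<^sub>M N) (\<lambda>p. (case p of (z, y) \<Rightarrow> A' z y) * (case p of (z, y) \<Rightarrow> h z * g y))"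
    by (intro L2_integrable_mult A'L2 L2_pair_tensor h2 g) unfold_locales
  hence "integrable (\<mu> \<Otimes>\<^sub>M N) (\<lambda>(z, y). h z * A' z y * g y)"
    by (simp add: case_prod_unfold mult_ac)
  from Fubini_integral[OF this]
  show "(LINT y|N. (LINT z|\<mu>. h z * A z y) * g y) = (LINT z|\<mu>. h z * (LINT y|N. A z y * g y))"
    by (simp only: hA[symmetric] mult.assoc Bochner_Integration.integral_mult_right_zero
          Bochner_Integration.integral_mult_left_zero[symmetric])
qed

section \<open>Truncation to balls\<close>

definition trunc :: "real \<Rightarrow> ('z::euclidean_space \<Rightarrow> complex) \<Rightarrow> 'z \<Rightarrow> complex" where
  "trunc r F z = (if norm z \<le> r then F z else 0)"

lemma trunc_measurable:
  assumes "sets \<mu> = sets borel" "F \<in> borel_measurable \<mu>"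
  shows "trunc r F \<in> borel_measurable \<mu>"
proof -
  have [measurable_cong]: "sets \<mu> = sets borel" by fact
  have [measurable]: "F \<in> borel_measurable \<mu>" by fact
  show ?thesis unfolding trunc_def by measurable
qed

lemma trunc_L2:
  assumes "sets \<mu> = sets borel" "F \<in> L2 \<mu>"
  shows "trunc r F \<in> L2 \<mu>"
proof (rule L2I)
  show "trunc r F \<in> borel_measurable \<mu>" using assms by (intro trunc_measurable L2_measurable)
  hence "(\<lambda>x. (norm (trunc r F x))\<^sup>2) \<in> borel_measurable \<mu>" by measurable
  thus "integrable \<mu> (\<lambda>x. (norm (trunc r F x))\<^sup>2)"
    by (rule Bochner_Integration.integrable_bound[OF L2_integrable[OF assms(2)]])
       (auto simp: trunc_def)
qed

lemma trunc_L2_compact: "sets \<mu> = sets borel \<Longrightarrow> F \<in> L2 \<mu> \<Longrightarrow> trunc r F \<in> L2_compact \<mu>"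
  by (auto simp: L2_compact_def trunc_L2 trunc_def intro!: exI[of _ r])

lemma L2_compact_diff:
  assumes "f \<in> L2_compact \<mu>" "g \<in> L2_compact \<mu>"
  shows "(\<lambda>z. f z - g z) \<in> L2_compact \<mu>"
proof -
  obtain r s where "\<forall>z. norm z > r \<longrightarrow> f z = 0" "\<forall>z. norm z > s \<longrightarrow> g z = 0"
    using assms by (auto simp: L2_compact_def)
  hence "\<forall>z. norm z > max r s \<longrightarrow> f z - g z = 0" by auto
  thus ?thesis using assms L2_diff by (auto simp: L2_compact_def simp del: max_less_iff_conj)
qed

text \<open>The radius is real because the explicit formula takes its limit along all discs, not
  only those of integer radius.\<close>

lemma nsq_trunc_tail_tendsto_0:
  assumes [simp]: "sets \<mu> = sets borel" and F: "F \<in> L2 \<mu>"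
  shows "((\<lambda>r. nsq \<mu> (\<lambda>z. F z - trunc r F z)) \<longlongrightarrow> 0) at_top"
proof -
  have "((\<lambda>r. LINT z|\<mu>. (norm (F z - trunc r F z))\<^sup>2) \<longlongrightarrow> (LINT z|\<mu>. 0)) at_top"
  proof (rule integral_dominated_convergence_at_top)
    show "(\<lambda>z. (norm (F z - trunc r F z))\<^sup>2) \<in> borel_measurable \<mu>" for r
      using L2_integrable[OF L2_diff[OF F trunc_L2[OF _ F, of r]]] by simp
    show "AE z in \<mu>. ((\<lambda>r. (norm (F z - trunc r F z))\<^sup>2) \<longlongrightarrow> 0) at_top"
    proof (rule AE_I2)
      fix z
      have "\<forall>\<^sub>F r in at_top. (norm (F z - trunc r F z))\<^sup>2 = 0"
        using eventually_ge_at_top[of "norm z"] by eventually_elim (simp add: trunc_def)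
      thus "((\<lambda>r. (norm (F z - trunc r F z))\<^sup>2) \<longlongrightarrow> 0) at_top" by (rule tendsto_eventually)
    qed
    show "\<forall>\<^sub>F r in at_top. AE z in \<mu>. norm ((norm (F z - trunc r F z))\<^sup>2) \<le> (norm (F z))\<^sup>2"
      by (intro always_eventually allI AE_I2) (auto simp: trunc_def)
  qed (use L2_integrable[OF F] in auto)
  thus ?thesis by (simp add: nsq_def)
qed

text \<open>
  \<open>T\<close> is the adjoint of \<open>B\<close> and \<open>P = B \<circ> T\<close>, all on functions of bounded support, where Fubini
  applies. Idempotence of the kernel \<open>K\<close> gives \<open>\<parallel>P h\<parallel>\<^sup>2 = \<langle>h, P h\<rangle>\<close>, hence \<open>\<parallel>P h\<parallel> \<le> \<parallel>h\<parallel>\<close>, and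
  \<open>\<parallel>T h\<parallel>\<^sup>2 = \<langle>h, P h\<rangle>\<close> makes \<open>T\<close> a contraction; boundedness of \<open>B\<close> follows by duality.
\<close>

locale coherent_kernel = M: finite_measure M + N: finite_measure N
  for M :: "'x::euclidean_space measure" and N :: "'z::euclidean_space measure" +
  fixes k :: "'z \<Rightarrow> 'x \<Rightarrow> complex" and K :: "'z \<Rightarrow> 'z \<Rightarrow> complex"
  assumes sets_M [measurable_cong, simp]: "sets M = sets borel"
    and sets_N [measurable_cong, simp]: "sets N = sets borel"
    and k_cont: "continuous_on UNIV (\<lambda>(z, x). k z x)"
    and K_cont: "continuous_on UNIV (\<lambda>(z, w). K z w)"
    and k_L2: "k z \<in> L2 M"
    and k_K: "(LINT x|M. k z x * cnj (k w x)) = K z w"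
    and K_L2: "(\<lambda>w. K w a) \<in> L2 N"
    and K_K: "(LINT w|N. K z w * K w a) = K z a"
begin

definition B :: "('x \<Rightarrow> complex) \<Rightarrow> 'z \<Rightarrow> complex" where
  "B f z = (LINT x|M. f x * k z x)"

definition T :: "('z \<Rightarrow> complex) \<Rightarrow> 'x \<Rightarrow> complex" where
  "T h x = (LINT z|N. h z * cnj (k z x))"

definition P :: "('z \<Rightarrow> complex) \<Rightarrow> 'z \<Rightarrow> complex" where
  "P h z = (LINT w|N. h w * K z w)"

lemma cnj_K: "cnj (K z w) = K w z"
  unfolding k_K[symmetric] Bochner_Integration.integral_cnj[symmetric] by (simp add: mult.commute)

lemma K_L2': "K z \<in> L2 N"
  using L2_cnj[OF K_L2[of z]] by (simp add: cnj_K)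

lemma nsq_k: "complex_of_real (nsq M (k z)) = K z z"
  by (simp add: of_real_nsq k_K)

lemma nsq_K: "complex_of_real (nsq N (\<lambda>z. K z w)) = K w w"
  by (simp add: of_real_nsq cnj_K mult.commute[of "K _ w"] K_K)

text \<open>The sections of k and of K have the same squared norm, the diagonal value of K. Its
  continuity is what \<open>kernel_swap\<close> asks for in both uses.\<close>

lemma diag_cont: "continuous_on UNIV (\<lambda>z. Re (K z z))"
proof -
  have "continuous_on UNIV (\<lambda>z::'z. (z, z))" by (intro continuous_intros)
  from continuous_on_compose2[OF K_cont this] show ?thesis by (auto intro!: continuous_intros)
qed

lemma nsq_k': "nsq M (k z) = Re (K z z)"
  by (simp flip: nsq_k)

lemma nsq_K': "nsq N (\<lambda>z. K z w) = Re (K w w)"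
  by (simp flip: nsq_K)

lemma T_L2: "h \<in> L2_compact N \<Longrightarrow> T h \<in> L2 M"
  and T_swap: "h \<in> L2_compact N \<Longrightarrow> g \<in> L2 M \<Longrightarrow>
    (LINT x|M. T h x * g x) = (LINT z|N. h z * (LINT x|M. cnj (k z x) * g x))"
proof -
  assume h: "h \<in> L2_compact N"
  note * = M.finite_measure_axioms N.finite_measure_axioms
  have c: "continuous_on UNIV (\<lambda>(z, x). cnj (k z x))"
    using k_cont by (auto simp: case_prod_unfold intro: continuous_on_cnj)
  have d: "continuous_on UNIV (\<lambda>z. nsq M (\<lambda>x. cnj (k z x)))"
    by (simp add: nsq_k' diag_cont)
  note ** = *(2,1) sets_N sets_M c L2_cnj[OF k_L2] d h
  show "T h \<in> L2 M" unfolding T_def[abs_def] by (rule kernel_swap_L2[OF **])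
  show "(LINT x|M. T h x * g x) = (LINT z|N. h z * (LINT x|M. cnj (k z x) * g x))" if "g \<in> L2 M"
    unfolding T_def by (rule kernel_swap_eq[OF ** that])
qed

lemma P_L2: "h \<in> L2_compact N \<Longrightarrow> P h \<in> L2 N"
  and P_swap: "h \<in> L2_compact N \<Longrightarrow> g \<in> L2 N \<Longrightarrow>
    (LINT z|N. P h z * g z) = (LINT w|N. h w * (LINT z|N. K z w * g z))"
proof -
  assume h: "h \<in> L2_compact N"
  note * = N.finite_measure_axioms
  have c: "continuous_on UNIV (\<lambda>(w, z). K z w)"
  proof -
    have "continuous_on UNIV (\<lambda>p::'z \<times> 'z. (snd p, fst p))" by (intro continuous_intros)
    from continuous_on_compose2[OF K_cont this] show ?thesis by (simp add: case_prod_unfold)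
  qed
  have d: "continuous_on UNIV (\<lambda>w. nsq N (\<lambda>z. K z w))"
    by (simp add: nsq_K' diag_cont)
  note ** = * * sets_N sets_N c K_L2 d h
  show "P h \<in> L2 N" unfolding P_def[abs_def] by (rule kernel_swap_L2[OF **])
  show "(LINT z|N. P h z * g z) = (LINT w|N. h w * (LINT z|N. K z w * g z))" if "g \<in> L2 N"
    unfolding P_def by (rule kernel_swap_eq[OF ** that])
qed

lemma T_adjoint:
  assumes "h \<in> L2_compact N" "f \<in> L2 M"
  shows "(LINT x|M. T h x * cnj (f x)) = (LINT z|N. h z * cnj (B f z))"
  unfolding T_swap[OF assms(1) L2_cnj[OF assms(2)]] B_def Bochner_Integration.integral_cnj[symmetric]
  by (simp add: mult.commute)

lemma B_T:
  assumes "h \<in> L2_compact N"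
  shows "B (T h) z = P h z"
  unfolding B_def P_def T_swap[OF assms k_L2] by (simp add: mult.commute k_K)

text \<open>Idempotence of the kernel carried under the integral: the operator of K fixes the range
  of \<open>P\<close>.\<close>

lemma K_P:
  assumes "h \<in> L2_compact N"
  shows "(LINT z|N. P h z * K w z) = P h w"
proof -
  have "(LINT z|N. K z v * K w z) = K w v" for v
    using K_K[of w v] by (simp add: mult.commute)
  thus ?thesis unfolding P_swap[OF assms K_L2'] by (simp add: P_def)
qed

lemma nsq_P_eq:
  assumes "h \<in> L2_compact N"
  shows "complex_of_real (nsq N (P h)) = (LINT z|N. h z * cnj (P h z))"
proof -
  have "(LINT z|N. K z w * cnj (P h z)) = cnj (LINT z|N. P h z * K w z)" for w
    by (simp add: cnj_K mult.commute flip: Bochner_Integration.integral_cnj)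
  thus ?thesis
    by (simp add: of_real_nsq P_swap[OF assms L2_cnj[OF P_L2[OF assms]]] K_P[OF assms])
qed

lemma nsq_P_le:
  assumes h: "h \<in> L2_compact N"
  shows "nsq N (P h) \<le> nsq N h"
proof -
  have h2: "h \<in> L2 N" using h by (simp add: L2_compact_def)
  have "(nsq N (P h))\<^sup>2 = (norm (complex_of_real (nsq N (P h))))\<^sup>2" by simp
  also have "\<dots> \<le> nsq N h * nsq N (P h)"
    unfolding nsq_P_eq[OF h] using L2_Cauchy_Schwarz[OF h2 L2_cnj[OF P_L2[OF h]]] by simp
  finally have "nsq N (P h) * nsq N (P h) \<le> nsq N h * nsq N (P h)" by (simp add: power2_eq_square)
  \<comment> \<open>One factor \<open>nsq N (P h)\<close> is cancelled; if it vanishes, the claim is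
    only that \<open>nsq N h\<close> is nonnegative.\<close>
  thus ?thesis
    by (metis mult_right_le_imp_le nsq_nonneg order_le_less)
qed

lemma nsq_T_le:
  assumes h: "h \<in> L2_compact N"
  shows "nsq M (T h) \<le> nsq N h"
proof -
  have h2: "h \<in> L2 N" using h by (simp add: L2_compact_def)
  have eq: "complex_of_real (nsq M (T h)) = (LINT z|N. h z * cnj (P h z))"
    by (simp add: of_real_nsq T_adjoint[OF h T_L2[OF h]] B_T[OF h])
  have "(nsq M (T h))\<^sup>2 = (norm (complex_of_real (nsq M (T h))))\<^sup>2" by simp
  also have "\<dots> \<le> nsq N h * nsq N (P h)"
    unfolding eq using L2_Cauchy_Schwarz[OF h2 L2_cnj[OF P_L2[OF h]]] by simp
  also have "\<dots> \<le> nsq N h * nsq N h" by (intro mult_left_mono nsq_P_le h) simp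
  finally show ?thesis by (simp add: power2_eq_square[symmetric])
qed

text \<open>Linearity of \<open>T\<close> at every single x needs convergent integrals. On the ball
  that carries h the kernel is bounded, and h is integrable because N is finite.\<close>

lemma T_integrable:
  assumes h: "h \<in> L2_compact N"
  shows "integrable N (\<lambda>z. h z * cnj (k z x))"
proof -
  have h2: "h \<in> L2 N" using h by (simp add: L2_compact_def)
  obtain r where r: "\<And>z. norm z > r \<Longrightarrow> h z = 0" using h by (auto simp: L2_compact_def)
  have c: "continuous_on UNIV (\<lambda>z. k z x)"
  proof -
    have "continuous_on UNIV (\<lambda>z::'z. (z, x))" by (intro continuous_intros)
    from continuous_on_compose2[OF k_cont this] show ?thesis by simp
  qed
  obtain C where C: "C \<ge> 0" "\<And>z. norm z \<le> r \<Longrightarrow> norm (k z x) \<le> C"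
    using continuous_bounded_cball[OF c] by blast
  have km [measurable]: "(\<lambda>z. k z x) \<in> borel_measurable N"
    using borel_measurable_continuous_onI[OF c] by (simp cong: measurable_cong_sets)
  have hm [measurable]: "h \<in> borel_measurable N" using h2 by (rule L2_measurable)
  show ?thesis
  proof (rule Bochner_Integration.integrable_bound)
    show "integrable N (\<lambda>z. C * norm (h z))" using N.L2_imp_integrable[OF h2] by simp
    show "AE z in N. norm (h z * cnj (k z x)) \<le> norm (C * norm (h z))"
    proof (rule AE_I2)
      fix z show "norm (h z * cnj (k z x)) \<le> norm (C * norm (h z))"
        using r[of z] C by (cases "norm z \<le> r") (auto simp: norm_mult mult.commute[of C] intro!: mult_left_mono)
    qed
  qed (auto intro: measurable_compose[OF _ borel_measurable_cnj])
qed

lemma T_diff: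
  assumes "h \<in> L2_compact N" "h' \<in> L2_compact N"
  shows "T (\<lambda>z. h z - h' z) x = T h x - T h' x"
  unfolding T_def using assms by (simp add: left_diff_distrib T_integrable)

lemma B_measurable:
  assumes "f \<in> borel_measurable M"
  shows "B f \<in> borel_measurable N"
proof -
  have "(\<lambda>(z, x). k z x) \<in> borel_measurable (N \<Otimes>\<^sub>M M)"
    using borel_measurable_continuous_onI[OF k_cont]
    by (simp add: borel_prod[symmetric] cong: measurable_cong_sets sets_pair_measure_cong[OF sets_N sets_M])
  note [measurable] = this assms
  show ?thesis unfolding B_def[abs_def] by measurable
qed

text \<open>Duality: h = \<open>trunc r (B f)\<close> is tested against \<open>B f\<close> itself,
  and the adjoint relation with the contraction \<open>T\<close> gives a bound by
  \<open>nsq M f\<close> that does not depend on r. Fatou's lemma then removes the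
  truncation.\<close>

lemma B_L2: "f \<in> L2 M \<Longrightarrow> B f \<in> L2 N"
proof -
  assume f: "f \<in> L2 M"
  have Bm [measurable]: "B f \<in> borel_measurable N"
    by (rule B_measurable[OF L2_measurable[OF f]])
  have bound: "nsq N (trunc r (B f)) \<le> nsq M f" and L2: "trunc r (B f) \<in> L2 N" for r
  proof -
    obtain C where C: "C \<ge> 0" "\<And>z. norm z \<le> r \<Longrightarrow> norm (Re (K z z)) \<le> C"
      using continuous_bounded_cball[OF diag_cont] by blast
    show t: "trunc r (B f) \<in> L2 N"
    proof (rule N.L2_bounded)
      fix z
      show "norm (trunc r (B f) z) \<le> sqrt (nsq M f * C)"
      proof (cases "norm z \<le> r")
        case True
        \<comment> \<open>Point evaluations are bounded by the diagonal of K, which is bounded on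
          the ball; so the truncation is bounded and lies in L2.\<close>
        have "(norm (B f z))\<^sup>2 \<le> nsq M f * nsq M (k z)"
          unfolding B_def by (rule L2_Cauchy_Schwarz[OF f k_L2])
        also have "\<dots> \<le> nsq M f * C"
          using C(2)[OF True] by (intro mult_left_mono) (auto simp: nsq_k')
        finally show ?thesis using True by (simp add: trunc_def real_le_rsqrt)
      qed (use C in \<open>auto simp: trunc_def\<close>)
    qed (intro trunc_measurable sets_N Bm)
    have tc: "trunc r (B f) \<in> L2_compact N"
      using t by (auto simp: L2_compact_def trunc_def intro!: exI[of _ r])
    let ?h = "trunc r (B f)"
    have "complex_of_real (nsq N ?h) = (LINT z|N. ?h z * cnj (B f z))"
      \<comment> \<open>The second factor may lose its truncation, since the first one vanishes
        outside the ball.\<close>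
      unfolding of_real_nsq by (intro Bochner_Integration.integral_cong) (auto simp: trunc_def)
    also have "\<dots> = (LINT x|M. T ?h x * cnj (f x))"
      by (rule T_adjoint[OF tc f, symmetric])
    finally have eq: "complex_of_real (nsq N ?h) = (LINT x|M. T ?h x * cnj (f x))" .
    have "(nsq N ?h)\<^sup>2 = (norm (complex_of_real (nsq N ?h)))\<^sup>2" by simp
    also have "\<dots> \<le> nsq M (T ?h) * nsq M f"
      unfolding eq using L2_Cauchy_Schwarz[OF T_L2[OF tc] L2_cnj[OF f]] by simp
    also have "\<dots> \<le> nsq N ?h * nsq M f" by (intro mult_right_mono nsq_T_le tc) simp
    finally have "nsq N ?h * nsq N ?h \<le> nsq M f * nsq N ?h" by (simp add: power2_eq_square mult.commute)
    thus "nsq N ?h \<le> nsq M f"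
      by (metis mult_right_le_imp_le nsq_nonneg order_le_less)
  qed
  show "B f \<in> L2 N"
  proof (rule L2I)
    have lim: "(\<lambda>n. ennreal ((norm (trunc (real n) (B f) z))\<^sup>2)) \<longlonglongrightarrow> ennreal ((norm (B f z))\<^sup>2)" for z
    proof -
      obtain n0 where "norm z \<le> real n0" using real_arch_simple by blast
      hence "\<forall>\<^sub>F n in sequentially. ennreal ((norm (trunc (real n) (B f) z))\<^sup>2) = ennreal ((norm (B f z))\<^sup>2)"
        by (intro eventually_sequentiallyI[of n0]) (auto simp: trunc_def)
      thus ?thesis by (rule tendsto_eventually)
    qed
    have "(\<integral>\<^sup>+z. ennreal ((norm (B f z))\<^sup>2) \<partial>N)
        = (\<integral>\<^sup>+z. liminf (\<lambda>n. ennreal ((norm (trunc (real n) (B f) z))\<^sup>2)) \<partial>N)"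
      using lim_imp_Liminf[OF trivial_limit_sequentially lim] by simp
    also have "\<dots> \<le> liminf (\<lambda>n. \<integral>\<^sup>+z. ennreal ((norm (trunc (real n) (B f) z))\<^sup>2) \<partial>N)"
      using L2_measurable[OF L2] by (intro nn_integral_liminf) auto
    also have "\<dots> = liminf (\<lambda>n. ennreal (nsq N (trunc (real n) (B f))))"
      unfolding nsq_def using L2_integrable[OF L2] by (subst nn_integral_eq_integral) auto
    also have "\<dots> \<le> liminf (\<lambda>n::nat. ennreal (nsq M f))"
      by (intro Liminf_mono always_eventually allI ennreal_leI bound)
    also have "\<dots> < \<infinity>" by (simp add: Liminf_const)
    finally show "integrable N (\<lambda>z. (norm (B f z))\<^sup>2)"
      by (simp add: integrable_iff_bounded)
  qed measurable
qed

text \<open>The contraction \<open>T\<close> sends the truncations of F to a Cauchy sequence. Its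
  limit f is the adjoint of \<open>B\<close> applied to F: the third property is the adjoint
  relation, and the fourth says that \<open>B\<close> after its adjoint is the integral operator of
  K on all of L2.\<close>

lemma T_limit:
  assumes F: "F \<in> L2 N"
  obtains f where "f \<in> L2 M"
    and "\<And>r. nsq M (\<lambda>x. T (trunc r F) x - f x) \<le> 2 * nsq N (\<lambda>z. F z - trunc r F z)"
    and "\<And>g. g \<in> L2 M \<Longrightarrow> (LINT x|M. f x * cnj (g x)) = (LINT z|N. F z * cnj (B g z))"
    and "\<And>z. B f z = (LINT w|N. F w * K z w)"
proof -
  let ?t = "\<lambda>r. nsq N (\<lambda>z. F z - trunc r F z)"
  let ?u = "\<lambda>n x. T (trunc (real n) F) x"
  have tc: "trunc r F \<in> L2_compact N" for r by (rule trunc_L2_compact[OF sets_N F])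
  have t2: "trunc r F \<in> L2 N" for r by (rule trunc_L2[OF sets_N F])
  have tail_seq: "(\<lambda>n. ?t (real n)) \<longlonglongrightarrow> 0"
    by (rule filterlim_compose[OF nsq_trunc_tail_tendsto_0[OF sets_N F] filterlim_real_sequentially])
  have diff: "nsq M (\<lambda>x. T (trunc s F) x - T (trunc r F) x) \<le> ?t r" if "r \<le> s" for r s
  proof -
    have "nsq M (\<lambda>x. T (trunc s F) x - T (trunc r F) x) = nsq M (T (\<lambda>z. trunc s F z - trunc r F z))"
      by (simp add: nsq_def T_diff[OF tc tc])
    also have "\<dots> \<le> nsq N (\<lambda>z. trunc s F z - trunc r F z)"
      by (intro nsq_T_le L2_compact_diff tc)
    also have "\<dots> \<le> ?t r" unfolding nsq_def
      using that by (intro integral_mono L2_integrable L2_diff t2 F) (auto simp: trunc_def)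
    finally show ?thesis .
  qed
  obtain f where f: "f \<in> L2 M" and fn: "\<And>n. nsq M (\<lambda>x. ?u n x - f x) \<le> ?t (real n)"
  proof (rule M.L2_complete[OF T_L2[OF tc] tail_seq])
    show "nsq M (\<lambda>x. ?u n x - ?u m x) \<le> ?t (real m)" if "m \<le> n" for m n :: nat
      using that by (intro diff) simp
  qed (rule that)
  have lim: "(\<lambda>n. nsq M (\<lambda>x. ?u n x - f x)) \<longlonglongrightarrow> 0"
    by (rule tendsto_sandwich[OF _ _ tendsto_const tail_seq]) (use fn in auto)
  have "nsq M (\<lambda>x. T (trunc r F) x - f x) \<le> 2 * ?t r" for r
  proof -
    \<comment> \<open>The limit was built along integer radii. A real radius r is compared with an
      integer n above it, and then n tends to infinity, which removes the second term.\<close>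
    have "nsq M (\<lambda>x. T (trunc r F) x - f x) \<le> 2 * ?t r + 2 * ?t (real n)" if "r \<le> real n" for n
    proof -
      have "nsq M (\<lambda>x. T (trunc r F) x - f x)
          = nsq M (\<lambda>x. (T (trunc r F) x - T (trunc (real n) F) x) + (?u n x - f x))" by simp
      also have "\<dots> \<le> 2 * nsq M (\<lambda>x. T (trunc r F) x - T (trunc (real n) F) x) + 2 * nsq M (\<lambda>x. ?u n x - f x)"
        by (intro nsq_add_le L2_diff T_L2 tc f)
      also have "nsq M (\<lambda>x. T (trunc r F) x - T (trunc (real n) F) x) = nsq M (\<lambda>x. T (trunc (real n) F) x - T (trunc r F) x)"
        by (simp add: nsq_def norm_minus_commute)
      also have "2 * \<dots> + 2 * nsq M (\<lambda>x. ?u n x - f x) \<le> 2 * ?t r + 2 * ?t (real n)"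
        using diff[OF that] fn[of n] by simp
      finally show ?thesis .
    qed
    moreover have "(\<lambda>n. 2 * ?t r + 2 * ?t (real n)) \<longlonglongrightarrow> 2 * ?t r + 2 * 0"
      by (intro tendsto_intros tail_seq)
    moreover obtain n0 where "r \<le> real n0" using real_arch_simple by blast
    ultimately have "nsq M (\<lambda>x. T (trunc r F) x - f x) \<le> 2 * ?t r + 2 * 0"
      by (intro LIMSEQ_le_const[where X = "\<lambda>n. 2 * ?t r + 2 * ?t (real n)"])
         (auto intro!: exI[of _ n0])
    thus ?thesis by simp
  qed
  moreover have tlim: "(\<lambda>n. nsq N (\<lambda>z. trunc (real n) F z - F z)) \<longlonglongrightarrow> 0"
    using tail_seq by (simp add: nsq_def norm_minus_commute)
  have "(LINT x|M. f x * cnj (g x)) = (LINT z|N. F z * cnj (B g z))" if g: "g \<in> L2 M" for g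
  proof (rule LIMSEQ_unique)
    show "(\<lambda>n. LINT x|M. ?u n x * cnj (g x)) \<longlonglongrightarrow> (LINT x|M. f x * cnj (g x))"
      by (intro L2_mult_limit T_L2 tc f L2_cnj g lim)
    show "(\<lambda>n. LINT x|M. ?u n x * cnj (g x)) \<longlonglongrightarrow> (LINT z|N. F z * cnj (B g z))"
      unfolding T_adjoint[OF tc g] by (intro L2_mult_limit t2 F L2_cnj B_L2 g tlim)
  qed
  moreover have "B f z = (LINT w|N. F w * K z w)" for z
  proof (rule LIMSEQ_unique)
    show "(\<lambda>n. B (?u n) z) \<longlonglongrightarrow> B f z"
      unfolding B_def by (intro L2_mult_limit T_L2 tc f k_L2 lim)
    show "(\<lambda>n. B (?u n) z) \<longlonglongrightarrow> (LINT w|N. F w * K z w)"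
      unfolding B_T[OF tc] P_def by (intro L2_mult_limit t2 F K_L2' tlim)
  qed
  ultimately show ?thesis using f by (intro that[of f]) auto
qed

end

section \<open>The Gaussian measure and the reproducing formula\<close>

text \<open>Left unnormalised, so that \<open>L2w \<nu>\<close> is exactly
  \<open>L2 (gauss \<nu>)\<close>; the total mass reappears as a denominator in the reproducing
  kernel.\<close>

definition gauss :: "real \<Rightarrow> 'a::euclidean_space measure" where
  "gauss \<nu> = density lborel (\<lambda>x. ennreal (exp (- \<nu> * (norm x)\<^sup>2)))"

lemma sets_gauss [measurable_cong, simp]: "sets (gauss \<nu>) = sets borel"
  by (simp add: gauss_def)

lemma space_gauss [simp]: "space (gauss \<nu>) = UNIV"
  by (simp add: gauss_def)

lemma borel_measurable_gauss [simp]: "borel_measurable (gauss \<nu>) = borel_measurable borel"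
  by (rule measurable_cong_sets) auto

lemma integrable_gauss_iff:
  fixes f :: "'a::euclidean_space \<Rightarrow> 'b::{banach, second_countable_topology}"
  assumes "f \<in> borel_measurable borel"
  shows "integrable (gauss \<nu>) f \<longleftrightarrow> integrable lborel (\<lambda>x. exp (- \<nu> * (norm x)\<^sup>2) *\<^sub>R f x)"
  unfolding gauss_def using assms by (subst integrable_density) auto

lemma integral_gauss:
  fixes f :: "'a::euclidean_space \<Rightarrow> 'b::{banach, second_countable_topology}"
  assumes "f \<in> borel_measurable borel"
  shows "(LINT x|gauss \<nu>. f x) = (LINT x|lborel. exp (- \<nu> * (norm x)\<^sup>2) *\<^sub>R f x)"
  unfolding gauss_def using assms by (subst integral_density) auto

lemma AE_gauss_iff: "(AE x in gauss \<nu>. P x) \<longleftrightarrow> (AE x in lborel. P x)"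
  unfolding gauss_def by (subst AE_density) auto

lemma L2w_eq_L2: "L2w \<nu> = L2 (gauss \<nu>)"
  by (auto simp: L2w_def L2_def integrable_gauss_iff mult.commute)

lemma inner_w_eq:
  assumes "f \<in> borel_measurable borel" "g \<in> borel_measurable borel"
  shows "inner_w \<nu> f g = (LINT x|gauss \<nu>. f x * cnj (g x))"
  unfolding inner_w_def using assms measurable_compose[OF assms(2) borel_measurable_cnj]
  by (subst integral_gauss) (auto simp: scaleR_conv_of_real mult_ac)

lemma emeasure_gauss_UNIV:
  assumes "\<nu> > 0"
  shows "emeasure (gauss \<nu>) (UNIV :: 'a::euclidean_space set) = ennreal (sqrt (pi / \<nu>) ^ DIM('a))"
  unfolding gauss_def using nn_integral_gaussian[OF assms] by (subst emeasure_density) auto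

lemma finite_measure_gauss:
  assumes "\<nu> > 0"
  shows "finite_measure (gauss \<nu>)"
  by (rule finite_measureI) (simp add: emeasure_gauss_UNIV[OF assms])

lemma measure_gauss_UNIV:
  assumes "\<nu> > 0"
  shows "measure (gauss \<nu>) (UNIV :: 'a::euclidean_space set) = sqrt (pi / \<nu>) ^ DIM('a)"
  using assms by (simp add: measure_def emeasure_gauss_UNIV)

text \<open>Half of the Gaussian absorbs the exponential: completing the square in -\<nu> t^2 / 2 +
  2 R t leaves the constant 2 R^2 / \<nu>.\<close>

lemma exp_norm_L2_gauss:
  assumes "\<nu> > 0"
  shows "(\<lambda>x::'a::euclidean_space. complex_of_real (exp (R * norm x))) \<in> L2 (gauss \<nu>)"
proof (rule L2I)
  interpret finite_measure "gauss (\<nu> / 2) :: 'a measure" by (rule finite_measure_gauss) (use assms in simp)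
  have "integrable lborel (\<lambda>x::'a. exp (2 * R\<^sup>2 / \<nu>) * exp (- (\<nu> / 2) * (norm x)\<^sup>2))"
    using integrable_const[of "1::real"] by (subst (asm) integrable_gauss_iff) auto
  hence "integrable lborel (\<lambda>x::'a. exp (- \<nu> * (norm x)\<^sup>2) *\<^sub>R (norm (complex_of_real (exp (R * norm x))))\<^sup>2)"
  proof (rule Bochner_Integration.integrable_bound)
    have "- \<nu> * t\<^sup>2 + 2 * (R * t) \<le> 2 * R\<^sup>2 / \<nu> + - (\<nu> / 2) * t\<^sup>2" for t
    proof -
      have "0 \<le> (\<nu> * t - 2 * R)\<^sup>2 / (2 * \<nu>)" using assms by simp
      also have "\<dots> = 2 * R\<^sup>2 / \<nu> + - (\<nu> / 2) * t\<^sup>2 - (- \<nu> * t\<^sup>2 + 2 * (R * t))"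
        using assms by (simp add: power2_eq_square field_simps)
      finally show ?thesis by simp
    qed
    hence "exp (- \<nu> * t\<^sup>2) * (exp (R * t))\<^sup>2 \<le> exp (2 * R\<^sup>2 / \<nu>) * exp (- (\<nu> / 2) * t\<^sup>2)" for t
      by (simp add: exp_double[symmetric] flip: exp_add)
    thus "AE x in lborel. norm (exp (- \<nu> * (norm x)\<^sup>2) *\<^sub>R (norm (complex_of_real (exp (R * norm x))))\<^sup>2)
       \<le> norm (exp (2 * R\<^sup>2 / \<nu>) * exp (- (\<nu> / 2) * (norm (x::'a))\<^sup>2))"
      by (intro AE_I2) simp
  qed auto
  thus "integrable (gauss \<nu>) (\<lambda>x::'a. (norm (complex_of_real (exp (R * norm x))))\<^sup>2)"
    by (subst integrable_gauss_iff) auto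
qed auto

lemma exp_bound_L2_gauss:
  fixes f :: "'a::euclidean_space \<Rightarrow> complex"
  assumes "\<nu> > 0" and [measurable]: "f \<in> borel_measurable borel" and "\<And>x. norm (f x) \<le> C * exp (R * norm x)"
  shows "f \<in> L2 (gauss \<nu>)"
proof (rule L2I)
  show "integrable (gauss \<nu>) (\<lambda>x. (norm (f x))\<^sup>2)"
  proof (rule Bochner_Integration.integrable_bound)
    show "integrable (gauss \<nu>) (\<lambda>x::'a. (norm (of_real C * complex_of_real (exp (R * norm x))))\<^sup>2)"
      by (intro L2_integrable L2_cmult exp_norm_L2_gauss assms)
    have "(norm (f x))\<^sup>2 \<le> (C * exp (R * norm x))\<^sup>2" for x
      using assms(3) by (intro power_mono) auto
    thus "AE x in gauss \<nu>. norm ((norm (f x))\<^sup>2) \<le> norm ((norm (of_real C * complex_of_real (exp (R * norm x))))\<^sup>2)"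
      by (intro AE_I2) (simp add: norm_mult power_mult_distrib)
  qed simp
qed simp

lemma distr_gauss_isometry:
  fixes U :: "'b::euclidean_space \<Rightarrow> 'a::euclidean_space"
  assumes "linear U" "surj U" "\<And>x. norm (U x) = norm x"
  shows "distr (gauss \<nu>) borel U = gauss \<nu>"
proof -
  have [measurable]: "U \<in> borel_measurable borel"
    using assms(1) by (intro borel_measurable_continuous_onI linear_continuous_on linear_conv_bounded_linear[THEN iffD1])
  have "distr (density lborel (\<lambda>x. ennreal (exp (- \<nu> * (norm (U x))\<^sup>2)))) borel U
      = density (distr lborel borel U) (\<lambda>x. ennreal (exp (- \<nu> * (norm x)\<^sup>2)))"
    by (rule density_distr[symmetric]) auto
  thus ?thesis by (simp add: gauss_def assms(3) lborel_distr_isometry[OF assms])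
qed

text \<open>The common structure of \<open>complex\<close> and \<open>complex^'d\<close>, so that
  the reproducing formula is proved once: \<open>sc\<close> is scalar multiplication and
  \<open>hp\<close> the hermitian product, linear in its first argument, with the Euclidean inner
  product as real part.\<close>

locale complex_space =
  fixes sc :: "complex \<Rightarrow> 'z::euclidean_space \<Rightarrow> 'z" and hp :: "'z \<Rightarrow> 'z \<Rightarrow> complex"
  assumes linear_sc: "linear (sc c)"
    and sc_sc: "sc c (sc d z) = sc (c * d) z"
    and sc_1: "sc 1 z = z"
    and norm_sc: "norm (sc c z) = norm c * norm z"
    and sc_cont: "continuous_on UNIV (\<lambda>(c, z). sc c z)"
    and hp_cont: "continuous_on UNIV (\<lambda>(z, w). hp z w)"
    and hp_add: "hp (z + z') w = hp z w + hp z' w"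
    and hp_sc: "hp (sc c z) w = c * hp z w"
    and cnj_hp: "cnj (hp z w) = hp w z"
    and Re_hp: "Re (hp z w) = z \<bullet> w"
begin

text \<open>Both \<open>holomorphic_on\<close> and \<open>entire_vec\<close> imply this, and circle
  averages see no more of a function than its restrictions to complex lines.\<close>

definition line_entire :: "('z \<Rightarrow> complex) \<Rightarrow> bool" where
  "line_entire F \<longleftrightarrow> continuous_on UNIV F \<and> (\<forall>z v. (\<lambda>u. F (z + sc u v)) holomorphic_on UNIV)"

lemma sc_0 [simp]: "sc 0 z = 0"
  using norm_sc[of 0 z] by simp

lemma surj_sc: "c \<noteq> 0 \<Longrightarrow> surj (sc c)"
  by (intro surjI[where f = "sc (inverse c)"]) (simp add: sc_sc sc_1)

lemma hp_self: "hp z z = of_real ((norm z)\<^sup>2)"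
proof -
  have "Im (hp z z) = 0" using arg_cong[OF cnj_hp[of z z], of Im] by simp
  thus ?thesis by (simp add: complex_eq_iff Re_hp power2_norm_eq_inner)
qed

lemma hp_add_right: "hp w (z + z') = hp w z + hp w z'"
  by (simp add: hp_add flip: cnj_hp[of _ w])

lemma norm_exp_hp_le: "norm (exp (of_real \<nu> * hp z w)) \<le> exp (\<bar>\<nu>\<bar> * norm z * norm w)"
proof -
  have "\<nu> * (z \<bullet> w) \<le> \<bar>\<nu>\<bar> * (norm z * norm w)"
    using Cauchy_Schwarz_ineq2[of z w]
    by (intro order.trans[OF abs_ge_self[of "\<nu> * (z \<bullet> w)"]]) (auto simp: abs_mult intro: mult_left_mono)
  thus ?thesis by (simp add: norm_exp_eq_Re Re_hp mult.assoc)
qed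

lemma hp_cont': "continuous_on UNIV (\<lambda>w. hp z w)" "continuous_on UNIV (\<lambda>w. hp w z)"
proof -
  have "continuous_on UNIV (\<lambda>w::'z. (z, w))" "continuous_on UNIV (\<lambda>w::'z. (w, z))" by (intro continuous_intros)+
  from this[THEN continuous_on_compose2[OF hp_cont]]
  show "continuous_on UNIV (\<lambda>w. hp z w)" "continuous_on UNIV (\<lambda>w. hp w z)" by auto
qed

text \<open>Multiplication by a unit complex number preserves the Gaussian measure. Averaging over
  these rotations replaces F w by its mean over the circle through w on the complex line of w, which
  is F 0 by Cauchy's formula; Fubini exchanges the two averages.\<close>

lemma gauss_mean_value:
  assumes F: "line_entire F" and int: "integrable (gauss \<nu>) F" and \<nu>: "\<nu> > 0"
  shows "(LINT w|gauss \<nu>. F w) = F 0 * of_real (measure (gauss \<nu>) (UNIV :: 'z set))"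
proof -
  define e where "e t = exp (2 * of_real pi * \<i> * complex_of_real t)" for t :: real
  define L :: "real measure" where "L = restrict_space lborel {0..1}"
  have Fc: "continuous_on UNIV F" using F by (simp add: line_entire_def)
  have ec: "continuous_on UNIV e" unfolding e_def by (intro continuous_intros)
  have ne: "norm (e t) = 1" for t
    using norm_exp_i_times[of "2 * pi * t"] by (simp add: e_def mult_ac)
  interpret G: finite_measure "gauss \<nu> :: 'z measure" by (rule finite_measure_gauss[OF \<nu>])
  have L1: "emeasure L (space L) = 1" by (simp add: L_def emeasure_restrict_space space_restrict_space)
  interpret L: finite_measure L by (rule finite_measureI) (simp add: L1)
  interpret pair_sigma_finite L "gauss \<nu> :: 'z measure" ..
  have "continuous_on UNIV (\<lambda>p. sc (e (fst p)) (snd p))"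
    using continuous_on_compose2[OF sc_cont, of UNIV "\<lambda>p. (e (fst p), snd p)"]
      continuous_on_Pair[OF continuous_on_compose2[OF ec continuous_on_fst[OF continuous_on_id]] continuous_on_snd[OF continuous_on_id]]
    by auto
  hence fc: "continuous_on UNIV (\<lambda>p. F (sc (e (fst p)) (snd p)))"
    by (rule continuous_on_compose2[OF Fc]) auto
  have "(\<lambda>p. F (sc (e (fst p)) (snd p))) \<in> borel_measurable (lborel \<Otimes>\<^sub>M gauss \<nu>)"
    using borel_measurable_continuous_onI[OF fc]
    by (simp add: borel_prod[symmetric] cong: measurable_cong_sets sets_pair_measure_cong[OF sets_lborel sets_gauss])
  moreover have "(\<lambda>p. (fst p, snd p)) \<in> L \<Otimes>\<^sub>M gauss \<nu> \<rightarrow>\<^sub>M lborel \<Otimes>\<^sub>M (gauss \<nu> :: 'z measure)"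
    unfolding L_def by (intro measurable_Pair measurable_snd measurable_compose[OF measurable_fst] measurable_restrict_space1) simp
  ultimately have fm: "(\<lambda>p. F (sc (e (fst p)) (snd p))) \<in> borel_measurable (L \<Otimes>\<^sub>M gauss \<nu>)"
    using measurable_compose by fastforce
  have rot: "distr (gauss \<nu>) borel (sc (e t)) = gauss \<nu>" for t
    using ne[of t] by (intro distr_gauss_isometry linear_sc surj_sc) (auto simp: norm_sc)
  have scm: "sc (e t) \<in> gauss \<nu> \<rightarrow>\<^sub>M borel" for t
    using linear_sc by (simp, intro borel_measurable_continuous_onI linear_continuous_on linear_conv_bounded_linear[THEN iffD1])
  have Fm [measurable]: "F \<in> borel_measurable borel" by (rule borel_measurable_continuous_onI[OF Fc])
  have rot_int: "integrable (gauss \<nu>) (\<lambda>w. F (sc (e t) w))" for t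
    using int integrable_distr_eq[OF scm Fm, of t] by (simp add: rot)
  have rot_eq: "(LINT w|gauss \<nu>. g (sc (e t) w)) = (LINT w|gauss \<nu>. g w)"
    if "g \<in> borel_measurable borel" for t and g :: "'z \<Rightarrow> 'b::{banach, second_countable_topology}"
    using integral_distr[OF scm that, of t] by (simp add: rot)
  \<comment> \<open>By rotation invariance the inner integral of the modulus is the same for every
    angle.\<close>
  have pint: "integrable (L \<Otimes>\<^sub>M gauss \<nu>) (\<lambda>p. F (sc (e (fst p)) (snd p)))"
  proof (rule Fubini_integrable[OF fm])
    show "integrable L (\<lambda>t. LINT w|gauss \<nu>. norm (F (sc (e (fst (t, w))) (snd (t, w)))))"
      using rot_eq[of "\<lambda>w. norm (F w)"] by simp
  qed (simp add: rot_int)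
  have circle: "(LINT t|L. F (sc (e t) w)) = F 0" for w
  proof -
    \<comment> \<open>The summand 0 brings the line through the origin into the shape z +
      \<open>sc u v\<close> used by \<open>line_entire\<close>.\<close>
    define \<phi> where "\<phi> u = F (0 + sc u w)" for u
    have hol: "\<phi> holomorphic_on UNIV" using F unfolding line_entire_def \<phi>_def by blast
    have "((\<lambda>u. \<phi> u / (u - 0)) has_contour_integral (2 * of_real pi * \<i> * \<phi> 0)) (circlepath 0 1)"
      by (rule Cauchy_integral_circlepath_simple) (auto intro: holomorphic_on_subset[OF hol])
    hence "((\<lambda>t. \<phi> (circlepath 0 1 t) / (circlepath 0 1 t - 0) * vector_derivative (circlepath 0 1) (at t within {0..1}))
              has_integral (2 * of_real pi * \<i> * \<phi> 0)) {0..1}"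
      by (simp add: has_contour_integral_def)
    hence "((\<lambda>t. 2 * of_real pi * \<i> * \<phi> (e t)) has_integral (2 * of_real pi * \<i> * \<phi> 0)) {0..1}"
      by (rule has_integral_eq[rotated]) (simp add: vector_derivative_circlepath01, simp add: circlepath e_def)
    from has_integral_mult_right[OF this, of "1 / (2 * of_real pi * \<i>)"]
    have hi: "((\<lambda>t. \<phi> (e t)) has_integral \<phi> 0) {0..1}" by simp
    have c: "continuous_on {0..1} (\<lambda>t. \<phi> (e t))"
      using continuous_on_compose2[OF holomorphic_on_imp_continuous_on[OF hol] ec]
      by (auto intro: continuous_on_subset)
    have "(LINT t|L. \<phi> (e t)) = (LINT t:{0..1}|lborel. \<phi> (e t))"
      unfolding L_def set_lebesgue_integral_def by (subst integral_restrict_space) auto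
    also have "\<dots> = integral {0..1} (\<lambda>t. \<phi> (e t))"
      by (intro set_borel_integral_eq_integral borel_integrable_atLeastAtMost' c)
    also have "\<dots> = \<phi> 0" using hi by (rule integral_unique)
    finally show ?thesis by (simp add: \<phi>_def)
  qed
  have "F 0 * of_real (measure (gauss \<nu>) (UNIV :: 'z set)) = (LINT w|gauss \<nu>. (LINT t|L. F (sc (e t) w)))"
    by (simp add: circle scaleR_conv_of_real mult.commute)
  also have "\<dots> = (LINT t|L. (LINT w|gauss \<nu>. F (sc (e t) w)))"
    using pint by (intro Fubini_integral) (simp add: case_prod_unfold)
  also have "\<dots> = (LINT w|gauss \<nu>. F w)"
    using rot_eq[OF Fm] L1 by (simp add: measure_def)
  finally show ?thesis by simp
qed

text \<open>The reproducing kernel of the Fock space with respect to the unnormalised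
  \<open>gauss \<nu>\<close>.\<close>

definition K :: "real \<Rightarrow> 'z \<Rightarrow> 'z \<Rightarrow> complex" where
  "K \<nu> z w = exp (of_real \<nu> * hp z w) / of_real (measure (gauss \<nu>) (UNIV :: 'z set))"

lemma line_entire_exp_hp: "line_entire (\<lambda>z. exp (c * hp z a))"
  unfolding line_entire_def
  by (auto simp: hp_add hp_sc intro!: continuous_intros hp_cont' holomorphic_intros)

lemma line_entire_mult: "line_entire F \<Longrightarrow> line_entire G \<Longrightarrow> line_entire (\<lambda>z. F z * G z)"
  by (auto simp: line_entire_def intro!: continuous_intros holomorphic_intros)

lemma line_entire_shift: "line_entire F \<Longrightarrow> line_entire (\<lambda>w. F (z + w))"
proof -
  assume F: "line_entire F"
  have "continuous_on UNIV (\<lambda>w. z + w)" by (intro continuous_intros)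
  with F have "continuous_on UNIV (\<lambda>w. F (z + w))"
    using continuous_on_compose2[of UNIV F UNIV "\<lambda>w. z + w"] by (simp add: line_entire_def)
  thus ?thesis using F by (simp add: line_entire_def flip: add.assoc)
qed

text \<open>The mean value property for the entire function \<open>w \<mapsto> F (z + w) exp (-\<nu> \<langle>w, z\<rangle>)\<close>.\<close>

lemma gauss_reproducing:
  assumes F: "line_entire F" and \<nu>: "\<nu> > 0"
    and int: "\<And>R. integrable (gauss \<nu>) (\<lambda>w. exp (R * norm w) * norm (F w))"
  shows "(LINT w|gauss \<nu>. F w * K \<nu> z w) = F z"
proof -
  let ?m = "complex_of_real (measure (gauss \<nu>) (UNIV :: 'z set))"
  have m: "?m \<noteq> 0" using \<nu> by (simp add: measure_gauss_UNIV)
  have Fc: "continuous_on UNIV F" using F by (simp add: line_entire_def)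
  have Fm [measurable]: "F \<in> borel_measurable borel" by (rule borel_measurable_continuous_onI[OF Fc])
  have hm [measurable]: "hp z \<in> borel_measurable borel" "(\<lambda>w. hp w z) \<in> borel_measurable borel"
    by (intro borel_measurable_continuous_onI hp_cont')+
  define G where "G w = F (z + w) * exp (- of_real \<nu> * hp w z)" for w
  have Gm [measurable]: "G \<in> borel_measurable borel" unfolding G_def by measurable
  have G: "line_entire G" unfolding G_def by (intro line_entire_mult line_entire_shift F line_entire_exp_hp)
  define H where "H u = exp (- \<nu> * (norm u)\<^sup>2) *\<^sub>R (F u * exp (of_real \<nu> * hp z u))" for u
  have Hm [measurable]: "H \<in> borel_measurable borel" unfolding H_def by measurable
  have "integrable (gauss \<nu>) (\<lambda>u. F u * exp (of_real \<nu> * hp z u))"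
  proof (rule Bochner_Integration.integrable_bound[OF int[of "\<nu> * norm z"]])
    show "AE w in gauss \<nu>. norm (F w * exp (of_real \<nu> * hp z w)) \<le> norm (exp (\<nu> * norm z * norm w) * norm (F w))"
      using norm_exp_hp_le[of \<nu> z] \<nu> by (intro AE_I2) (auto simp: norm_mult mult.commute[of _ "norm (F _)"] intro: mult_left_mono)
  qed simp
  hence H1: "integrable lborel H" unfolding H_def by (subst (asm) integrable_gauss_iff) simp_all
  \<comment> \<open>Expanding |z + w|^2 cancels |z|^2 and the product of z with w, which is
    antiholomorphic in w. What remains is holomorphic in w, so the mean value property applies after
    the translation.\<close>
  have shift: "H (z + w) = exp (- \<nu> * (norm w)\<^sup>2) *\<^sub>R G w" for w
  proof -
    have "complex_of_real ((norm (z + w))\<^sup>2) = hp z z + hp z w + hp w z + of_real ((norm w)\<^sup>2)"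
      using hp_self[of "z + w"] hp_self[of w] by (simp add: hp_add hp_add_right add_ac)
    hence "complex_of_real (- \<nu> * (norm (z + w))\<^sup>2) + of_real \<nu> * hp z (z + w)
        = of_real (- \<nu> * (norm w)\<^sup>2) + - of_real \<nu> * hp w z"
      by (simp add: hp_add_right algebra_simps)
    hence "exp (complex_of_real (- \<nu> * (norm (z + w))\<^sup>2)) * exp (of_real \<nu> * hp z (z + w))
        = exp (of_real (- \<nu> * (norm w)\<^sup>2)) * exp (- of_real \<nu> * hp w z)"
      by (simp only: exp_add[symmetric])
    thus ?thesis unfolding H_def G_def by (simp only: scaleR_conv_of_real exp_of_real[symmetric]) (simp add: mult_ac)
  qed
  have pm: "(+) z \<in> lborel \<rightarrow>\<^sub>M borel" by simp
  have "integrable lborel (\<lambda>w. H (z + w))"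
    using H1 integrable_distr_eq[OF pm Hm] by (simp add: lborel_distr_plus)
  hence Gint: "integrable (gauss \<nu>) G" by (subst integrable_gauss_iff) (simp_all add: shift)
  have "(LINT u|gauss \<nu>. F u * exp (of_real \<nu> * hp z u)) = (LINT u|lborel. H u)"
    unfolding H_def by (rule integral_gauss) simp
  also have "\<dots> = (LINT w|lborel. H (z + w))"
    using integral_distr[OF pm Hm] by (simp add: lborel_distr_plus)
  also have "\<dots> = (LINT w|gauss \<nu>. G w)"
    by (simp add: shift integral_gauss)
  also have "\<dots> = G 0 * ?m" by (rule gauss_mean_value[OF G Gint \<nu>])
  also have "G 0 = F z"
    using hp_sc[of 0 z z] by (simp add: G_def)
  finally have "(LINT u|gauss \<nu>. F u * exp (of_real \<nu> * hp z u)) = F z * ?m" .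
  thus ?thesis using m by (simp add: K_def)
qed

text \<open>\<open>gauss_reproducing\<close> assumes exponentially weighted integrability because it
  is also applied to products of Fock functions with exponentials, which need not be in L2. For F in
  L2 the assumption follows from Cauchy-Schwarz.\<close>

lemma L2_reproducing:
  assumes F: "line_entire F" "F \<in> L2 (gauss \<nu>)" and \<nu>: "\<nu> > 0"
  shows "(LINT w|gauss \<nu>. F w * K \<nu> z w) = F z"
proof (rule gauss_reproducing[OF F(1) \<nu>])
  show "integrable (gauss \<nu>) (\<lambda>w. exp (R * norm w) * norm (F w))" for R
    using L2_integrable_norm_mult[OF exp_norm_L2_gauss[OF \<nu>, of R] F(2)] by simp
qed

lemma K_cont: "continuous_on UNIV (\<lambda>(z, w). K \<nu> z w)"
  unfolding K_def divide_inverse using hp_cont by (auto simp: case_prod_unfold intro!: continuous_intros)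

lemma line_entire_K: "line_entire (\<lambda>z. K \<nu> z a)"
  using line_entire_mult[OF line_entire_exp_hp[of "of_real \<nu>" a], of "\<lambda>_. 1 / of_real (measure (gauss \<nu>) (UNIV :: 'z set))"]
  by (simp add: K_def line_entire_def)

lemma cnj_K: "cnj (K \<nu> z w) = K \<nu> w z"
  by (simp add: K_def cnj_hp exp_cnj)

lemma K_L2:
  assumes "\<nu> > 0"
  shows "(\<lambda>w. K \<nu> w a) \<in> L2 (gauss \<nu>)"
proof (rule exp_bound_L2_gauss[OF assms])
  show "(\<lambda>w. K \<nu> w a) \<in> borel_measurable borel"
    using line_entire_K[of \<nu> a] by (intro borel_measurable_continuous_onI) (simp add: line_entire_def)
  show "norm (K \<nu> w a) \<le> (1 / measure (gauss \<nu>) (UNIV :: 'z set)) * exp ((\<nu> * norm a) * norm w)" for w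
    using norm_exp_hp_le[of \<nu> w a] assms
    by (simp add: K_def norm_divide mult_ac divide_right_mono)
qed

text \<open>A Gram identity for k suffices: idempotence of K is the reproducing formula applied to
  the function K(., a), itself entire and square integrable.\<close>

lemma coherent_kernelI:
  fixes k :: "'z \<Rightarrow> 'x::euclidean_space \<Rightarrow> complex"
  assumes "\<nu> > 0" "continuous_on UNIV (\<lambda>(z, x). k z x)" "\<And>z. k z \<in> L2 (gauss \<nu>)"
    and "\<And>z w. (LINT x|gauss \<nu>. k z x * cnj (k w x)) = K \<nu> z w"
  shows "coherent_kernel (gauss \<nu>) (gauss \<nu>) k (K \<nu>)"
proof -
  have "(LINT w|gauss \<nu>. K \<nu> z w * K \<nu> w a) = K \<nu> z a" for z a
    using L2_reproducing[OF line_entire_K K_L2, of \<nu> a z] assms(1) by (simp add: mult.commute)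
  thus ?thesis
    using assms K_cont[of \<nu>] K_L2[of \<nu>]
    by (intro coherent_kernel.intro coherent_kernel_axioms.intro finite_measure_gauss) auto
qed

end

interpretation C1: complex_space "(*)" "\<lambda>z w. z * cnj w"
proof (rule complex_space.intro)
  show "linear ((*) c)" for c :: complex by (intro linearI) (auto simp: algebra_simps)
qed (auto simp: norm_mult case_prod_unfold algebra_simps inner_complex_def intro!: continuous_intros)

interpretation Cd: complex_space "(*s)" "\<lambda>z w :: complex^'d. \<Sum>i\<in>UNIV. z $ i * cnj (w $ i)"
proof (rule complex_space.intro)
  show "linear ((*s) c)" for c :: complex by (intro linearI) (auto simp: vec_eq_iff algebra_simps)
  show "norm (c *s z) = norm c * norm z" for c and z :: "complex^'d"
    by (simp add: norm_vec_def norm_mult L2_set_right_distrib)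
  show "continuous_on UNIV (\<lambda>(c, z :: complex^'d). c *s z)"
    unfolding vector_scalar_mult_def case_prod_unfold by (intro continuous_intros)
qed (auto simp: vec_eq_iff case_prod_unfold algebra_simps sum.distrib sum_distrib_left inner_vec_def inner_complex_def
        intro!: continuous_intros sum.cong)

section \<open>Parameter integrals and Fourier injectivity\<close>

lemma sum_exp_series_le: "t \<ge> 0 \<Longrightarrow> (\<Sum>i<n. t ^ i / fact i) \<le> exp (t::real)"
  using sum_le_suminf[of "\<lambda>i. t ^ i / fact i" "{..<n}"] sums_unique[OF exp_converges[of t]]
    sums_summable[OF exp_converges[of t]]
  by (simp add: divide_inverse mult.commute)

text \<open>The exponential is expanded and integrated term by term, giving a power series that
  converges everywhere. The integrable function |u| exp(|z| |a|) dominates all partial sums.\<close>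

lemma holomorphic_integral_exp:
  fixes u a :: "'a \<Rightarrow> complex"
  assumes [measurable]: "u \<in> borel_measurable M" "a \<in> borel_measurable M"
    and int: "\<And>R. integrable M (\<lambda>x. norm (u x) * exp (R * norm (a x)))"
  shows "(\<lambda>z. LINT x|M. u x * exp (z * a x)) holomorphic_on UNIV"
proof -
  let ?f = "\<lambda>z. LINT x|M. u x * exp (z * a x)"
  have sums: "(\<lambda>n. (LINT x|M. u x * a x ^ n / fact n) * (z - 0) ^ n) sums ?f z" for z
  proof -
    let ?g = "\<lambda>n x. u x * (z * a x) ^ n / fact n"
    have ng: "norm (?g n x) = norm (u x) * ((norm z * norm (a x)) ^ n / fact n)" for n x
      by (simp add: norm_mult norm_divide norm_power)
    have psum: "(\<Sum>i<n. norm (?g i x)) \<le> norm (u x) * exp (norm z * norm (a x))" for n x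
    proof -
      have "(\<Sum>i<n. norm (?g i x)) = norm (u x) * (\<Sum>i<n. (norm z * norm (a x)) ^ i / fact i)"
        unfolding ng by (rule sum_distrib_left[symmetric])
      thus ?thesis using sum_exp_series_le[of "norm z * norm (a x)" n] by (simp add: mult_left_mono)
    qed
    have gint: "integrable M (?g n)" for n
    proof (rule Bochner_Integration.integrable_bound[OF int[of "norm z"]])
      have "norm (?g n x) \<le> norm (u x) * exp (norm z * norm (a x))" for x
        using psum[where n = "Suc n" and x = x] sum_nonneg[of "{..<n}" "\<lambda>i. norm (?g i x)"] by simp
      thus "AE x in M. norm (?g n x) \<le> norm (norm (u x) * exp (norm z * norm (a x)))"
        by (intro AE_I2) simp
    qed measurable
    have ptsum: "(\<lambda>n. ?g n x) sums (u x * exp (z * a x))" for x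
      using sums_mult[OF exp_converges[of "z * a x"], of "u x"]
      by (simp add: scaleR_conv_of_real divide_inverse mult_ac)
    have "(\<lambda>n. integral\<^sup>L M (?g n)) sums (LINT x|M. (\<Sum>n. ?g n x))"
    proof (rule sums_integral[OF gint])
      show "AE x in M. summable (\<lambda>n. norm (?g n x))"
        by (intro AE_I2 summableI_nonneg_bounded[OF _ psum]) simp
      show "summable (\<lambda>n. LINT x|M. norm (?g n x))"
      proof (rule summableI_nonneg_bounded)
        fix n
        have "(\<Sum>i<n. LINT x|M. norm (?g i x)) = (LINT x|M. (\<Sum>i<n. norm (?g i x)))"
          by (rule Bochner_Integration.integral_sum[symmetric]) (rule integrable_norm[OF gint])
        also have "\<dots> \<le> (LINT x|M. norm (u x) * exp (norm z * norm (a x)))"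
          by (intro integral_mono Bochner_Integration.integrable_sum integrable_norm gint int psum)
        finally show "(\<Sum>i<n. LINT x|M. norm (?g i x)) \<le> (LINT x|M. norm (u x) * exp (norm z * norm (a x)))" .
      qed simp
    qed
    moreover have "(\<Sum>n. ?g n x) = u x * exp (z * a x)" for x
      using ptsum[of x] by (simp add: sums_iff)
    moreover have "integral\<^sup>L M (?g n) = (LINT x|M. u x * a x ^ n / fact n) * (z - 0) ^ n" for n
      by (subst Bochner_Integration.integral_mult_left_zero[symmetric])
         (simp add: power_mult_distrib mult_ac)
    ultimately show ?thesis by simp
  qed
  have "?f holomorphic_on ball 0 r" for r
    by (rule power_series_holomorphic) (rule sums)
  hence "?f holomorphic_on (\<Union>r. ball 0 r)" by (intro holomorphic_on_UN_open) auto
  moreover have "(\<Union>r. ball 0 r) = (UNIV :: complex set)"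
    by (auto intro: gt_ex)
  ultimately show ?thesis by simp
qed

lemma char_density_real:
  fixes p :: "real \<Rightarrow> real"
  assumes "p \<in> borel_measurable borel" "\<And>x. p x \<ge> 0"
  shows "char (density lborel (\<lambda>x. ennreal (p x))) t = (LINT x|lborel. of_real (p x) * iexp (t * x))"
  unfolding char_def using assms by (subst integral_density) (auto simp: scaleR_conv_of_real)

text \<open>
  Both normalised parts of \<open>g\<close> are probability densities with the same characteristic function.
\<close>

lemma fourier_inj_real:
  fixes g :: "real \<Rightarrow> real"
  assumes int: "integrable lborel g" and zero: "\<And>t. (LINT x|lborel. of_real (g x) * iexp (t * x)) = 0"
  shows "AE x in lborel. g x = 0"
proof -
  define p n where "p x = max 0 (g x)" and "n x = max 0 (- g x)" for x
  have g: "g x = p x - n x" for x by (simp add: p_def n_def)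
  have pos: "p x \<ge> 0" "n x \<ge> 0" for x by (simp_all add: p_def n_def)
  have pn: "integrable lborel p" "integrable lborel n"
    unfolding p_def n_def using int by simp_all
  have [measurable]: "p \<in> borel_measurable borel" "n \<in> borel_measurable borel"
    using pn by (auto dest: borel_measurable_integrable)
  have eint: "integrable lborel (\<lambda>x. complex_of_real (q x) * iexp (t * x))" if "integrable lborel q" for q t
  proof (rule Bochner_Integration.integrable_bound[OF integrable_norm[OF that]])
    have [measurable]: "q \<in> borel_measurable borel" using that by (auto dest: borel_measurable_integrable)
    show "(\<lambda>x. complex_of_real (q x) * iexp (t * x)) \<in> borel_measurable lborel" by measurable
  qed (simp add: norm_mult)
  have eq: "(LINT x|lborel. of_real (p x) * iexp (t * x)) = (LINT x|lborel. of_real (n x) * iexp (t * x))" for t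
    using zero[of t] eint[OF pn(1), of t] eint[OF pn(2), of t] by (simp add: g left_diff_distrib)
  define c where "c = integral\<^sup>L lborel p"
  \<comment> \<open>Frequency 0 compares the total masses, so one constant normalises both parts;
    mass zero is treated apart.\<close>
  have cn: "c = integral\<^sup>L lborel n"
    using eq[of 0] by (simp add: c_def)
  have "c \<ge> 0" unfolding c_def using pos by simp
  show ?thesis
  proof (cases "c = 0")
    case True
    have "AE x in lborel. p x = 0" "AE x in lborel. n x = 0"
      using True cn pn pos integral_nonneg_eq_0_iff_AE[of lborel p] integral_nonneg_eq_0_iff_AE[of lborel n]
      by (simp_all add: c_def)
    thus ?thesis by eventually_elim (simp add: g)
  next
    case False
    hence c: "c > 0" using \<open>c \<ge> 0\<close> by simp
    have rd: "real_distribution (density lborel (\<lambda>x. ennreal (q x / c)))"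
      if q: "integrable lborel q" "\<And>x. q x \<ge> 0" "integral\<^sup>L lborel q = c" for q
    proof -
      have [measurable]: "q \<in> borel_measurable borel" using q by (auto dest: borel_measurable_integrable)
      have "(\<integral>\<^sup>+x. ennreal (q x / c) \<partial>lborel) = ennreal (LINT x|lborel. q x / c)"
        using q c by (intro nn_integral_eq_integral) auto
      hence "emeasure (density lborel (\<lambda>x. ennreal (q x / c))) UNIV = 1"
        using q c by (simp add: emeasure_density)
      thus ?thesis
        by (auto simp: real_distribution_def real_distribution_axioms_def intro!: prob_spaceI)
    qed
    have "density lborel (\<lambda>x. ennreal (p x / c)) = density lborel (\<lambda>x. ennreal (n x / c))"
    proof (rule Levy_uniqueness)
      show "char (density lborel (\<lambda>x. ennreal (p x / c))) = char (density lborel (\<lambda>x. ennreal (n x / c)))"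
        using eq c pos by (intro ext) (simp add: char_density_real)
    qed (intro rd pn pos cn[symmetric] c_def[symmetric])+
    hence "AE x in lborel. ennreal (p x / c) = ennreal (n x / c)"
      using pos c by (subst (asm) sigma_finite_measure.density_unique_iff[OF sigma_finite_lborel]) auto
    thus ?thesis by eventually_elim (use c pos in \<open>simp add: g\<close>)
  qed
qed

text \<open>Conjugation reflects the frequency, so cnj g has vanishing Fourier transform too, and
  with it the real and imaginary parts of g.\<close>

lemma fourier_inj:
  fixes g :: "real \<Rightarrow> complex"
  assumes int: "integrable lborel g" and zero: "\<And>t. (LINT x|lborel. g x * iexp (t * x)) = 0"
  shows "AE x in lborel. g x = 0"
proof -
  have [measurable]: "g \<in> borel_measurable borel" using int by (auto dest: borel_measurable_integrable)
  have eint: "integrable lborel (\<lambda>x. h x * iexp (t * x))" if "integrable lborel h" for h :: "real \<Rightarrow> complex" and t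
  proof (rule Bochner_Integration.integrable_bound[OF integrable_norm[OF that]])
    have [measurable]: "h \<in> borel_measurable borel" using that by (auto dest: borel_measurable_integrable)
    show "(\<lambda>x. h x * iexp (t * x)) \<in> borel_measurable lborel" by measurable
  qed (simp add: norm_mult)
  have zero': "(LINT x|lborel. cnj (g x) * iexp (t * x)) = 0" for t
  proof -
    have "(LINT x|lborel. cnj (g x) * iexp (t * x)) = cnj (LINT x|lborel. g x * iexp (- t * x))"
      by (subst Bochner_Integration.integral_cnj[symmetric]) (simp add: exp_cnj)
    thus ?thesis using zero[of "- t"] by simp
  qed
  have cint: "integrable lborel (\<lambda>x. cnj (g x))" using int by simp
  have "AE x in lborel. Re (g x) = 0"
  proof (rule fourier_inj_real)
    fix t
    have "(LINT x|lborel. of_real (Re (g x)) * iexp (t * x))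
        = (LINT x|lborel. (g x * iexp (t * x) + cnj (g x) * iexp (t * x)) / 2)"
      by (intro Bochner_Integration.integral_cong refl) (simp add: complex_add_cnj flip: distrib_right)
    thus "(LINT x|lborel. of_real (Re (g x)) * iexp (t * x)) = 0"
      using zero[of t] zero'[of t] eint[OF int, of t] eint[OF cint, of t] by simp
  qed (use int in simp)
  moreover have "AE x in lborel. Im (g x) = 0"
  proof (rule fourier_inj_real)
    fix t
    have "(LINT x|lborel. of_real (Im (g x)) * iexp (t * x))
        = (LINT x|lborel. (g x * iexp (t * x) - cnj (g x) * iexp (t * x)) / (2 * \<i>))"
      by (intro Bochner_Integration.integral_cong refl) (simp add: complex_diff_cnj mult.left_commute flip: left_diff_distrib)
    thus "(LINT x|lborel. of_real (Im (g x)) * iexp (t * x)) = 0"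
      using zero[of t] zero'[of t] eint[OF int, of t] eint[OF cint, of t] by simp
  qed (use int in simp)
  ultimately show ?thesis by eventually_elim (simp add: complex_eq_iff)
qed

section \<open>The Segal-Bargmann transform\<close>

text \<open>This is what fixes the exponent 3d/4: with s = \<nu> / pi the left side is s^(3d/2)
  s^(-d/2) = s^d, the reciprocal of the Gaussian mass of complex d-space, whose real dimension is
  2d.\<close>

lemma gaussian_norm_const:
  assumes "\<nu> > 0"
  shows "((\<nu> / pi) powr (3 * real n / 4))\<^sup>2 * sqrt (pi / \<nu>) ^ n = 1 / sqrt (pi / \<nu>) ^ (2 * n)"
proof -
  define s where "s = \<nu> / pi"
  have s: "s > 0" using assms by (simp add: s_def)
  have q: "sqrt (pi / \<nu>) = s powr (- (1/2))"
    using assms by (simp add: s_def powr_minus_divide powr_half_sqrt real_sqrt_divide)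
  have p: "sqrt (pi / \<nu>) ^ m = s powr (- real m / 2)" for m
    unfolding q using s by (simp add: powr_powr flip: powr_realpow)
  have "(s powr (3 * real n / 4))\<^sup>2 = s powr (3 * real n / 2)"
    using s by (simp add: powr_powr flip: powr_realpow)
  thus ?thesis using s unfolding p s_def[symmetric]
    by (simp add: powr_add[symmetric] powr_minus_divide[symmetric])
qed

lemma integral_exp_cnj_gauss:
  fixes c d :: "'x::euclidean_space \<Rightarrow> complex"
  assumes "\<nu> > 0"
  shows "(LINT x|gauss \<nu>. exp (\<Sum>b\<in>Basis. c b * of_real (x \<bullet> b)) * cnj (exp (\<Sum>b\<in>Basis. d b * of_real (x \<bullet> b))))
       = of_real (sqrt (pi / \<nu>)) ^ DIM('x) * exp ((\<Sum>b\<in>(Basis::'x set). (c b + cnj (d b))\<^sup>2) / of_real (4 * \<nu>))"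
proof -
  have "(LINT x|gauss \<nu>. exp (\<Sum>b\<in>Basis. c b * of_real (x \<bullet> b)) * cnj (exp (\<Sum>b\<in>Basis. d b * of_real (x \<bullet> b))))
      = (LINT x::'x|gauss \<nu>. exp (\<Sum>b\<in>Basis. (c b + cnj (d b)) * of_real (x \<bullet> b)))"
    by (simp add: exp_cnj sum.distrib algebra_simps flip: exp_add)
  also have "\<dots> = (LINT x::'x|lborel. exp (- complex_of_real \<nu> * (of_real (norm x))\<^sup>2 + (\<Sum>b\<in>Basis. (c b + cnj (d b)) * of_real (x \<bullet> b))))"
    by (subst integral_gauss) (simp_all only: scaleR_conv_of_real exp_of_real[symmetric] exp_add, simp_all)
  finally show ?thesis
    using has_bochner_integral_gaussian[OF assms, of "\<lambda>b. c b + cnj (d b)"]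
    by (simp add: has_bochner_integral_iff)
qed

lemma sum_Basis_real_vec:
  fixes g :: "real^'d \<Rightarrow> 'b::comm_monoid_add"
  shows "(\<Sum>b\<in>Basis. g b) = (\<Sum>i\<in>UNIV. g (axis i 1))"
proof -
  have "bij_betw (\<lambda>i. axis i 1) UNIV (Basis :: (real^'d) set)"
    by (auto simp: bij_betw_def inj_on_def axis_eq_axis Basis_vec_def)
  from sum.reindex_bij_betw[OF this, of g] show ?thesis ..
qed

text \<open>
  The kernels are taken with respect to the weighted measure, so the factor \<open>exp (-\<nu> x\<^sup>2)\<close> of the
  transform is divided out.
\<close>

definition sb_kernel :: "real \<Rightarrow> complex^'d \<Rightarrow> real^'d \<Rightarrow> complex" where
  "sb_kernel \<nu> z x = of_real ((\<nu> / pi) powr (3 * real CARD('d) / 4)) *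
     exp (of_real (sqrt 2 * \<nu>) * (\<Sum>i\<in>UNIV. of_real (x $ i) * z $ i) - of_real (\<nu> / 2) * (\<Sum>i\<in>UNIV. (z $ i)\<^sup>2))"

definition sb1_kernel :: "real \<Rightarrow> complex \<Rightarrow> real \<Rightarrow> complex" where
  "sb1_kernel \<nu> z x = of_real ((\<nu> / pi) powr (3 / 4)) *
     exp (of_real (sqrt 2 * \<nu>) * of_real x * z - of_real (\<nu> / 2) * z\<^sup>2)"

lemma sqrt2_squared_complex: "(complex_of_real (sqrt 2))\<^sup>2 = 2"
  by (simp flip: of_real_power)

lemma shifted_square:
  fixes z :: complex and x :: real
  shows "- of_real \<nu> * (of_real x - z / of_real (sqrt 2))\<^sup>2
      = - of_real \<nu> * (of_real x)\<^sup>2 + (of_real (sqrt 2 * \<nu>) * of_real x * z - of_real (\<nu> / 2) * z\<^sup>2)"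
proof -
  have h: "z / of_real (sqrt 2) = of_real (sqrt 2) * z / 2"
    using sqrt2_squared_complex by (simp add: field_simps power2_eq_square)
  have *: "(of_real x - z / of_real (sqrt 2))\<^sup>2 = (of_real x)\<^sup>2 - of_real (sqrt 2) * of_real x * z + z\<^sup>2 / 2"
    unfolding h by (simp add: power2_diff power_mult_distrib power_divide sqrt2_squared_complex)
  show ?thesis unfolding * by (simp add: algebra_simps)
qed

lemma segal_bargmann_eq:
  assumes [measurable]: "f \<in> borel_measurable borel"
  shows "segal_bargmann \<nu> f z = (LINT x|gauss \<nu>. f x * sb_kernel \<nu> z x)"
proof -
  have km [measurable]: "sb_kernel \<nu> z \<in> borel_measurable borel"
    unfolding sb_kernel_def by (intro borel_measurable_continuous_onI continuous_intros)
  have "exp (- complex_of_real \<nu> * (\<Sum>i\<in>UNIV. (complex_of_real (x $ i) - z $ i / complex_of_real (sqrt 2))\<^sup>2))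
    = of_real (exp (- \<nu> * (norm x)\<^sup>2)) * exp (of_real (sqrt 2 * \<nu>) * (\<Sum>i\<in>UNIV. of_real (x $ i) * z $ i) - of_real (\<nu> / 2) * (\<Sum>i\<in>UNIV. (z $ i)\<^sup>2))"
    for x :: "real^'a"
  proof -
    have "- complex_of_real \<nu> * (\<Sum>i\<in>UNIV. (complex_of_real (x $ i) - z $ i / complex_of_real (sqrt 2))\<^sup>2)
      = (\<Sum>i\<in>UNIV. - complex_of_real \<nu> * (of_real (x $ i))\<^sup>2 + (of_real (sqrt 2 * \<nu>) * of_real (x $ i) * z $ i - of_real (\<nu> / 2) * (z $ i)\<^sup>2))"
      unfolding sum_distrib_left shifted_square ..
    also have "\<dots> = of_real (- \<nu> * (norm x)\<^sup>2) + (of_real (sqrt 2 * \<nu>) * (\<Sum>i\<in>UNIV. of_real (x $ i) * z $ i) - of_real (\<nu> / 2) * (\<Sum>i\<in>UNIV. (z $ i)\<^sup>2))"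
      by (simp add: norm_vec_def L2_set_def sum_nonneg sum.distrib sum_subtractf sum_negf sum_distrib_left mult.assoc)
    finally show ?thesis by (simp only: exp_add exp_of_real)
  qed
  thus ?thesis
    unfolding segal_bargmann_def
    by (subst integral_gauss)
       (simp_all add: sb_kernel_def scaleR_conv_of_real mult_ac flip: Bochner_Integration.integral_mult_right_zero)
qed

lemma segal_bargmann1_kernel_eq:
  assumes [measurable]: "f \<in> borel_measurable borel"
  shows "segal_bargmann1 \<nu> f z = (LINT x|gauss \<nu>. f x * sb1_kernel \<nu> z x)"
proof -
  have km [measurable]: "sb1_kernel \<nu> z \<in> borel_measurable borel"
    unfolding sb1_kernel_def by (intro borel_measurable_continuous_onI continuous_intros)
  have "exp (- complex_of_real \<nu> * (complex_of_real x - z / complex_of_real (sqrt 2))\<^sup>2)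
    = of_real (exp (- \<nu> * x\<^sup>2)) * exp (of_real (sqrt 2 * \<nu>) * of_real x * z - of_real (\<nu> / 2) * z\<^sup>2)" for x
    unfolding shifted_square exp_add by (simp add: exp_of_real[symmetric])
  thus ?thesis
    unfolding segal_bargmann1_eq[OF assms]
    by (subst integral_gauss)
       (simp_all add: sb1_kernel_def scaleR_conv_of_real mult_ac flip: Bochner_Integration.integral_mult_right_zero)
qed

lemma norm_exp_le_exp_norm: "norm (exp z) \<le> exp (norm (z::complex))"
  by (simp add: norm_exp_eq_Re complex_Re_le_cmod)

text \<open>The Gaussian integral of the two linear exponentials is exp(\<nu>/2 sum (z_i + cnj
  w_i)^2) up to a constant. The prefactors of the kernels cancel the pure squares and leave the
  mixed term, which is the reproducing kernel.\<close>

lemma coherent_sb: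
  assumes \<nu>: "\<nu> > 0"
  shows "coherent_kernel (gauss \<nu>) (gauss \<nu>) (sb_kernel \<nu> :: complex^'d \<Rightarrow> _) (Cd.K \<nu>)"
proof (rule Cd.coherent_kernelI[OF \<nu>])
  show "continuous_on UNIV (\<lambda>(z, x). sb_kernel \<nu> z x)"
    unfolding sb_kernel_def case_prod_unfold by (intro continuous_intros)
  let ?C = "(\<nu> / pi) powr (3 * real CARD('d) / 4)"
  let ?q = "\<lambda>z :: complex^'d. of_real (\<nu> / 2) * (\<Sum>i\<in>UNIV. (z $ i)\<^sup>2)"
  let ?c = "\<lambda>(z :: complex^'d) b :: real^'d. of_real (sqrt 2 * \<nu>) * (\<Sum>i\<in>UNIV. of_real (b $ i) * z $ i)"
  have cax: "?c z (axis j 1) = of_real (sqrt 2 * \<nu>) * z $ j" for z j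
    by (simp add: axis_def if_distrib[of complex_of_real] if_distrib[of "\<lambda>x. x * _"] cong: if_cong)
  have k: "sb_kernel \<nu> z x = of_real ?C * exp (- ?q z) * exp (\<Sum>b\<in>Basis. ?c z b * of_real (x \<bullet> b))"
    for z :: "complex^'d" and x
  proof -
    have e: "(\<Sum>b\<in>Basis. ?c z b * of_real (x \<bullet> b)) = of_real (sqrt 2 * \<nu>) * (\<Sum>i\<in>UNIV. of_real (x $ i) * z $ i)"
      unfolding sum_Basis_real_vec cax
      by (subst sum_distrib_left) (auto intro!: sum.cong simp: inner_axis)
    show ?thesis unfolding sb_kernel_def e by (simp only: diff_conv_add_uminus exp_add mult_ac)
  qed
  show "sb_kernel \<nu> z \<in> L2 (gauss \<nu>)" for z :: "complex^'d"
  proof (rule exp_bound_L2_gauss[OF \<nu>])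
    show "sb_kernel \<nu> z \<in> borel_measurable borel"
      unfolding sb_kernel_def by (intro borel_measurable_continuous_onI continuous_intros)
    fix x :: "real^'d"
    have "norm (\<Sum>b\<in>Basis. ?c z b * of_real (x \<bullet> b)) \<le> (\<Sum>b\<in>Basis. norm (?c z b) * norm x)"
      by (intro order.trans[OF norm_sum] sum_mono) (auto simp: norm_mult Basis_le_norm intro!: mult_left_mono)
    also have "\<dots> = (\<Sum>b\<in>Basis. norm (?c z b)) * norm x" by (simp only: sum_distrib_right)
    finally have "norm (exp (\<Sum>b\<in>Basis. ?c z b * of_real (x \<bullet> b))) \<le> exp ((\<Sum>b\<in>Basis. norm (?c z b)) * norm x)"
      by (intro order.trans[OF norm_exp_le_exp_norm]) (simp only: exp_le_cancel_iff)
    thus "norm (sb_kernel \<nu> z x) \<le> norm (of_real ?C * exp (- ?q z)) * exp ((\<Sum>b\<in>Basis. norm (?c z b)) * norm x)"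
      unfolding k norm_mult[of _ "exp (sum _ _)"] by (intro mult_left_mono) auto
  qed
  show "(LINT x|gauss \<nu>. sb_kernel \<nu> z x * cnj (sb_kernel \<nu> w x)) = Cd.K \<nu> z w" for z w :: "complex^'d"
  proof -
    have "(LINT x|gauss \<nu>. sb_kernel \<nu> z x * cnj (sb_kernel \<nu> w x))
       = (LINT x|gauss \<nu>. (of_real (?C\<^sup>2) * exp (- ?q z) * cnj (exp (- ?q w))) *
            (exp (\<Sum>b\<in>Basis. ?c z b * of_real (x \<bullet> b)) * cnj (exp (\<Sum>b\<in>Basis. ?c w b * of_real (x \<bullet> b)))))"
      unfolding k by (intro Bochner_Integration.integral_cong refl) (simp add: power2_eq_square mult_ac)
    also have "\<dots> = (of_real (?C\<^sup>2) * exp (- ?q z) * cnj (exp (- ?q w))) *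
        (of_real (sqrt (pi / \<nu>)) ^ CARD('d) * exp ((\<Sum>b\<in>Basis. (?c z b + cnj (?c w b))\<^sup>2) / of_real (4 * \<nu>)))"
      by (simp only: Bochner_Integration.integral_mult_right_zero integral_exp_cnj_gauss[OF \<nu>] DIM_cart DIM_real mult_1_right)
    also have "(\<Sum>b\<in>Basis. (?c z b + cnj (?c w b))\<^sup>2) / of_real (4 * \<nu>)
        = of_real (\<nu> / 2) * (\<Sum>i\<in>UNIV. (z $ i + cnj (w $ i))\<^sup>2)"
    proof -
      have "(?c z (axis i 1) + cnj (?c w (axis i 1)))\<^sup>2 = of_real (2 * \<nu>\<^sup>2) * (z $ i + cnj (w $ i))\<^sup>2" for i
        unfolding cax by (simp add: power_mult_distrib flip: distrib_left of_real_power)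
      thus ?thesis unfolding sum_Basis_real_vec using \<nu>
        by (simp add: sum_distrib_left[symmetric] power2_eq_square)
    qed
    also have "(of_real (?C\<^sup>2) * exp (- ?q z) * cnj (exp (- ?q w))) *
        (of_real (sqrt (pi / \<nu>)) ^ CARD('d) * exp (of_real (\<nu> / 2) * (\<Sum>i\<in>UNIV. (z $ i + cnj (w $ i))\<^sup>2)))
       = of_real (?C\<^sup>2 * sqrt (pi / \<nu>) ^ CARD('d)) * (exp (- ?q z) * exp (cnj (- ?q w)) * exp (of_real (\<nu> / 2) * (\<Sum>i\<in>UNIV. (z $ i + cnj (w $ i))\<^sup>2)))"
      by (simp add: exp_cnj mult_ac)
    also have "exp (- ?q z) * exp (cnj (- ?q w)) * exp (of_real (\<nu> / 2) * (\<Sum>i\<in>UNIV. (z $ i + cnj (w $ i))\<^sup>2))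
       = exp (of_real \<nu> * (\<Sum>i\<in>UNIV. z $ i * cnj (w $ i)))"
      unfolding exp_add[symmetric]
      by (rule arg_cong[of _ _ exp])
         (simp add: sum_distrib_left power2_sum sum.distrib[symmetric] flip: sum_negf,
          intro sum.cong refl, simp add: field_simps)
    finally show ?thesis
      unfolding gaussian_norm_const[OF \<nu>]
      using \<nu> by (simp add: Cd.K_def measure_gauss_UNIV mult.commute)
  qed
qed

text \<open>The same computation over \<open>real\<close> and \<open>complex\<close> themselves,
  where \<open>segal_bargmann1\<close> lives, instead of over vectors of length one.\<close>

lemma coherent_sb1:
  assumes \<nu>: "\<nu> > 0"
  shows "coherent_kernel (gauss \<nu>) (gauss \<nu>) (sb1_kernel \<nu>) (C1.K \<nu>)"
proof (rule C1.coherent_kernelI[OF \<nu>])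
  show "continuous_on UNIV (\<lambda>(z, x). sb1_kernel \<nu> z x)"
    unfolding sb1_kernel_def case_prod_unfold by (intro continuous_intros)
  let ?C = "(\<nu> / pi) powr (3 / 4)"
  let ?q = "\<lambda>z :: complex. of_real (\<nu> / 2) * z\<^sup>2"
  let ?c = "\<lambda>(z :: complex) b :: real. of_real (sqrt 2 * \<nu>) * z"
  have k: "sb1_kernel \<nu> z x = of_real ?C * exp (- ?q z) * exp (\<Sum>b\<in>Basis. ?c z b * of_real (x \<bullet> b))" for z x
  proof -
    have e: "(\<Sum>b\<in>Basis. ?c z b * of_real (x \<bullet> b)) = of_real (sqrt 2 * \<nu>) * of_real x * z" by simp
    show ?thesis unfolding sb1_kernel_def e by (simp only: diff_conv_add_uminus exp_add mult_ac)
  qed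
  show "sb1_kernel \<nu> z \<in> L2 (gauss \<nu>)" for z
  proof (rule exp_bound_L2_gauss[OF \<nu>])
    show "sb1_kernel \<nu> z \<in> borel_measurable borel"
      unfolding sb1_kernel_def by (intro borel_measurable_continuous_onI continuous_intros)
    fix x :: real
    have "norm (exp (\<Sum>b\<in>Basis. ?c z b * of_real (x \<bullet> b))) \<le> exp (norm (?c z 1) * norm x)"
      by (intro order.trans[OF norm_exp_le_exp_norm]) (simp add: norm_mult)
    thus "norm (sb1_kernel \<nu> z x) \<le> norm (of_real ?C * exp (- ?q z)) * exp (norm (?c z 1) * norm x)"
      unfolding k norm_mult[of _ "exp (sum _ _)"] by (intro mult_left_mono) auto
  qed
  show "(LINT x|gauss \<nu>. sb1_kernel \<nu> z x * cnj (sb1_kernel \<nu> w x)) = C1.K \<nu> z w" for z w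
  proof -
    have "(LINT x|gauss \<nu>. sb1_kernel \<nu> z x * cnj (sb1_kernel \<nu> w x))
       = (LINT x|gauss \<nu>. (of_real (?C\<^sup>2) * exp (- ?q z) * cnj (exp (- ?q w))) *
            (exp (\<Sum>b\<in>Basis. ?c z b * of_real (x \<bullet> b)) * cnj (exp (\<Sum>b\<in>Basis. ?c w b * of_real (x \<bullet> b)))))"
      unfolding k by (intro Bochner_Integration.integral_cong refl) (simp add: power2_eq_square mult_ac)
    also have "\<dots> = (of_real (?C\<^sup>2) * exp (- ?q z) * cnj (exp (- ?q w))) *
        (of_real (sqrt (pi / \<nu>)) * exp ((\<Sum>b\<in>(Basis :: real set). (?c z b + cnj (?c w b))\<^sup>2) / of_real (4 * \<nu>)))"
      by (simp only: Bochner_Integration.integral_mult_right_zero integral_exp_cnj_gauss[OF \<nu>] DIM_real power_one_right)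
    also have "(\<Sum>b\<in>(Basis :: real set). (?c z b + cnj (?c w b))\<^sup>2) / of_real (4 * \<nu>) = of_real (\<nu> / 2) * (z + cnj w)\<^sup>2"
    proof -
      have "(?c z 1 + cnj (?c w 1))\<^sup>2 = of_real (2 * \<nu>\<^sup>2) * (z + cnj w)\<^sup>2"
        by (simp add: power_mult_distrib flip: distrib_left of_real_power)
      thus ?thesis using \<nu> by (simp add: power2_eq_square)
    qed
    also have "(of_real (?C\<^sup>2) * exp (- ?q z) * cnj (exp (- ?q w))) *
        (of_real (sqrt (pi / \<nu>)) * exp (of_real (\<nu> / 2) * (z + cnj w)\<^sup>2))
       = of_real (?C\<^sup>2 * sqrt (pi / \<nu>)) * (exp (- ?q z) * exp (cnj (- ?q w)) * exp (of_real (\<nu> / 2) * (z + cnj w)\<^sup>2))"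
      by (simp add: exp_cnj mult_ac)
    also have "exp (- ?q z) * exp (cnj (- ?q w)) * exp (of_real (\<nu> / 2) * (z + cnj w)\<^sup>2) = exp (of_real \<nu> * (z * cnj w))"
      unfolding exp_add[symmetric] by (rule arg_cong[of _ _ exp]) (simp add: power2_sum field_simps)
    also have "?C\<^sup>2 * sqrt (pi / \<nu>) = 1 / sqrt (pi / \<nu>) ^ 2"
      using gaussian_norm_const[OF \<nu>, of 1] by (simp only: of_nat_1 mult_1_right power_one_right)
    finally show ?thesis
      using \<nu> by (simp add: C1.K_def measure_gauss_UNIV mult.commute)
  qed
qed

text \<open>The reproducing kernel as its own coherent kernel: \<open>B\<close> is then the integral
  operator that turns out to be the orthogonal projection.\<close>

lemma coherent_fock1:
  assumes \<nu>: "\<nu> > 0"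
  shows "coherent_kernel (gauss \<nu>) (gauss \<nu>) (C1.K \<nu>) (C1.K \<nu>)"
proof (rule C1.coherent_kernelI[OF \<nu> C1.K_cont])
  have L2: "C1.K \<nu> z \<in> L2 (gauss \<nu>)" for z
    using L2_cnj[OF C1.K_L2[OF \<nu>, of z]] by (simp add: C1.cnj_K)
  thus "C1.K \<nu> z \<in> L2 (gauss \<nu>)" for z .
  show "(LINT x|gauss \<nu>. C1.K \<nu> z x * cnj (C1.K \<nu> w x)) = C1.K \<nu> z w" for z w
    using C1.L2_reproducing[OF C1.line_entire_K C1.K_L2[OF \<nu>] \<nu>, of w z]
    by (simp add: C1.cnj_K mult.commute)
qed

text \<open>A pointwise limit, wherever it exists, must be the L2 limit, by way of an almost
  everywhere convergent subsequence. With y quantified inside, the exceptional null set does not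
  depend on where the pointwise limit is known to exist.\<close>

lemma (in coherent_kernel) T_limit_AE:
  assumes F: "F \<in> L2 N" and f: "f \<in> L2 M"
    and lim: "\<And>r. nsq M (\<lambda>x. T (trunc r F) x - f x) \<le> 2 * nsq N (\<lambda>z. F z - trunc r F z)"
  shows "AE x in M. \<forall>y. (\<lambda>n. T (trunc (real n) F) x) \<longlonglongrightarrow> y \<longrightarrow> f x = y"
proof -
  have "(\<lambda>n. 2 * nsq N (\<lambda>z. F z - trunc (real n) F z)) \<longlonglongrightarrow> 2 * 0"
    by (intro tendsto_intros filterlim_compose[OF nsq_trunc_tail_tendsto_0[OF sets_N F] filterlim_real_sequentially])
  hence *: "(\<lambda>n. 2 * nsq N (\<lambda>z. F z - trunc (real n) F z)) \<longlonglongrightarrow> 0" by simp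
  have "(\<lambda>n. nsq M (\<lambda>x. T (trunc (real n) F) x - f x)) \<longlonglongrightarrow> 0"
    by (rule tendsto_sandwich[OF _ _ tendsto_const *]) (use lim in auto)
  from L2_limit_AE_subseq[OF T_L2[OF trunc_L2_compact[OF sets_N F]] f this]
  obtain r :: "nat \<Rightarrow> nat" where r: "strict_mono r"
    "AE x in M. (\<lambda>n. T (trunc (real (r n)) F) x) \<longlonglongrightarrow> f x" by blast
  from r(2) show ?thesis
  proof eventually_elim
    case (elim x)
    show ?case
    proof (intro allI impI)
      fix y assume "(\<lambda>n. T (trunc (real n) F) x) \<longlonglongrightarrow> y"
      from LIMSEQ_subseq_LIMSEQ[OF this r(1)]
      have "(\<lambda>n. T (trunc (real (r n)) F) x) \<longlonglongrightarrow> y" by (simp add: o_def)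
      with elim show "f x = y" by (rule LIMSEQ_unique)
    qed
  qed
qed

section \<open>Fock functions as functions entire on lines\<close>

lemma line_entire_holomorphic:
  assumes "\<phi> holomorphic_on UNIV"
  shows "C1.line_entire \<phi>"
  unfolding C1.line_entire_def
proof (intro conjI allI)
  show "continuous_on UNIV \<phi>" by (rule holomorphic_on_imp_continuous_on[OF assms])
  fix z v :: complex
  have "(\<lambda>u. z + u * v) holomorphic_on UNIV" by (intro holomorphic_intros)
  from holomorphic_on_compose_gen[OF this assms]
  show "(\<lambda>u. \<phi> (z + u * v)) holomorphic_on UNIV" by (simp add: o_def)
qed

lemma line_entire_entire_vec:
  assumes "entire_vec F"
  shows "Cd.line_entire F"
  unfolding Cd.line_entire_def
proof (intro conjI allI)
  show "continuous_on UNIV F"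
    using assms unfolding entire_vec_def continuous_on_eq_continuous_at[OF open_UNIV]
    by (blast intro: has_derivative_continuous)
  show "(\<lambda>u. F (z + u *s v)) holomorphic_on UNIV" for z v
    unfolding holomorphic_on_open[OF open_UNIV]
  proof
    fix u :: complex
    obtain L where L: "(F has_derivative L) (at (z + u *s v))" "\<And>c v. L (c *s v) = c * L v"
      using assms unfolding entire_vec_def by blast
    have "bounded_linear (\<lambda>u. u *s v)"
      by (intro linear_conv_bounded_linear[THEN iffD1] linearI) (auto simp: vec_eq_iff algebra_simps)
    hence "((\<lambda>u. z + u *s v) has_derivative (\<lambda>u. u *s v)) (at u)"
      by (auto intro!: derivative_eq_intros bounded_linear_imp_has_derivative)
    \<comment> \<open>Complex linearity of L makes the real derivative along the line multiplication
      by the complex number L v.\<close>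
    from has_derivative_compose[OF this L(1)]
    have "((\<lambda>u. F (z + u *s v)) has_derivative (\<lambda>u. L v * u)) (at u)"
      by (simp add: L(2) mult.commute)
    thus "\<exists>f'. ((\<lambda>u. F (z + u *s v)) has_field_derivative f') (at u)"
      by (auto simp: has_field_derivative_def)
  qed
qed

lemma fock1_iff: "\<phi> \<in> fock1 \<nu> \<longleftrightarrow> \<phi> holomorphic_on UNIV \<and> \<phi> \<in> L2 (gauss \<nu>)"
  by (simp add: fock1_def L2w_eq_L2)

lemma fock_iff: "F \<in> fock \<nu> \<longleftrightarrow> entire_vec F \<and> F \<in> L2 (gauss \<nu>)"
  by (simp add: fock_def L2w_eq_L2)

lemma L2_gauss_measurable: "f \<in> L2 (gauss \<nu>) \<Longrightarrow> f \<in> borel_measurable borel"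
  using L2_measurable by fastforce

lemma fock1_reproducing:
  assumes "\<nu> > 0" "\<phi> \<in> fock1 \<nu>"
  shows "(LINT w|gauss \<nu>. \<phi> w * C1.K \<nu> z w) = \<phi> z"
  using assms by (intro C1.L2_reproducing line_entire_holomorphic) (auto simp: fock1_iff)

lemma holomorphic_integral_exp_gauss:
  fixes a :: "'x::euclidean_space \<Rightarrow> complex"
  assumes \<nu>: "\<nu> > 0" and f: "f \<in> L2 (gauss \<nu>)"
    and a: "a \<in> borel_measurable borel" "\<And>x. norm (a x) \<le> C * norm x"
  shows "(\<lambda>z. LINT x|gauss \<nu>. f x * exp (z * a x)) holomorphic_on UNIV"
proof (rule holomorphic_integral_exp)
  show "f \<in> borel_measurable (gauss \<nu>)" using f by (rule L2_measurable)
  show "a \<in> borel_measurable (gauss \<nu>)" using a by simp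
  fix R
  show "integrable (gauss \<nu>) (\<lambda>x. norm (f x) * exp (R * norm (a x)))"
  proof (rule Bochner_Integration.integrable_bound)
    show "integrable (gauss \<nu>) (\<lambda>x. norm (f x) * norm (complex_of_real (exp (\<bar>R\<bar> * C * norm x))))"
      by (rule L2_integrable_norm_mult[OF f exp_norm_L2_gauss[OF \<nu>]])
    have "R * norm (a x) \<le> \<bar>R\<bar> * C * norm x" for x
      using mult_mono[OF abs_ge_self a(2), of R x] by (simp add: mult.assoc)
    thus "AE x in gauss \<nu>. norm (norm (f x) * exp (R * norm (a x)))
        \<le> norm (norm (f x) * norm (complex_of_real (exp (\<bar>R\<bar> * C * norm x))))"
      by (intro AE_I2) (simp add: mult_left_mono)
    have [measurable]: "f \<in> borel_measurable borel" using f by (rule L2_gauss_measurable)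
    note a(1)[measurable]
    show "(\<lambda>x. norm (f x) * exp (R * norm (a x))) \<in> borel_measurable (gauss \<nu>)" by simp
  qed
qed

section \<open>Range, injectivity and surjectivity of the transforms\<close>

lemma segal_bargmann1_fock1:
  assumes \<nu>: "\<nu> > 0" and f: "f \<in> L2 (gauss \<nu>)"
  shows "segal_bargmann1 \<nu> f \<in> fock1 \<nu>"
proof -
  interpret S: coherent_kernel "gauss \<nu>" "gauss \<nu>" "sb1_kernel \<nu>" "C1.K \<nu>" by (rule coherent_sb1[OF \<nu>])
  have fm: "f \<in> borel_measurable borel" using f by (rule L2_gauss_measurable)
  have eq: "segal_bargmann1 \<nu> f = S.B f"
    by (simp add: fun_eq_iff segal_bargmann1_kernel_eq[OF fm] S.B_def)
  \<comment> \<open>Pulling exp(-\<nu> z^2 / 2) out of the integral leaves an exponent linear in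
    z.\<close>
  have "(\<lambda>z. of_real ((\<nu> / pi) powr (3 / 4)) * exp (- of_real (\<nu> / 2) * z\<^sup>2) *
      (LINT x|gauss \<nu>. f x * exp (z * (of_real (sqrt 2 * \<nu>) * of_real x)))) holomorphic_on UNIV"
  proof (intro holomorphic_intros holomorphic_integral_exp_gauss[OF \<nu> f])
    show "norm (complex_of_real (sqrt 2 * \<nu>) * complex_of_real x) \<le> \<bar>sqrt 2 * \<nu>\<bar> * norm x" for x
      unfolding norm_mult norm_of_real by simp
  qed measurable
  moreover have "segal_bargmann1 \<nu> f z = of_real ((\<nu> / pi) powr (3 / 4)) * exp (- of_real (\<nu> / 2) * z\<^sup>2) *
      (LINT x|gauss \<nu>. f x * exp (z * (of_real (sqrt 2 * \<nu>) * of_real x)))" for z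
    unfolding segal_bargmann1_kernel_eq[OF fm] Bochner_Integration.integral_mult_right_zero[symmetric]
    by (intro Bochner_Integration.integral_cong refl)
       (simp add: sb1_kernel_def diff_conv_add_uminus exp_add mult_ac del: add_uminus_conv_diff)
  ultimately have "segal_bargmann1 \<nu> f holomorphic_on UNIV" by presburger
  thus ?thesis using S.B_L2[OF f] eq by (simp add: fock1_iff)
qed

lemma segal_bargmann1_cmult:
  assumes "f \<in> L2 (gauss \<nu>)"
  shows "segal_bargmann1 \<nu> (\<lambda>x. c * f x) z = c * segal_bargmann1 \<nu> f z"
  using L2_gauss_measurable[OF assms] by (simp add: segal_bargmann1_kernel_eq mult.assoc)

text \<open>On the imaginary axis the kernel is a nonzero constant times a character, so there the
  transform is the Fourier transform of the difference times the Gaussian weight.\<close>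

lemma segal_bargmann1_inj:
  assumes \<nu>: "\<nu> > 0" and f: "f \<in> L2 (gauss \<nu>)" "g \<in> L2 (gauss \<nu>)"
    and eq: "segal_bargmann1 \<nu> f = segal_bargmann1 \<nu> g"
  shows "AE x in lborel. f x = g x"
proof -
  interpret S: coherent_kernel "gauss \<nu>" "gauss \<nu>" "sb1_kernel \<nu>" "C1.K \<nu>" by (rule coherent_sb1[OF \<nu>])
  define h where "h x = f x - g x" for x
  have h: "h \<in> L2 (gauss \<nu>)" unfolding h_def by (rule L2_diff[OF f])
  have [measurable]: "h \<in> borel_measurable borel" using h by (rule L2_gauss_measurable)
  have zero: "(LINT x|gauss \<nu>. h x * sb1_kernel \<nu> z x) = 0" for z
  proof -
    have "(LINT x|gauss \<nu>. h x * sb1_kernel \<nu> z x) = segal_bargmann1 \<nu> f z - segal_bargmann1 \<nu> g z"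
      using f S.k_L2[of z]
      by (simp add: h_def left_diff_distrib segal_bargmann1_kernel_eq L2_gauss_measurable L2_integrable_mult)
    thus ?thesis by (simp add: eq)
  qed
  have "AE x in lborel. exp (- \<nu> * (norm x)\<^sup>2) *\<^sub>R h x = 0"
  proof (rule fourier_inj)
    show "integrable lborel (\<lambda>x. exp (- \<nu> * (norm x)\<^sup>2) *\<^sub>R h x)"
      using S.M.L2_imp_integrable[OF h] by (subst (asm) integrable_gauss_iff) simp_all
    fix t :: real
    \<comment> \<open>Chosen so that the linear exponent \<open>sqrt 2 * \<nu> * x * z\<close>
      equals i t x.\<close>
    define z where "z = \<i> * of_real (t / (sqrt 2 * \<nu>))"
    define D where "D = of_real ((\<nu> / pi) powr (3 / 4)) * exp (- of_real (\<nu> / 2) * z\<^sup>2)"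
    have D: "D \<noteq> 0" using \<nu> by (simp add: D_def)
    have e: "of_real (sqrt 2 * \<nu>) * of_real x * z = \<i> * complex_of_real (t * x)" for x
    proof -
      have "of_real (sqrt 2 * \<nu>) * of_real x * z = \<i> * complex_of_real (sqrt 2 * \<nu> * x * (t / (sqrt 2 * \<nu>)))"
        by (simp add: z_def)
      also have "sqrt 2 * \<nu> * x * (t / (sqrt 2 * \<nu>)) = t * x" using \<nu> by simp
      finally show ?thesis .
    qed
    have k: "sb1_kernel \<nu> z x = D * iexp (t * x)" for x
      unfolding sb1_kernel_def D_def e diff_conv_add_uminus exp_add by simp
    have "0 = (LINT x|gauss \<nu>. D * (h x * iexp (t * x)))"
      using zero[of z] by (simp add: k mult.left_commute)
    hence "(LINT x|gauss \<nu>. h x * iexp (t * x)) = 0" using D by simp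
    thus "(LINT x|lborel. exp (- \<nu> * (norm x)\<^sup>2) *\<^sub>R h x * iexp (t * x)) = 0"
      by (subst (asm) integral_gauss) (auto simp del: of_real_mult)
  qed
  thus ?thesis by eventually_elim (simp add: h_def)
qed

text \<open>The preimage is the limit of the truncated adjoint, since \<open>B\<close> maps that
  limit to the reproducing integral of \<phi>. The rate in the last property feeds the explicit
  formula.\<close>

lemma segal_bargmann1_surj:
  assumes \<nu>: "\<nu> > 0" and \<phi>: "\<phi> \<in> fock1 \<nu>"
  obtains f where "f \<in> L2 (gauss \<nu>)" "segal_bargmann1 \<nu> f = \<phi>"
    and "\<And>r. nsq (gauss \<nu>) (\<lambda>x. coherent_kernel.T (gauss \<nu>) (sb1_kernel \<nu>) (trunc r \<phi>) x - f x)
               \<le> 2 * nsq (gauss \<nu>) (\<lambda>z. \<phi> z - trunc r \<phi> z)"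
proof -
  interpret S: coherent_kernel "gauss \<nu>" "gauss \<nu>" "sb1_kernel \<nu>" "C1.K \<nu>" by (rule coherent_sb1[OF \<nu>])
  have "\<phi> \<in> L2 (gauss \<nu>)" using \<phi> by (simp add: fock1_iff)
  then obtain f where f: "f \<in> L2 (gauss \<nu>)"
    "\<And>r. nsq (gauss \<nu>) (\<lambda>x. S.T (trunc r \<phi>) x - f x) \<le> 2 * nsq (gauss \<nu>) (\<lambda>z. \<phi> z - trunc r \<phi> z)"
    "\<And>z. S.B f z = (LINT w|gauss \<nu>. \<phi> w * C1.K \<nu> z w)"
    by (rule S.T_limit) (rule that)
  have "segal_bargmann1 \<nu> f = \<phi>"
    using f(3) segal_bargmann1_kernel_eq[OF L2_gauss_measurable[OF f(1)]]
    by (simp add: fun_eq_iff S.B_def fock1_reproducing[OF \<nu> \<phi>])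
  with f that show ?thesis by blast
qed

lemma segal_bargmann_surj:
  assumes \<nu>: "\<nu> > 0" and F: "F \<in> fock \<nu>"
  obtains g where "g \<in> L2 (gauss \<nu>)" "segal_bargmann \<nu> g = F"
proof -
  interpret S: coherent_kernel "gauss \<nu>" "gauss \<nu>" "sb_kernel \<nu> :: complex^'a \<Rightarrow> _" "Cd.K \<nu>" by (rule coherent_sb[OF \<nu>])
  have F': "F \<in> L2 (gauss \<nu>)" "Cd.line_entire F" using F by (auto simp: fock_iff line_entire_entire_vec)
  obtain g where g: "g \<in> L2 (gauss \<nu>)" "\<And>z. S.B g z = (LINT w|gauss \<nu>. F w * Cd.K \<nu> z w)"
    by (rule S.T_limit[OF F'(1)]) (rule that)
  have "segal_bargmann \<nu> g = F"
    using g(2) segal_bargmann_eq[OF L2_gauss_measurable[OF g(1)]]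
    by (simp add: fun_eq_iff S.B_def Cd.L2_reproducing[OF F'(2,1) \<nu>])
  with g that show ?thesis by blast
qed

text \<open>Orthogonality says that the adjoint of \<open>B\<close> fixes every Fock function h;
  then testing g or its image against h gives the same value. For uniqueness, the difference of two
  candidates is a Fock function orthogonal to itself.\<close>

lemma fock_proj_eq:
  assumes \<nu>: "\<nu> > 0" and g: "g \<in> L2 (gauss \<nu>)"
  shows "fock_proj \<nu> g = (\<lambda>z. LINT w|gauss \<nu>. g w * C1.K \<nu> z w)"
    and "fock_proj \<nu> g \<in> fock1 \<nu>"
proof -
  interpret S: coherent_kernel "gauss \<nu>" "gauss \<nu>" "C1.K \<nu>" "C1.K \<nu>" by (rule coherent_fock1[OF \<nu>])
  have gm [measurable]: "g \<in> borel_measurable borel" using g by (rule L2_gauss_measurable)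
  have hol: "S.B g holomorphic_on UNIV"
  proof -
    have "(\<lambda>z. (LINT w|gauss \<nu>. g w * exp (z * (of_real \<nu> * cnj w))) / of_real (measure (gauss \<nu>) (UNIV :: complex set))) holomorphic_on UNIV"
    proof (intro holomorphic_on_divide[where f = "\<lambda>z. LINT w|gauss \<nu>. g w * exp (z * (of_real \<nu> * cnj w))"] holomorphic_integral_exp_gauss[OF \<nu> g] holomorphic_intros)
      show "norm (of_real \<nu> * cnj w) \<le> \<nu> * norm w" for w using \<nu> by (simp add: norm_mult)
      show "(\<lambda>w. complex_of_real \<nu> * cnj w) \<in> borel_measurable borel"
        by (intro borel_measurable_continuous_onI continuous_intros)
    qed (use \<nu> in \<open>simp add: measure_gauss_UNIV\<close>)
    moreover have "S.B g z = (LINT w|gauss \<nu>. g w * exp (z * (of_real \<nu> * cnj w))) / of_real (measure (gauss \<nu>) (UNIV :: complex set))" for z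
      unfolding S.B_def C1.K_def by (simp add: mult_ac)
    ultimately show ?thesis by presburger
  qed
  have Bg: "S.B g \<in> fock1 \<nu>" using hol S.B_L2[OF g] by (simp add: fock1_iff)
  have orth: "inner_w \<nu> (\<lambda>z. g z - S.B g z) h = 0" if h: "h \<in> fock1 \<nu>" for h
  proof -
    have h2: "h \<in> L2 (gauss \<nu>)" using h by (simp add: fock1_iff)
    obtain f where f: "f \<in> L2 (gauss \<nu>)"
      "\<And>r. nsq (gauss \<nu>) (\<lambda>x. S.T (trunc r h) x - f x) \<le> 2 * nsq (gauss \<nu>) (\<lambda>z. h z - trunc r h z)"
      "\<And>g. g \<in> L2 (gauss \<nu>) \<Longrightarrow> (LINT x|gauss \<nu>. f x * cnj (g x)) = (LINT z|gauss \<nu>. h z * cnj (S.B g z))"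
      by (rule S.T_limit[OF h2]) (rule that)
    \<comment> \<open>The truncated adjoint converges pointwise to the reproducing integral of h,
      which identifies its L2 limit f with h almost everywhere.\<close>
    have "(\<lambda>n. S.T (trunc (real n) h) x) \<longlonglongrightarrow> h x" for x
    proof -
      have "(\<lambda>n. LINT z|gauss \<nu>. trunc (real n) h z * C1.K \<nu> x z) \<longlonglongrightarrow> (LINT z|gauss \<nu>. h z * C1.K \<nu> x z)"
      proof (rule L2_mult_limit[OF trunc_L2[OF S.sets_N h2] h2 S.k_L2])
        have "(\<lambda>n. nsq (gauss \<nu>) (\<lambda>z. h z - trunc (real n) h z)) \<longlonglongrightarrow> 0"
          by (rule filterlim_compose[OF nsq_trunc_tail_tendsto_0[OF S.sets_N h2] filterlim_real_sequentially])
        thus "(\<lambda>n. nsq (gauss \<nu>) (\<lambda>z. trunc (real n) h z - h z)) \<longlonglongrightarrow> 0"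
          by (simp add: nsq_def norm_minus_commute)
      qed
      thus ?thesis by (simp add: S.T_def C1.cnj_K fock1_reproducing[OF \<nu> h])
    qed
    hence fh: "AE x in gauss \<nu>. f x = h x"
      using S.T_limit_AE[OF h2 f(1,2)] by (auto elim: eventually_mono)
    have m [measurable]: "f \<in> borel_measurable borel" "h \<in> borel_measurable borel" "S.B g \<in> borel_measurable borel"
      using f(1) h2 S.B_L2[OF g] by (auto dest: L2_gauss_measurable)
    have cm: "(\<lambda>x. cnj (g x)) \<in> borel_measurable borel" using measurable_compose[OF gm borel_measurable_cnj] .
    have "(LINT x|gauss \<nu>. h x * cnj (g x)) = (LINT x|gauss \<nu>. f x * cnj (g x))"
      using fh m cm by (intro integral_cong_AE) auto
    also have "\<dots> = (LINT z|gauss \<nu>. h z * cnj (S.B g z))" by (rule f(3)[OF g])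
    finally have "(LINT z|gauss \<nu>. h z * cnj (g z - S.B g z)) = 0"
      using L2_integrable_mult[OF h2 L2_cnj[OF g]] L2_integrable_mult[OF h2 L2_cnj[OF S.B_L2[OF g]]]
      by (simp add: right_diff_distrib)
    hence "cnj (LINT z|gauss \<nu>. (g z - S.B g z) * cnj (h z)) = 0"
      by (simp add: mult.commute flip: Bochner_Integration.integral_cnj)
    thus ?thesis using gm m by (subst inner_w_eq) auto
  qed
  have "fock_proj \<nu> g = S.B g"
    unfolding fock_proj_def
  proof (rule the_equality)
    fix \<phi> assume \<phi>: "\<phi> \<in> fock1 \<nu> \<and> (\<forall>h\<in>fock1 \<nu>. inner_w \<nu> (\<lambda>z. g z - \<phi> z) h = 0)"
    define d where "d z = S.B g z - \<phi> z" for z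
    have d: "d \<in> fock1 \<nu>"
      using Bg \<phi> unfolding fock1_iff d_def by (auto intro: holomorphic_intros L2_diff)
    have L: "\<phi> \<in> L2 (gauss \<nu>)" "d \<in> L2 (gauss \<nu>)" "S.B g \<in> L2 (gauss \<nu>)" using \<phi> d Bg by (auto simp: fock1_iff)
    note ip = inner_w_eq[OF L2_gauss_measurable L2_gauss_measurable]
    have "0 = inner_w \<nu> (\<lambda>z. g z - \<phi> z) d - inner_w \<nu> (\<lambda>z. g z - S.B g z) d"
      using \<phi> d orth by simp
    also have "\<dots> = (LINT z|gauss \<nu>. (g z - \<phi> z) * cnj (d z) - (g z - S.B g z) * cnj (d z))"
      using L2_integrable_mult[OF L2_diff[OF g L(1)] L2_cnj[OF L(2)]] L2_integrable_mult[OF L2_diff[OF g L(3)] L2_cnj[OF L(2)]]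
      by (simp add: ip[OF L2_diff[OF g L(1)] L(2)] ip[OF L2_diff[OF g L(3)] L(2)])
    also have "\<dots> = of_real (nsq (gauss \<nu>) d)"
      unfolding of_real_nsq by (intro Bochner_Integration.integral_cong refl) (simp add: d_def algebra_simps)
    finally have "nsq (gauss \<nu>) d = 0" by simp
    from nsq_eq_0_imp_AE[OF L(2) this] have ae: "AE z in gauss \<nu>. d z = 0" .
    \<comment> \<open>The reproducing formula recovers every value of d from its class, so vanishing
      almost everywhere becomes vanishing everywhere.\<close>
    have "d z = 0" for z
    proof -
      have "d z = (LINT w|gauss \<nu>. d w * C1.K \<nu> z w)" by (rule fock1_reproducing[OF \<nu> d, symmetric])
      also have "\<dots> = 0" using ae by (intro integral_eq_zero_AE) (auto elim: eventually_mono)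
      finally show ?thesis .
    qed
    thus "\<phi> = S.B g" by (simp add: fun_eq_iff d_def)
  qed (use Bg orth in blast)
  thus "fock_proj \<nu> g = (\<lambda>z. LINT w|gauss \<nu>. g w * C1.K \<nu> z w)" "fock_proj \<nu> g \<in> fock1 \<nu>"
    using Bg by (auto simp: S.B_def[abs_def])
qed

section \<open>The transforms G and R\<close>

lemma gauss_isometry:
  fixes U :: "'b::euclidean_space \<Rightarrow> 'a::euclidean_space"
  assumes U: "linear U" "surj U" "\<And>x. norm (U x) = norm x"
  shows integral_gauss_isometry: "f \<in> borel_measurable borel \<Longrightarrow>
      (LINT x|gauss \<nu>. f (U x)) = (LINT x|gauss \<nu>. f x :: 'c::{banach, second_countable_topology})"
    and L2_gauss_isometry: "h \<in> L2 (gauss \<nu>) \<Longrightarrow> (\<lambda>x. h (U x)) \<in> L2 (gauss \<nu>)"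
proof -
  have Ub: "U \<in> borel_measurable borel"
    using U(1) by (intro borel_measurable_continuous_onI linear_continuous_on linear_conv_bounded_linear[THEN iffD1])
  hence Um: "U \<in> gauss \<nu> \<rightarrow>\<^sub>M borel" by simp
  note d = distr_gauss_isometry[OF U, of \<nu>]
  show "(LINT x|gauss \<nu>. f (U x)) = (LINT x|gauss \<nu>. f x)" if "f \<in> borel_measurable borel"
    using integral_distr[OF Um that] by (simp add: d)
  show "(\<lambda>x. h (U x)) \<in> L2 (gauss \<nu>)" if h: "h \<in> L2 (gauss \<nu>)"
  proof (rule L2I)
    have [measurable]: "h \<in> borel_measurable borel" using h by (rule L2_gauss_measurable)
    note Ub[measurable]
    show "(\<lambda>x. h (U x)) \<in> borel_measurable (gauss \<nu>)" by simp
    show "integrable (gauss \<nu>) (\<lambda>x. (norm (h (U x)))\<^sup>2)"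
      using L2_integrable[OF h] integrable_distr_eq[OF Um, of "\<lambda>x. (norm (h x))\<^sup>2"] by (simp add: d)
  qed
qed

lemma vector_2_isometry:
  defines "U \<equiv> \<lambda>\<zeta>. vector [Re \<zeta>, Im \<zeta>] :: real^2"
  shows "linear U" "surj U" "\<And>\<zeta>. norm (U \<zeta>) = norm \<zeta>"
proof -
  show "linear U" unfolding U_def by (intro linearI) (auto simp: vec_eq_iff forall_2)
  show "surj U"
    by (rule surjI[where f = "\<lambda>x :: real^2. Complex (x $ 1) (x $ 2)"]) (auto simp: U_def vec_eq_iff forall_2)
  show "norm (U \<zeta>) = norm \<zeta>" for \<zeta>
    by (simp add: U_def norm_vec_def L2_set_def sum_2 cmod_def)
qed

lemma Complex_isometry:
  defines "V \<equiv> \<lambda>x :: real^2. Complex (x $ 1) (x $ 2)"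
  shows "linear V" "surj V" "\<And>x. norm (V x) = norm x"
proof -
  show "linear V" unfolding V_def by (intro linearI) (auto simp: complex_eq_iff)
  show "surj V"
    by (rule surjI[where f = "\<lambda>\<zeta>. vector [Re \<zeta>, Im \<zeta>]"]) (auto simp: V_def complex_eq_iff)
  show "norm (V x) = norm x" for x
    by (simp add: V_def norm_vec_def L2_set_def sum_2 cmod_def)
qed

lemma on_complex_L2: "g \<in> L2 (gauss \<nu>) \<Longrightarrow> on_complex g \<in> L2 (gauss \<nu>)"
  unfolding on_complex_def[abs_def] by (rule L2_gauss_isometry[OF vector_2_isometry])

lemma segal_bargmann_on_complex:
  assumes "g \<in> L2 (gauss \<nu>)"
  shows "segal_bargmann \<nu> g p = of_real ((\<nu> / pi) powr (3 / 2)) *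
    (LINT \<zeta>|gauss \<nu>. on_complex g \<zeta> * exp (of_real (sqrt 2 * \<nu>) * (of_real (Re \<zeta>) * p $ 1 + of_real (Im \<zeta>) * p $ 2)
        - of_real (\<nu> / 2) * ((p $ 1)\<^sup>2 + (p $ 2)\<^sup>2)))"
proof -
  have gm [measurable]: "g \<in> borel_measurable borel" using assms by (rule L2_gauss_measurable)
  have km [measurable]: "sb_kernel \<nu> p \<in> borel_measurable borel"
    unfolding sb_kernel_def by (intro borel_measurable_continuous_onI continuous_intros)
  have "segal_bargmann \<nu> g p = (LINT x|gauss \<nu>. g x * sb_kernel \<nu> p x)" by (rule segal_bargmann_eq[OF gm])
  also have "\<dots> = (LINT \<zeta>|gauss \<nu>. on_complex g \<zeta> * sb_kernel \<nu> p (vector [Re \<zeta>, Im \<zeta>]))"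
    unfolding on_complex_def by (rule integral_gauss_isometry[OF vector_2_isometry, symmetric]) measurable
  also have "\<dots> = (LINT \<zeta>|gauss \<nu>. of_real ((\<nu> / pi) powr (3 / 2)) * (on_complex g \<zeta> *
      exp (of_real (sqrt 2 * \<nu>) * (of_real (Re \<zeta>) * p $ 1 + of_real (Im \<zeta>) * p $ 2)
        - of_real (\<nu> / 2) * ((p $ 1)\<^sup>2 + (p $ 2)\<^sup>2))))"
    unfolding sb_kernel_def by (simp add: sum_2 mult_ac)
  finally show ?thesis by simp
qed

lemma pi_div_powr:
  assumes "\<nu> > 0"
  shows "(pi / \<nu>) powr a = (\<nu> / pi) powr (- a)"
proof -
  have "pi / \<nu> = inverse (\<nu> / pi)" by simp
  thus ?thesis using assms by (simp only: powr_minus) (simp add: powr_divide)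
qed

lemma fock_proj_on_complex:
  assumes \<nu>: "\<nu> > 0" and g: "g \<in> L2 (gauss \<nu>)"
  shows "fock_proj \<nu> (on_complex g) = (\<lambda>\<xi>. of_real ((pi / \<nu>) powr (1 / 2)) * C_psi2 (segal_bargmann \<nu> g) \<xi>)"
proof
  fix \<xi>
  let ?s = "complex_of_real (sqrt 2)"
  have e: "of_real (sqrt 2 * \<nu>) * (of_real (Re \<zeta>) * psi2 \<xi> $ 1 + of_real (Im \<zeta>) * psi2 \<xi> $ 2)
        - of_real (\<nu> / 2) * ((psi2 \<xi> $ 1)\<^sup>2 + (psi2 \<xi> $ 2)\<^sup>2) = of_real \<nu> * (\<xi> * cnj \<zeta>)" for \<zeta>
  proof -
    \<comment> \<open>Isotropy removes the quadratic part of the exponent, and the linear part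
      becomes \<nu> times \<xi> times the conjugate of \<zeta>, the exponent of the reproducing
      kernel.\<close>
    have "(psi2 \<xi> $ 1)\<^sup>2 + (psi2 \<xi> $ 2)\<^sup>2 = 0" by (simp add: psi2_def power_mult_distrib power_divide)
    moreover have "of_real (Re \<zeta>) * psi2 \<xi> $ 1 + of_real (Im \<zeta>) * psi2 \<xi> $ 2 = \<xi> / ?s * (of_real (Re \<zeta>) - \<i> * of_real (Im \<zeta>))"
      by (simp add: psi2_def algebra_simps)
    moreover have "of_real (Re \<zeta>) - \<i> * of_real (Im \<zeta>) = cnj \<zeta>" by (simp add: complex_eq_iff)
    ultimately show ?thesis by simp
  qed
  have "C_psi2 (segal_bargmann \<nu> g) \<xi>
     = of_real ((\<nu> / pi) powr (3 / 2)) * (LINT \<zeta>|gauss \<nu>. on_complex g \<zeta> * exp (of_real \<nu> * (\<xi> * cnj \<zeta>)))"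
    unfolding C_psi2_def o_def segal_bargmann_on_complex[OF g] e ..
  \<comment> \<open>The product is the reciprocal of the Gaussian mass pi / \<nu> of the complex
    plane.\<close>
  moreover have "(pi / \<nu>) powr (1 / 2) * (\<nu> / pi) powr (3 / 2) = \<nu> / pi"
    using \<nu> by (simp add: pi_div_powr flip: powr_add)
  hence "complex_of_real ((pi / \<nu>) powr (1 / 2)) * of_real ((\<nu> / pi) powr (3 / 2)) = of_real (\<nu> / pi)"
    by (simp only: of_real_mult[symmetric])
  ultimately have "of_real ((pi / \<nu>) powr (1 / 2)) * C_psi2 (segal_bargmann \<nu> g) \<xi>
     = of_real (\<nu> / pi) * (LINT \<zeta>|gauss \<nu>. on_complex g \<zeta> * exp (of_real \<nu> * (\<xi> * cnj \<zeta>)))"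
    by (simp only: mult.assoc[symmetric])
  also have "\<dots> = (LINT \<zeta>|gauss \<nu>. on_complex g \<zeta> * C1.K \<nu> \<xi> \<zeta>)"
  proof -
    have K: "C1.K \<nu> \<xi> \<zeta> = of_real (\<nu> / pi) * exp (of_real \<nu> * (\<xi> * cnj \<zeta>))" for \<zeta>
      using \<nu> by (simp add: C1.K_def measure_gauss_UNIV)
    show ?thesis
      unfolding K mult.left_commute[of "on_complex g _"] Bochner_Integration.integral_mult_right_zero ..
  qed
  also have "\<dots> = fock_proj \<nu> (on_complex g) \<xi>"
    by (simp add: fock_proj_eq[OF \<nu> on_complex_L2[OF g]])
  finally show "fock_proj \<nu> (on_complex g) \<xi> = of_real ((pi / \<nu>) powr (1 / 2)) * C_psi2 (segal_bargmann \<nu> g) \<xi>" ..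
qed

lemma fock1_cmult: "\<phi> \<in> fock1 \<nu> \<Longrightarrow> (\<lambda>z. c * \<phi> z) \<in> fock1 \<nu>"
  by (auto simp: fock1_iff L2_cmult intro: holomorphic_intros)

text \<open>
  Proj is the adjoint of the inclusion of the Fock space, so the adjoint of R is B1 followed by the
  inclusion and by the two-dimensional transform; this is G.
\<close>

lemma segal_bargmann_of_fock1:
  assumes \<nu>: "\<nu> > 0" and \<phi>: "\<phi> \<in> fock1 \<nu>"
  defines "g \<equiv> \<lambda>x :: real^2. \<phi> (Complex (x $ 1) (x $ 2))"
  shows "g \<in> L2 (gauss \<nu>)"
    and "segal_bargmann \<nu> g p = of_real ((\<nu> / pi) powr (1 / 2)) * \<phi> ((p $ 1 + \<i> * p $ 2) / of_real (sqrt 2))"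
proof -
  have \<phi>2: "\<phi> \<in> L2 (gauss \<nu>)" and hol: "\<phi> holomorphic_on UNIV" using \<phi> by (simp_all add: fock1_iff)
  show g: "g \<in> L2 (gauss \<nu>)" unfolding g_def by (rule L2_gauss_isometry[OF Complex_isometry \<phi>2])
  let ?s = "complex_of_real (sqrt 2)"
  \<comment> \<open>Isotropic coordinates, in which p_1^2 + p_2^2 = 2 \<xi> \<eta>: the exponent
    splits into a constant, a part holomorphic in \<zeta> that depends on \<eta>, and the exponent
    of the kernel at \<xi>.\<close>
  define \<xi> where "\<xi> = (p $ 1 + \<i> * p $ 2) / ?s"
  define \<eta> where "\<eta> = (p $ 1 - \<i> * p $ 2) / ?s"
  have s: "?s * ?s = 2" "?s \<noteq> 0" using sqrt2_squared_complex by (simp_all add: power2_eq_square)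
  have oc: "on_complex g = \<phi>" by (simp add: g_def on_complex_def fun_eq_iff)
  have p: "p $ 1 = ?s * (\<xi> + \<eta>) / 2" "p $ 2 = ?s * (\<xi> - \<eta>) / (2 * \<i>)"
    using s by (simp_all add: \<xi>_def \<eta>_def field_simps)
  have e: "of_real (sqrt 2 * \<nu>) * (of_real (Re \<zeta>) * p $ 1 + of_real (Im \<zeta>) * p $ 2)
        - of_real (\<nu> / 2) * ((p $ 1)\<^sup>2 + (p $ 2)\<^sup>2)
      = - of_real \<nu> * \<xi> * \<eta> + (of_real \<nu> * \<eta> * \<zeta> + of_real \<nu> * (\<xi> * cnj \<zeta>))" for \<zeta>
  proof -
    have 1: "(p $ 1)\<^sup>2 + (p $ 2)\<^sup>2 = 2 * \<xi> * \<eta>"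
      unfolding p using s by (simp add: power_divide power_mult_distrib sqrt2_squared_complex) (simp add: power2_eq_square field_simps)
    have "?s * (of_real (Re \<zeta>) * p $ 1 + of_real (Im \<zeta>) * p $ 2)
        = (?s * ?s) * (of_real (Re \<zeta>) * (\<xi> + \<eta>) - \<i> * of_real (Im \<zeta>) * (\<xi> - \<eta>)) / 2"
      unfolding p by (simp add: field_simps)
    also have "\<dots> = \<eta> * (of_real (Re \<zeta>) + \<i> * of_real (Im \<zeta>)) + \<xi> * (of_real (Re \<zeta>) - \<i> * of_real (Im \<zeta>))"
      unfolding s(1) by (simp add: field_simps)
    also have "of_real (Re \<zeta>) - \<i> * of_real (Im \<zeta>) = cnj \<zeta>" by (simp add: complex_eq_iff)
    also have "of_real (Re \<zeta>) + \<i> * of_real (Im \<zeta>) = \<zeta>" by (simp add: complex_eq_iff)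
    finally have 2: "?s * (of_real (Re \<zeta>) * p $ 1 + of_real (Im \<zeta>) * p $ 2) = \<eta> * \<zeta> + \<xi> * cnj \<zeta>" .
    have "of_real (sqrt 2 * \<nu>) * (of_real (Re \<zeta>) * p $ 1 + of_real (Im \<zeta>) * p $ 2)
        = of_real \<nu> * (?s * (of_real (Re \<zeta>) * p $ 1 + of_real (Im \<zeta>) * p $ 2))" by (simp add: mult_ac)
    thus ?thesis unfolding 1 2 by (simp add: algebra_simps)
  qed
  \<comment> \<open>Reproduction at \<xi> of \<phi> times the holomorphic factor yields exp(\<nu>
    \<eta> \<xi>), which cancels the constant exp(-\<nu> \<xi> \<eta>) and with it all dependence on
    \<eta>.\<close>
  have rep: "(LINT w|gauss \<nu>. (\<phi> w * exp (of_real \<nu> * \<eta> * w)) * C1.K \<nu> \<xi> w) = \<phi> \<xi> * exp (of_real \<nu> * \<eta> * \<xi>)"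
  proof (rule C1.gauss_reproducing[OF _ \<nu>])
    show "C1.line_entire (\<lambda>w. \<phi> w * exp (of_real \<nu> * \<eta> * w))"
      by (intro line_entire_holomorphic holomorphic_intros hol)
    fix R
    have [measurable]: "\<phi> \<in> borel_measurable borel" using \<phi>2 by (rule L2_gauss_measurable)
    show "integrable (gauss \<nu>) (\<lambda>w. exp (R * norm w) * norm (\<phi> w * exp (of_real \<nu> * \<eta> * w)))"
    proof (rule Bochner_Integration.integrable_bound)
      show "integrable (gauss \<nu>) (\<lambda>w. norm (complex_of_real (exp ((R + \<nu> * norm \<eta>) * norm w))) * norm (\<phi> w))"
        by (rule L2_integrable_norm_mult[OF exp_norm_L2_gauss[OF \<nu>] \<phi>2])
      have "norm (exp (of_real \<nu> * \<eta> * w)) \<le> exp (\<nu> * norm \<eta> * norm w)" for w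
        using norm_exp_le_exp_norm[of "of_real \<nu> * \<eta> * w"] \<nu> by (simp add: norm_mult)
      hence "exp (R * norm w) * (norm (\<phi> w) * norm (exp (of_real \<nu> * \<eta> * w)))
          \<le> exp (R * norm w) * (norm (\<phi> w) * exp (\<nu> * norm \<eta> * norm w))" for w
        by (intro mult_left_mono) auto
      moreover have e: "exp ((R + \<nu> * norm \<eta>) * norm w) = exp (R * norm w) * exp (\<nu> * norm \<eta> * norm w)" for w
        by (simp add: distrib_right exp_add)
      ultimately show "AE w in gauss \<nu>. norm (exp (R * norm w) * norm (\<phi> w * exp (of_real \<nu> * \<eta> * w)))
          \<le> norm (norm (complex_of_real (exp ((R + \<nu> * norm \<eta>) * norm w))) * norm (\<phi> w))"
        unfolding e by (intro AE_I2) (simp add: norm_mult mult_ac)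
    qed simp
  qed
  have "(LINT \<zeta>|gauss \<nu>. \<phi> \<zeta> * exp (- of_real \<nu> * \<xi> * \<eta> + (of_real \<nu> * \<eta> * \<zeta> + of_real \<nu> * (\<xi> * cnj \<zeta>))))
      = (LINT \<zeta>|gauss \<nu>. (exp (- of_real \<nu> * \<xi> * \<eta>) * of_real (pi / \<nu>)) * ((\<phi> \<zeta> * exp (of_real \<nu> * \<eta> * \<zeta>)) * C1.K \<nu> \<xi> \<zeta>))"
    unfolding exp_add using \<nu> by (intro Bochner_Integration.integral_cong refl)
      (simp add: C1.K_def measure_gauss_UNIV mult_ac)
  also have "\<dots> = (exp (- of_real \<nu> * \<xi> * \<eta>) * of_real (pi / \<nu>)) * (\<phi> \<xi> * exp (of_real \<nu> * \<eta> * \<xi>))"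
    unfolding Bochner_Integration.integral_mult_right_zero rep ..
  also have "\<dots> = of_real (pi / \<nu>) * \<phi> \<xi>"
    by (simp add: exp_minus mult_ac)
  finally have "segal_bargmann \<nu> g p = of_real ((\<nu> / pi) powr (3 / 2)) * (of_real (pi / \<nu>) * \<phi> \<xi>)"
    unfolding segal_bargmann_on_complex[OF g] oc e by simp
  also have "(\<nu> / pi) powr (3 / 2) * (pi / \<nu>) = (\<nu> / pi) powr (1 / 2)"
  proof -
    have "(\<nu> / pi) powr (3 / 2) = (\<nu> / pi) powr (1 / 2) * (\<nu> / pi)"
      using \<nu> powr_add[of "\<nu> / pi" "1/2" 1] by simp
    thus ?thesis using \<nu> by simp
  qed
  hence "of_real ((\<nu> / pi) powr (3 / 2)) * (of_real (pi / \<nu>) * \<phi> \<xi>) = of_real ((\<nu> / pi) powr (1 / 2)) * \<phi> \<xi>"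
    by (simp only: mult.assoc[symmetric] of_real_mult[symmetric])
  finally show "segal_bargmann \<nu> g p = of_real ((\<nu> / pi) powr (1 / 2)) * \<phi> ((p $ 1 + \<i> * p $ 2) / of_real (sqrt 2))"
    by (simp add: \<xi>_def)
qed

text \<open>Square integrability comes for free once G f is recognised as the two-dimensional
  transform of an L2 function; complex differentiability is the chain rule.\<close>

lemma G_transform_fock:
  assumes \<nu>: "\<nu> > 0" and f: "f \<in> L2 (gauss \<nu>)"
  shows "G_transform \<nu> f \<in> fock \<nu>"
proof -
  interpret S: coherent_kernel "gauss \<nu>" "gauss \<nu>" "sb_kernel \<nu> :: complex^2 \<Rightarrow> _" "Cd.K \<nu>" by (rule coherent_sb[OF \<nu>])
  define \<phi> where "\<phi> = segal_bargmann1 \<nu> f"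
  have \<phi>: "\<phi> \<in> fock1 \<nu>" unfolding \<phi>_def by (rule segal_bargmann1_fock1[OF \<nu> f])
  define g where "g = (\<lambda>x :: real^2. \<phi> (Complex (x $ 1) (x $ 2)))"
  have g: "g \<in> L2 (gauss \<nu>)" unfolding g_def by (rule segal_bargmann_of_fock1(1)[OF \<nu> \<phi>])
  have "G_transform \<nu> f = segal_bargmann \<nu> g"
    unfolding g_def fun_eq_iff segal_bargmann_of_fock1(2)[OF \<nu> \<phi>] by (simp add: G_transform_def \<phi>_def)
  also have "\<dots> = S.B g"
    by (simp add: fun_eq_iff segal_bargmann_eq[OF L2_gauss_measurable[OF g]] S.B_def)
  finally have "G_transform \<nu> f \<in> L2 (gauss \<nu>)" using S.B_L2[OF g] by simp
  moreover have "entire_vec (G_transform \<nu> f)"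
    unfolding entire_vec_def
  proof
    fix p :: "complex^2"
    let ?l = "\<lambda>p :: complex^2. (p $ 1 + \<i> * p $ 2) / complex_of_real (sqrt 2)"
    let ?c = "complex_of_real ((\<nu> / pi) powr (1 / 2))"
    have "\<phi> field_differentiable at (?l p)"
      using \<phi> by (simp add: fock1_iff holomorphic_on_def)
    then obtain D where "(\<phi> has_field_derivative D) (at (?l p))" by (auto simp: field_differentiable_def)
    hence D: "(\<phi> has_derivative (\<lambda>h. D * h)) (at (?l p))" by (simp add: has_field_derivative_def)
    have "bounded_linear ?l"
      by (intro linear_conv_bounded_linear[THEN iffD1] linearI) (auto simp: add_divide_distrib scaleR_add_right distrib_left scaleR_conv_of_real[where 'a = complex] algebra_simps)
    hence "(?l has_derivative ?l) (at p)" by (rule bounded_linear_imp_has_derivative)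
    from has_derivative_compose[OF this D]
    have "((\<lambda>p. ?c * \<phi> (?l p)) has_derivative (\<lambda>v. ?c * (D * ?l v))) (at p)"
      by (rule has_derivative_mult_right)
    moreover have "?c * (D * ?l (c *s v)) = c * (?c * (D * ?l v))" for c v
      by (simp add: algebra_simps)
    ultimately show "\<exists>L. (G_transform \<nu> f has_derivative L) (at p) \<and> (\<forall>c v. L (c *s v) = c * L v)"
      unfolding G_transform_def[abs_def] \<phi>_def by blast
  qed
  ultimately show ?thesis by (simp add: fock_iff)
qed

lemma C_psi2_G_transform:
  "C_psi2 (G_transform \<nu> f) \<xi> = of_real ((\<nu> / pi) powr (1 / 2)) * segal_bargmann1 \<nu> f \<xi>"
proof -
  have "(psi2 \<xi> $ 1 + \<i> * psi2 \<xi> $ 2) / complex_of_real (sqrt 2) = 2 * \<xi> / (complex_of_real (sqrt 2))\<^sup>2"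
    by (simp add: psi2_def power2_eq_square add_divide_distrib)
  also have "\<dots> = \<xi>" unfolding sqrt2_squared_complex by simp
  finally show ?thesis by (simp add: C_psi2_def G_transform_def)
qed

text \<open>Restriction to a complex line does not visibly preserve square integrability. Here the
  restriction is a multiple of a projection, hence a Fock function.\<close>

lemma C_psi2_fock1:
  assumes \<nu>: "\<nu> > 0" and F: "F \<in> fock \<nu>"
  shows "C_psi2 F \<in> fock1 \<nu>"
proof -
  obtain g where g: "g \<in> L2 (gauss \<nu>)" "segal_bargmann \<nu> g = F" using segal_bargmann_surj[OF \<nu> F] .
  have "(\<lambda>\<xi>. of_real ((pi / \<nu>) powr (1 / 2)) * C_psi2 F \<xi>) \<in> fock1 \<nu>"
    using fock_proj_eq(2)[OF \<nu> on_complex_L2[OF g(1)]] fock_proj_on_complex[OF \<nu> g(1)] g(2) by simp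
  from fock1_cmult[OF this, of "1 / of_real ((pi / \<nu>) powr (1 / 2))"] show ?thesis using \<nu> by simp
qed

text \<open>Both inverses are instances of \<open>inv_into\<close>, which says something only for
  elements of the image; hence the surjectivity statements come first.\<close>

lemma R_transform_props:
  assumes \<nu>: "\<nu> > 0" and F: "F \<in> fock \<nu>"
  shows "fock_proj \<nu> (on_complex (segal_bargmann_inv \<nu> F)) = (\<lambda>\<xi>. of_real ((pi / \<nu>) powr (1 / 2)) * C_psi2 F \<xi>)"
    and "fock_proj \<nu> (on_complex (segal_bargmann_inv \<nu> F)) \<in> segal_bargmann1 \<nu> ` L2 (gauss \<nu>)"
    and "R_transform \<nu> F \<in> L2 (gauss \<nu>)"
    and "segal_bargmann1 \<nu> (R_transform \<nu> F) = (\<lambda>\<xi>. of_real ((pi / \<nu>) powr (1 / 2)) * C_psi2 F \<xi>)"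
proof -
  have F1: "F \<in> segal_bargmann \<nu> ` L2 (gauss \<nu>)" using segal_bargmann_surj[OF \<nu> F] by blast
  have g: "segal_bargmann_inv \<nu> F \<in> L2 (gauss \<nu>)" "segal_bargmann \<nu> (segal_bargmann_inv \<nu> F) = F"
    unfolding segal_bargmann_inv_def L2w_eq_L2 using inv_into_into[OF F1] f_inv_into_f[OF F1] by auto
  let ?p = "fock_proj \<nu> (on_complex (segal_bargmann_inv \<nu> F))"
  show p: "?p = (\<lambda>\<xi>. of_real ((pi / \<nu>) powr (1 / 2)) * C_psi2 F \<xi>)"
    using fock_proj_on_complex[OF \<nu> g(1)] g(2) by simp
  have "?p \<in> fock1 \<nu>" by (rule fock_proj_eq(2)[OF \<nu> on_complex_L2[OF g(1)]])
  then obtain f where "f \<in> L2 (gauss \<nu>)" "segal_bargmann1 \<nu> f = ?p"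
    by (rule segal_bargmann1_surj[OF \<nu>]) (rule that)
  thus P: "?p \<in> segal_bargmann1 \<nu> ` L2 (gauss \<nu>)" by (intro rev_image_eqI[OF _ sym])
  show "R_transform \<nu> F \<in> L2 (gauss \<nu>)"
    unfolding R_transform_def segal_bargmann1_inv_def L2w_eq_L2 by (rule inv_into_into[OF P])
  show "segal_bargmann1 \<nu> (R_transform \<nu> F) = (\<lambda>\<xi>. of_real ((pi / \<nu>) powr (1 / 2)) * C_psi2 F \<xi>)"
    unfolding R_transform_def segal_bargmann1_inv_def L2w_eq_L2 f_inv_into_f[OF P] by (rule p)
qed

text \<open>Statements about R F are thereby checked on the holomorphic side, by comparing
  transforms.\<close>

lemma R_transform_unique:
  assumes \<nu>: "\<nu> > 0" and F: "F \<in> fock \<nu>" and f: "f \<in> L2 (gauss \<nu>)"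
    and eq: "\<And>\<xi>. segal_bargmann1 \<nu> f \<xi> = of_real ((pi / \<nu>) powr (1 / 2)) * C_psi2 F \<xi>"
  shows "AE x in lborel. R_transform \<nu> F x = f x"
  by (rule segal_bargmann1_inj[OF \<nu> R_transform_props(3)[OF \<nu> F] f])
     (simp add: fun_eq_iff eq R_transform_props(4)[OF \<nu> F])

section \<open>The explicit integral formula\<close>

lemma T_trunc_eq:
  assumes \<nu>: "\<nu> > 0" and F: "F \<in> fock \<nu>"
  shows "of_real ((pi / \<nu>) powr (1 / 2)) * coherent_kernel.T (gauss \<nu>) (sb1_kernel \<nu>) (trunc r (C_psi2 F)) x
     = of_real ((\<nu> / pi) powr (1 / 4)) * (LINT \<xi>:cball 0 r|lborel. R_integrand \<nu> F x \<xi>)"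
proof -
  interpret S: coherent_kernel "gauss \<nu>" "gauss \<nu>" "sb1_kernel \<nu>" "C1.K \<nu>" by (rule coherent_sb1[OF \<nu>])
  have \<phi>: "C_psi2 F \<in> L2 (gauss \<nu>)" using C_psi2_fock1[OF \<nu> F] by (simp add: fock1_iff)
  have [measurable]: "trunc r (C_psi2 F) \<in> borel_measurable borel"
    by (rule L2_gauss_measurable[OF trunc_L2[OF S.sets_N \<phi>]])
  have [measurable]: "(\<lambda>\<xi>. cnj (sb1_kernel \<nu> \<xi> x)) \<in> borel_measurable borel"
    unfolding sb1_kernel_def by (intro borel_measurable_continuous_onI continuous_intros)
  have k: "cnj (sb1_kernel \<nu> \<xi> x) = of_real ((\<nu> / pi) powr (3 / 4)) *
      exp (- complex_of_real (\<nu> / 2) * (cnj \<xi>)\<^sup>2 + complex_of_real (sqrt 2 * \<nu> * x) * cnj \<xi>)" for \<xi>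
    by (simp add: sb1_kernel_def exp_cnj algebra_simps)
  have "S.T (trunc r (C_psi2 F)) x = (LINT \<xi>|lborel. exp (- \<nu> * (norm \<xi>)\<^sup>2) *\<^sub>R (trunc r (C_psi2 F) \<xi> * cnj (sb1_kernel \<nu> \<xi> x)))"
    unfolding S.T_def by (rule integral_gauss) measurable
  also have "\<dots> = (LINT \<xi>|lborel. of_real ((\<nu> / pi) powr (3 / 4)) * (indicator (cball 0 r) \<xi> *\<^sub>R R_integrand \<nu> F x \<xi>))"
    unfolding k
    by (intro Bochner_Integration.integral_cong refl)
       (auto simp: trunc_def R_integrand_def C_psi2_def psi2_def scaleR_conv_of_real indicator_def)
  also have "\<dots> = of_real ((\<nu> / pi) powr (3 / 4)) * (LINT \<xi>:cball 0 r|lborel. R_integrand \<nu> F x \<xi>)"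
    unfolding set_lebesgue_integral_def by (rule Bochner_Integration.integral_mult_right_zero)
  finally have T: "S.T (trunc r (C_psi2 F)) x = \<dots>" .
  \<comment> \<open>The origin of the exponent 1/4: the factor of \<open>C_psi2\<close> contributes
    -1/2 and the kernel of the adjoint 3/4.\<close>
  have "(pi / \<nu>) powr (1 / 2) * (\<nu> / pi) powr (3 / 4) = (\<nu> / pi) powr (1 / 4)"
    using \<nu> by (simp add: pi_div_powr flip: powr_add)
  hence "complex_of_real ((pi / \<nu>) powr (1 / 2)) * of_real ((\<nu> / pi) powr (3 / 4)) = of_real ((\<nu> / pi) powr (1 / 4))"
    by (simp only: of_real_mult[symmetric])
  thus ?thesis unfolding T by (simp only: mult.assoc[symmetric])
qed

lemma LINT_cball_tendsto:
  fixes h :: "'a::euclidean_space \<Rightarrow> complex"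
  assumes "integrable lborel h"
  shows "(\<lambda>n. LINT \<xi>:cball 0 (real n)|lborel. h \<xi>) \<longlonglongrightarrow> (LINT \<xi>|lborel. h \<xi>)"
  unfolding set_lebesgue_integral_def
proof (rule integral_dominated_convergence)
  show "integrable lborel (\<lambda>\<xi>. norm (h \<xi>))" using assms by simp
  show "AE \<xi> in lborel. (\<lambda>n. indicator (cball 0 (real n)) \<xi> *\<^sub>R h \<xi>) \<longlonglongrightarrow> h \<xi>"
  proof (rule AE_I2)
    fix \<xi> :: 'a
    obtain n0 where "norm \<xi> \<le> real n0" using real_arch_simple by blast
    hence "\<forall>\<^sub>F n in sequentially. indicator (cball 0 (real n)) \<xi> *\<^sub>R h \<xi> = h \<xi>"
      by (intro eventually_sequentiallyI[of n0]) (auto simp: indicator_def)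
    thus "(\<lambda>n. indicator (cball 0 (real n)) \<xi> *\<^sub>R h \<xi>) \<longlonglongrightarrow> h \<xi>" by (rule tendsto_eventually)
  qed
qed (use assms in \<open>auto simp: indicator_def\<close>)

text \<open>The L2 limit is the tail estimate of \<open>segal_bargmann1_surj\<close>, scaled. Where
  the integrand is absolutely integrable, the disc integrals converge pointwise as well, and
  \<open>T_limit_AE\<close> forces the two limits to agree.\<close>

lemma R_transform_explicit:
  assumes \<nu>: "\<nu> > 0" and F: "F \<in> fock \<nu>"
  shows "((\<lambda>r. \<integral>\<^sup>+ x. ennreal ((norm (R_transform \<nu> F x -
                 complex_of_real ((\<nu> / pi) powr (1 / 4)) *
                 (LINT \<xi>:cball 0 r|lborel. R_integrand \<nu> F x \<xi>)))\<^sup>2 *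
               exp (- \<nu> * x\<^sup>2)) \<partial>lborel) \<longlongrightarrow> 0) at_top" (is ?lim)
    and "AE x in lborel. integrable lborel (R_integrand \<nu> F x) \<longrightarrow>
           R_transform \<nu> F x =
             complex_of_real ((\<nu> / pi) powr (1 / 4)) *
             (LINT \<xi>|lborel. R_integrand \<nu> F x \<xi>)" (is ?ae)
proof -
  interpret S: coherent_kernel "gauss \<nu>" "gauss \<nu>" "sb1_kernel \<nu>" "C1.K \<nu>" by (rule coherent_sb1[OF \<nu>])
  define \<phi> where "\<phi> = C_psi2 F"
  define c where "c = complex_of_real ((pi / \<nu>) powr (1 / 2))"
  have \<phi>1: "\<phi> \<in> fock1 \<nu>" unfolding \<phi>_def by (rule C_psi2_fock1[OF \<nu> F])
  hence \<phi>: "\<phi> \<in> L2 (gauss \<nu>)" by (simp add: fock1_iff)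
  obtain f where f: "f \<in> L2 (gauss \<nu>)" "segal_bargmann1 \<nu> f = \<phi>"
    "\<And>r. nsq (gauss \<nu>) (\<lambda>x. S.T (trunc r \<phi>) x - f x) \<le> 2 * nsq (gauss \<nu>) (\<lambda>z. \<phi> z - trunc r \<phi> z)"
    by (rule segal_bargmann1_surj[OF \<nu> \<phi>1]) (rule that)
  \<comment> \<open>f is the particular preimage approximated by the truncated adjoint, whereas
    \<open>R_transform\<close> picks an arbitrary one; they are related only almost
    everywhere.\<close>
  have RF: "AE x in lborel. R_transform \<nu> F x = c * f x"
    using segal_bargmann1_cmult[OF f(1)] f(2)
    by (intro R_transform_unique[OF \<nu> F] L2_cmult f) (simp add: c_def \<phi>_def)
  have TL2: "S.T (trunc r \<phi>) \<in> L2 (gauss \<nu>)" for r by (intro S.T_L2 trunc_L2_compact S.sets_N \<phi>)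
  have key: "of_real ((\<nu> / pi) powr (1 / 4)) * (LINT \<xi>:cball 0 r|lborel. R_integrand \<nu> F x \<xi>) = c * S.T (trunc r \<phi>) x" for r x
    using T_trunc_eq[OF \<nu> F] by (simp add: c_def \<phi>_def)
  have int: "(\<integral>\<^sup>+ x. ennreal ((norm (R_transform \<nu> F x - c * S.T (trunc r \<phi>) x))\<^sup>2 * exp (- \<nu> * x\<^sup>2)) \<partial>lborel)
      = ennreal ((norm c)\<^sup>2 * nsq (gauss \<nu>) (\<lambda>x. S.T (trunc r \<phi>) x - f x))" for r
  proof -
    have L: "(\<lambda>x. S.T (trunc r \<phi>) x - f x) \<in> L2 (gauss \<nu>)" by (intro L2_diff TL2 f)
    note [measurable] = L2_gauss_measurable[OF TL2[of r]] L2_gauss_measurable[OF f(1)]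
    have "(\<integral>\<^sup>+ x. ennreal ((norm (R_transform \<nu> F x - c * S.T (trunc r \<phi>) x))\<^sup>2 * exp (- \<nu> * x\<^sup>2)) \<partial>lborel)
        = (\<integral>\<^sup>+ x. ennreal (exp (- \<nu> * (norm x)\<^sup>2)) * ennreal ((norm c)\<^sup>2 * (norm (S.T (trunc r \<phi>) x - f x))\<^sup>2) \<partial>lborel)"
    proof (rule nn_integral_cong_AE, use RF in eventually_elim)
      case (elim x)
      have "norm (c * f x - c * S.T (trunc r \<phi>) x) = norm c * norm (S.T (trunc r \<phi>) x - f x)"
        by (simp add: norm_mult norm_minus_commute flip: right_diff_distrib)
      thus ?case by (simp add: elim power_mult_distrib ennreal_mult[symmetric] mult.commute)
    qed
    also have "\<dots> = (\<integral>\<^sup>+ x. ennreal ((norm c)\<^sup>2 * (norm (S.T (trunc r \<phi>) x - f x))\<^sup>2) \<partial>gauss \<nu>)"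
      unfolding gauss_def[where 'a = real] by (rule nn_integral_density[symmetric]) measurable
    also have "\<dots> = ennreal (LINT x|gauss \<nu>. (norm c)\<^sup>2 * (norm (S.T (trunc r \<phi>) x - f x))\<^sup>2)"
      using L2_integrable[OF L] by (intro nn_integral_eq_integral) auto
    finally show ?thesis by (simp add: nsq_def)
  qed
  have "((\<lambda>r. (norm c)\<^sup>2 * nsq (gauss \<nu>) (\<lambda>x. S.T (trunc r \<phi>) x - f x)) \<longlongrightarrow> 0) at_top"
  proof (rule tendsto_sandwich[OF _ _ tendsto_const])
    have "((\<lambda>r. (norm c)\<^sup>2 * (2 * nsq (gauss \<nu>) (\<lambda>z. \<phi> z - trunc r \<phi> z))) \<longlongrightarrow> (norm c)\<^sup>2 * (2 * 0)) at_top"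
      by (intro tendsto_intros nsq_trunc_tail_tendsto_0 S.sets_N \<phi>)
    thus "((\<lambda>r. (norm c)\<^sup>2 * (2 * nsq (gauss \<nu>) (\<lambda>z. \<phi> z - trunc r \<phi> z))) \<longlongrightarrow> 0) at_top" by simp
    show "\<forall>\<^sub>F r in at_top. (norm c)\<^sup>2 * nsq (gauss \<nu>) (\<lambda>x. S.T (trunc r \<phi>) x - f x)
        \<le> (norm c)\<^sup>2 * (2 * nsq (gauss \<nu>) (\<lambda>z. \<phi> z - trunc r \<phi> z))"
      by (intro always_eventually allI mult_left_mono f) simp
  qed simp
  from tendsto_ennrealI[OF this] show ?lim by (simp only: key int ennreal_0)
  have "AE x in lborel. \<forall>y. (\<lambda>n. S.T (trunc (real n) \<phi>) x) \<longlonglongrightarrow> y \<longrightarrow> f x = y"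
    using S.T_limit_AE[OF \<phi> f(1,3)] by (simp add: AE_gauss_iff)
  with RF show ?ae
  proof eventually_elim
    case (elim x)
    show ?case
    proof
      assume i: "integrable lborel (R_integrand \<nu> F x)"
      have c0: "c \<noteq> 0" using \<nu> by (simp add: c_def)
      let ?I = "of_real ((\<nu> / pi) powr (1 / 4)) * (LINT \<xi>|lborel. R_integrand \<nu> F x \<xi>)"
      have "(\<lambda>n. c * S.T (trunc (real n) \<phi>) x) \<longlonglongrightarrow> ?I"
        unfolding key[symmetric] by (intro tendsto_intros LINT_cball_tendsto i)
      hence "(\<lambda>n. (c * S.T (trunc (real n) \<phi>) x) / c) \<longlonglongrightarrow> ?I / c"
        using c0 by (intro tendsto_divide tendsto_const)
      hence "f x = ?I / c" using elim(2) c0 by simp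
      thus "R_transform \<nu> F x = ?I" using elim(1) c0 by simp
    qed
  qed
qed

theorem theorem2p6:
  fixes \<nu> :: real
  assumes "\<nu> > 0"
  shows
    "(\<forall>F\<in>fock \<nu>.
        F \<in> segal_bargmann \<nu> ` L2w \<nu> \<and>
        fock_proj \<nu> (on_complex (segal_bargmann_inv \<nu> F)) \<in> segal_bargmann1 \<nu> ` L2w \<nu> \<and>
        R_transform \<nu> F \<in> L2w \<nu> \<and>
        (\<forall>g\<in>L2w \<nu>. \<forall>f\<in>L2w \<nu>.
           segal_bargmann \<nu> g = F \<and> segal_bargmann1 \<nu> f = fock_proj \<nu> (on_complex g) \<longrightarrow>
           (AE x in lborel. f x = R_transform \<nu> F x))) \<and>
     (\<forall>f\<in>L2w \<nu>.
        G_transform \<nu> f \<in> fock \<nu> \<and>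
        (AE x in lborel. R_transform \<nu> (G_transform \<nu> f) x = f x)) \<and>
     (\<forall>F\<in>fock \<nu>.
        C_psi2 F \<in> fock1 \<nu> \<and>
        C_psi2 F \<in> segal_bargmann1 \<nu> ` L2w \<nu> \<and>
        (AE x in lborel. R_transform \<nu> F x =
           complex_of_real ((pi / \<nu>) powr (1 / 2)) * segal_bargmann1_inv \<nu> (C_psi2 F) x)) \<and>
     (\<forall>F\<in>fock \<nu>.
        ((\<lambda>r. \<integral>\<^sup>+ x. ennreal ((norm (R_transform \<nu> F x -
                 complex_of_real ((\<nu> / pi) powr (1 / 4)) *
                 (LINT \<xi>:cball 0 r|lborel. R_integrand \<nu> F x \<xi>)))\<^sup>2 *
               exp (- \<nu> * x\<^sup>2)) \<partial>lborel) \<longlongrightarrow> 0) at_top \<and>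
        (AE x in lborel. integrable lborel (R_integrand \<nu> F x) \<longrightarrow>
           R_transform \<nu> F x =
             complex_of_real ((\<nu> / pi) powr (1 / 4)) *
             (LINT \<xi>|lborel. R_integrand \<nu> F x \<xi>)))"
proof (intro conjI ballI impI)
  note \<nu> = assms
  {
    fix F :: "complex^2 \<Rightarrow> complex" assume F: "F \<in> fock \<nu>"
    note R = R_transform_props[OF \<nu> F]
    show "F \<in> segal_bargmann \<nu> ` L2w \<nu>"
      using segal_bargmann_surj[OF \<nu> F] unfolding L2w_eq_L2 by blast
    show "fock_proj \<nu> (on_complex (segal_bargmann_inv \<nu> F)) \<in> segal_bargmann1 \<nu> ` L2w \<nu>"
      unfolding L2w_eq_L2 by (rule R(2))
    show "R_transform \<nu> F \<in> L2w \<nu>"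
      unfolding L2w_eq_L2 by (rule R(3))
    show "AE x in lborel. f x = R_transform \<nu> F x"
      if "g \<in> L2w \<nu>" "f \<in> L2w \<nu>"
        "segal_bargmann \<nu> g = F \<and> segal_bargmann1 \<nu> f = fock_proj \<nu> (on_complex g)" for f g
    proof -
      \<comment> \<open>The preimage g is arbitrary: its projection is determined by F through
        \<open>psi2\<close>.\<close>
      have "AE x in lborel. R_transform \<nu> F x = f x"
        using that fock_proj_on_complex[OF \<nu>, of g] unfolding L2w_eq_L2
        by (intro R_transform_unique[OF \<nu> F]) auto
      thus ?thesis by eventually_elim simp
    qed
    show \<phi>: "C_psi2 F \<in> fock1 \<nu>" by (rule C_psi2_fock1[OF \<nu> F])
    obtain f where "f \<in> L2 (gauss \<nu>)" "segal_bargmann1 \<nu> f = C_psi2 F"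
      by (rule segal_bargmann1_surj[OF \<nu> \<phi>]) (rule that)
    thus im: "C_psi2 F \<in> segal_bargmann1 \<nu> ` L2w \<nu>"
      unfolding L2w_eq_L2 by (intro rev_image_eqI[OF _ sym])
    have i: "segal_bargmann1_inv \<nu> (C_psi2 F) \<in> L2 (gauss \<nu>)"
      "segal_bargmann1 \<nu> (segal_bargmann1_inv \<nu> (C_psi2 F)) = C_psi2 F"
      using inv_into_into[OF im] f_inv_into_f[OF im] by (auto simp: segal_bargmann1_inv_def L2w_eq_L2)
    show "AE x in lborel. R_transform \<nu> F x =
           complex_of_real ((pi / \<nu>) powr (1 / 2)) * segal_bargmann1_inv \<nu> (C_psi2 F) x"
      by (intro R_transform_unique[OF \<nu> F] L2_cmult i) (simp add: segal_bargmann1_cmult[OF i(1)] i(2))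
    note R_transform_explicit[OF \<nu> F]
    thus "((\<lambda>r. \<integral>\<^sup>+ x. ennreal ((norm (R_transform \<nu> F x -
                 complex_of_real ((\<nu> / pi) powr (1 / 4)) *
                 (LINT \<xi>:cball 0 r|lborel. R_integrand \<nu> F x \<xi>)))\<^sup>2 *
               exp (- \<nu> * x\<^sup>2)) \<partial>lborel) \<longlongrightarrow> 0) at_top"
      "AE x in lborel. integrable lborel (R_integrand \<nu> F x) \<longrightarrow>
           R_transform \<nu> F x =
             complex_of_real ((\<nu> / pi) powr (1 / 4)) *
             (LINT \<xi>|lborel. R_integrand \<nu> F x \<xi>)" .
  }
  fix f :: "real \<Rightarrow> complex" assume "f \<in> L2w \<nu>"
  hence f: "f \<in> L2 (gauss \<nu>)" by (simp add: L2w_eq_L2)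
  show G: "G_transform \<nu> f \<in> fock \<nu>" by (rule G_transform_fock[OF \<nu> f])
  \<comment> \<open>The constant of R cancels the one that G brings along on the image of
    \<open>psi2\<close>.\<close>
  have "(pi / \<nu>) powr (1 / 2) * (\<nu> / pi) powr (1 / 2) = 1"
    using \<nu> by (simp add: pi_div_powr flip: powr_add)
  hence "complex_of_real ((pi / \<nu>) powr (1 / 2)) * of_real ((\<nu> / pi) powr (1 / 2)) = 1"
    by (simp only: of_real_mult[symmetric] of_real_1)
  thus "AE x in lborel. R_transform \<nu> (G_transform \<nu> f) x = f x"
    by (intro R_transform_unique[OF \<nu> G f]) (simp only: C_psi2_G_transform mult.assoc[symmetric] mult_1_left)
qed

end
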